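(* Let $\rho=e^{\pi i/3}$, let $\mathfrak{z}\in\{i,\rho\}$, and let $F\in\mathcal{M}_{\mathfrak{z},3}$. Then, for $z=x+iy\in\mathbb{H}$ with $y>\mathfrak{z}_2:=\operatorname{Im}(\mathfrak{z})$, $F$ has a Fourier expansion which is a linear combination (over $\mathbb{C}$) of the expansions $F_{2k\omega_{\mathfrak{z}},\ell,r}(\mathfrak{z};q)$ with $k\in\mathbb{N}$, $\ell\in\mathbb{N}_0$, and $r\in\mathbb{N}_0$.
   Context: Notation: $\mathbb{H}$ is the complex upper half-plane, $q=e^{2\pi i z}$, $e(\alpha):=e^{2\pi i\alpha}$, $\rho=e^{\pi i/3}$, $\mathfrak{z}=\mathfrak{z}_1+i\mathfrak{z}_2$ with $\mathfrak{z}_1,\mathfrak{z}_2\in\mathbb{R}$. $\omega_{\mathfrak{z}}$ is the size of the stabilizer of $\mathfrak{z}$ in $\mathrm{PSL}_2(\mathbb{Z})$ (so $\omega_i=2$, $\omega_\rho=3$). $\mathcal{M}_{\mathfrak{z},\nu}$ denotes the space of negative (integral) weight meromorphic modular forms for $\mathrm{SL}_2(\mathbb{Z})$ whose only poles modulo $\mathrm{SL}_2(\mathbb{Z})$ are at the point $z=\mathfrak{z}$ and have order at most $\nu$ (in particular there is no pole at $i\infty$). For $\mathfrak{z}\in\{i,\rho\}$, $\mathcal{O}_{\mathbb{Q}(\mathfrak{z})}=\mathbb{Z}[\mathfrak{z}]$ is the ring of integers of $\mathbb{Q}(\mathfrak{z})$ and $N$ is the norm. A nonzero ideal is primitive if it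 is not divisible by any principal ideal $(g)$ with $g\in\mathbb{Z}$, $|g|>1$; $\sum^{*}_{\mathfrak{b}\subseteq\mathcal{O}_{\mathbb{Q}(\mathfrak{z})}}$ denotes the sum over primitive ideals. Every primitive ideal is $\mathfrak{b}=(c\mathfrak{z}+d)$ with $c,d\in\mathbb{Z}$, $\gcd(c,d)=1$. For $n\in\mathbb{N}_0$ and $k\in\mathbb{N}$ divisible by $2\omega_{\mathfrak{z}}$, choosing $a,b\in\mathbb{Z}$ with $ad-bc=1$, put $$C_k(\mathfrak{b},n):=\operatorname{Re}\, e\!\left(-\frac{n}{N(\mathfrak{b})}\left(ac|\mathfrak{z}|^2+bd+\mathfrak{z}_1(ad+bc)\right)-\frac{k}{2\pi}\arg(c\mathfrak{z}+d)\right),$$ which does not depend on the choices made. For such $k$ and $\ell,r\in\mathbb{N}_0$ (with $0^0:=1$), $$F_{k,\ell,r}(\mathfrak{z};q):=\sum_{n=0}^{\infty}\ \sum^{*}_{\mathfrak{b}\subseteq\mathcal{O}_{\mathbb{Q}(\mathfrak{z})}}\frac{C_k(\mathfrak{b},n)}{N(\mathfrak{b})^{\frac{k}{2}-\ell}}\,n^r e^{\frac{2\pi n}{N(\mathfrak{b})}\mathfrak{z}_2}q^n.$$ *)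

theory Defs
  imports
    "HOL-Complex_Analysis.Complex_Analysis"
    "HOL-Algebra.QuotRing"
    "HOL-Algebra.Ideal_Product"
begin

definition rho :: complex
  where "rho = exp (pi * \<i> / 3)"

definition e :: "real \<Rightarrow> complex"
  where "e \<alpha> = exp (2 * pi * \<i> * \<alpha>)"

definition upper_half_plane :: "complex set"
  where "upper_half_plane = {z. Im z > 0}"

subsection \<open>The modular group\<close>

definition SL2Z :: "(int ^ 2 ^ 2) set"
  where "SL2Z = {M. det M = 1}"

definition moebius_act :: "int ^ 2 ^ 2 \<Rightarrow> complex \<Rightarrow> complex"
  where "moebius_act M =
    moebius (of_int (M $ 1 $ 1)) (of_int (M $ 1 $ 2)) (of_int (M $ 2 $ 1)) (of_int (M $ 2 $ 2))"

definition automorphy :: "int ^ 2 ^ 2 \<Rightarrow> complex \<Rightarrow> complex"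
  where "automorphy M z = of_int (M $ 2 $ 1) * z + of_int (M $ 2 $ 2)"

text \<open>An element of the projective group is represented by its class \<open>{M, - M}\<close> in \<open>SL2Z\<close>.\<close>

definition PSL2Z :: "(int ^ 2 ^ 2) set set"
  where "PSL2Z = (\<lambda>M. {M, - M}) ` SL2Z"

definition omega :: "complex \<Rightarrow> nat"
  where "omega \<zz> = card {P \<in> PSL2Z. \<forall>M\<in>P. moebius_act M \<zz> = \<zz>}"

subsection \<open>Meromorphic modular forms\<close>

text \<open>
  The predicate \<open>nicely_meromorphic_on\<close> excludes removable singularities and fixes the value
  \<open>0\<close> at poles; with this convention the transformation law can be required at every point of
  the upper half-plane, poles included.  The last condition says that \<open>F\<close> is a function of
  \<open>q = exp (2 \<pi> i z)\<close> near \<open>i\<infinity>\<close> which is regular at \<open>q = 0\<close>, i.e. that \<open>i\<infinity>\<close> is not a pole.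
\<close>

definition meromorphic_modular_form :: "int \<Rightarrow> (complex \<Rightarrow> complex) \<Rightarrow> bool"
  where "meromorphic_modular_form w F \<longleftrightarrow>
    F nicely_meromorphic_on upper_half_plane \<and>
    (\<forall>M\<in>SL2Z. \<forall>z\<in>upper_half_plane. F (moebius_act M z) = automorphy M z powi w * F z) \<and>
    (\<exists>g Y. g meromorphic_on {0} \<and> (\<forall>z. Im z > Y \<longrightarrow> F z = g (exp (2 * pi * \<i> * z))))"

definition no_pole_at_cusp :: "(complex \<Rightarrow> complex) \<Rightarrow> bool"
  where "no_pole_at_cusp F \<longleftrightarrow>
    (\<exists>g Y. g analytic_on {0} \<and> (\<forall>z. Im z > Y \<longrightarrow> F z = g (exp (2 * pi * \<i> * z))))"

definition M_space :: "complex \<Rightarrow> nat \<Rightarrow> (complex \<Rightarrow> complex) set"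
  where "M_space \<zz> \<nu> = {F.
    (\<exists>w<0. meromorphic_modular_form w F) \<and>
    no_pole_at_cusp F \<and>
    (\<forall>z\<in>upper_half_plane. is_pole F z \<longrightarrow>
       (\<exists>M\<in>SL2Z. z = moebius_act M \<zz>) \<and> - zorder F z \<le> int \<nu>)}"

subsection \<open>Primitive ideals\<close>

text \<open>For \<open>\<zz> \<in> {\<i>, rho}\<close> the number \<open>\<zz>\<close> is a quadratic integer, so that this is \<open>\<int>[\<zz>]\<close>.\<close>

definition int_ring :: "complex \<Rightarrow> complex ring"
  where "int_ring \<zz> =
    \<lparr>carrier = {of_int m + of_int n * \<zz> | m n. True}, monoid.mult = (*), one = 1,
     ring.zero = 0, add = (+)\<rparr>"

definition ideal_norm :: "complex \<Rightarrow> complex set \<Rightarrow> nat"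
  where "ideal_norm \<zz> \<bb> = card (carrier (int_ring \<zz> Quot \<bb>))"

definition divisible_by :: "complex \<Rightarrow> complex set \<Rightarrow> complex set \<Rightarrow> bool"
  where "divisible_by \<zz> \<bb> \<aa> \<longleftrightarrow>
    (\<exists>\<cc>. ideal \<cc> (int_ring \<zz>) \<and> \<bb> = ideal_prod (int_ring \<zz>) \<aa> \<cc>)"

definition primitive_ideals :: "complex \<Rightarrow> complex set set"
  where "primitive_ideals \<zz> = {\<bb>. ideal \<bb> (int_ring \<zz>) \<and> \<bb> \<noteq> {0} \<and>
    \<not> (\<exists>g::int. \<bar>g\<bar> > 1 \<and> divisible_by \<zz> \<bb> (PIdl\<^bsub>int_ring \<zz>\<^esub> (of_int g)))}"

subsection \<open>The expansions\<close>

text \<open>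
  The generator \<open>c \<zz> + d\<close> of \<open>\<bb>\<close> and the completion \<open>a, b\<close> of its coefficients are chosen together,
  as a matrix \<open>(a, b; c, d)\<close> of determinant one.  The value of \<open>C_coeff\<close> does not depend on the
  choice when \<open>k\<close> is divisible by \<open>2 * omega \<zz>\<close>; otherwise it is meaningless.
\<close>

definition ideal_matrix :: "complex \<Rightarrow> complex set \<Rightarrow> int ^ 2 ^ 2"
  where "ideal_matrix \<zz> \<bb> =
    (SOME M. M \<in> SL2Z \<and> \<bb> = PIdl\<^bsub>int_ring \<zz>\<^esub> (automorphy M \<zz>))"

definition C_coeff :: "nat \<Rightarrow> complex \<Rightarrow> complex set \<Rightarrow> nat \<Rightarrow> real"
  where "C_coeff k \<zz> \<bb> n =
    (let M = ideal_matrix \<zz> \<bb>;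
         a = real_of_int (M $ 1 $ 1); b = real_of_int (M $ 1 $ 2);
         c = real_of_int (M $ 2 $ 1); d = real_of_int (M $ 2 $ 2)
     in Re (e (- (real n / real (ideal_norm \<zz> \<bb>)) *
                  (a * c * (cmod \<zz>)\<^sup>2 + b * d + Re \<zz> * (a * d + b * c))
               - real k / (2 * pi) * Arg (of_real c * \<zz> + of_real d))))"

definition F_term :: "nat \<Rightarrow> nat \<Rightarrow> nat \<Rightarrow> complex \<Rightarrow> nat \<Rightarrow> complex set \<Rightarrow> real"
  where "F_term k l r \<zz> n \<bb> =
    C_coeff k \<zz> \<bb> n / real (ideal_norm \<zz> \<bb>) powr (real k / 2 - real l) *
    real n ^ r * exp (2 * pi * real n / real (ideal_norm \<zz> \<bb>) * Im \<zz>)"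

definition F_coeff :: "nat \<Rightarrow> nat \<Rightarrow> nat \<Rightarrow> complex \<Rightarrow> nat \<Rightarrow> real"
  where "F_coeff k l r \<zz> n = (\<Sum>\<^sub>\<infinity>\<bb>\<in>primitive_ideals \<zz>. F_term k l r \<zz> n \<bb>)"

definition F_series :: "nat \<Rightarrow> nat \<Rightarrow> nat \<Rightarrow> complex \<Rightarrow> complex \<Rightarrow> complex"
  where "F_series k l r \<zz> q = (\<Sum>n. of_real (F_coeff k l r \<zz> n) * q ^ n)"

text \<open>
  Both \<open>infsum\<close> and \<open>suminf\<close> are total, so convergence of the double series has to be
  stated separately.
\<close>

definition F_converges :: "nat \<Rightarrow> nat \<Rightarrow> nat \<Rightarrow> complex \<Rightarrow> complex \<Rightarrow> bool"
  where "F_converges k l r \<zz> q \<longleftrightarrow>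
    (\<forall>n. F_term k l r \<zz> n summable_on primitive_ideals \<zz>) \<and>
    summable (\<lambda>n. of_real (F_coeff k l r \<zz> n) * q ^ n)"

end

theory Submission
  imports Defs
begin

text \<open>
  The proof evaluates the Fourier coefficients of \<open>F\<close> by pairing \<open>F\<close> with Poincare series. Let
  \<open>F\<close> have weight \<open>- m\<close>. If \<open>m\<close> is odd, then the matrix \<open>- 1\<close> shows that \<open>F = 0\<close>, so let \<open>m\<close>
  be even, hence \<open>m \<ge> 2\<close>. For every \<open>n\<close> the Poincare series \<open>Q\<^sub>n\<close> of weight \<open>m + 2\<close>, the sum
  of \<open>(c z + d) ^ (- m - 2) * exp (- 2 \<pi> i n M z)\<close> over all coprime pairs \<open>(c, d)\<close>, where \<open>M\<close>
  is any matrix of determinant one with bottom row \<open>(c, d)\<close>, converges absolutely. The product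
  \<open>F Q\<^sub>n\<close> has weight two, which means that \<open>F Q\<^sub>n dz\<close> is an invariant differential. Its only
  poles are the points of the orbit of \<open>\<zz>\<close>, and at the cusp \<open>Q\<^sub>n\<close> is close to
  \<open>2 exp (- 2 \<pi> i n z)\<close>. The residue theorem on the modular curve therefore expresses the
  \<open>n\<close>-th Fourier coefficient \<open>c\<^sub>n\<close> of \<open>F\<close> by a residue (\<open>fourier_coefficient_eq_residue\<close>):
  \<open>2 c\<^sub>n = - (2 \<pi> i / \<omega>) Res (F Q\<^sub>n, \<zz>)\<close>. The proof of this formula replaces the contour
  around a fundamental domain by primitives on a half-strip and their behaviour under the
  elliptic element that fixes \<open>\<zz>\<close>.

  The residue is the sum of the residues of \<open>F\<close> times the single terms of \<open>Q\<^sub>n\<close>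
  (\<open>residue_mult_poincare_has_sum\<close>). The principal part of \<open>F\<close> at \<open>\<zz>\<close> can be written as a
  combination of the functions \<open>(z - cnj \<zz>) ^ (m + \<nu>) / (z - \<zz>) ^ \<nu>\<close>, and these are chosen
  such that the substitution of \<open>M z\<close> for \<open>z\<close> leads to the same kind of function at the orbit
  point \<open>M \<zz>\<close>. With \<open>k = 2 \<nu> + m\<close>, each term becomes a combination, with constants that depend
  on neither \<open>n\<close> nor \<open>(c, d)\<close>, of the terms \<open>N ^ (l - k / 2) * n ^ r * exp (2 \<pi> n Im \<zz> / N)\<close>,
  where \<open>N = \<bar>c \<zz> + d\<bar>\<^sup>2\<close> and \<open>l + r = \<nu> - 1\<close>, times a phase (\<open>residue_mult_poincare_term\<close>).

  It remains to pass from coprime pairs to primitive ideals. As \<open>\<int>[\<zz>]\<close> is Euclidean, the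
  primitive ideals are generated by the numbers \<open>c \<zz> + d\<close> with coprime \<open>c\<close> and \<open>d\<close>; their norm
  is \<open>\<bar>c \<zz> + d\<bar>\<^sup>2\<close>, and each has \<open>2 \<omega>\<close> such generators, one for every unit
  (\<open>bij_betw_ideals_units\<close>, \<open>ideal_norm_gen\<close>). Multiplication of all pairs by the unit \<open>\<zz>\<close>
  shows that the sum over the pairs is zero unless \<open>2 \<omega>\<close> divides \<open>k\<close>, and complex conjugation
  shows that it is real, so that only the real parts of the phases survive, which are the
  numbers \<^const>\<open>C_coeff\<close> (\<open>theta_sum_eq_0\<close>, \<open>theta_sum_ideals\<close>). Consequently \<open>c\<^sub>n\<close> is a linear
  combination of the \<open>n\<close>-th coefficients of the expansions, with constants independent of \<open>n\<close>.
  All of them satisfy \<open>k / 2 - l \<ge> 2\<close>, which gives convergence for \<open>Im z > Im \<zz>\<close>, and the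
  identity theorem extends the equality from a neighbourhood of the cusp to this half-plane
  (\<open>M_space_expansion\<close>).
\<close>

section \<open>Principal parts, primitives and residues\<close>

text \<open>
  The pole is peeled off one order at a time: after subtraction of a suitable multiple of
  \<open>g K / (z - z0) ^ K\<close> the numerator vanishes at \<open>z0\<close>, which lowers the order by one. The
  family \<open>g\<close> is kept arbitrary so that principal parts can be written in functions that are
  adapted to the modular group.
\<close>
lemma principal_part:
  fixes f :: "complex \<Rightarrow> complex" and g :: "nat \<Rightarrow> complex \<Rightarrow> complex"
  assumes V: "open V" "z0 \<in> V" and f: "f holomorphic_on V - {z0}" "not_essential f z0"
    and g: "\<And>j. g j holomorphic_on V" "\<And>j. g j z0 \<noteq> 0"
  obtains K a h where "h holomorphic_on V"
    "\<And>z. z \<in> V - {z0} \<Longrightarrow> f z = (\<Sum>j=1..K. a j * g j z / (z - z0) ^ j) + h z"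
proof -
  have step: "\<exists>a h. h holomorphic_on V \<and>
      (\<forall>z\<in>V - {z0}. u z / (z - z0) ^ K = (\<Sum>j=1..K. a j * g j z / (z - z0) ^ j) + h z)"
    if "u holomorphic_on V" for u :: "complex \<Rightarrow> complex" and K :: nat
    using that
  proof (induction K arbitrary: u)
    case 0
    then show ?case by auto
  next
    case (Suc K)
    define b where "b = u z0 / g (Suc K) z0"
    define d where "d = (\<lambda>z. u z - b * g (Suc K) z)"
    have "d holomorphic_on V"
      unfolding d_def by (intro holomorphic_intros Suc g)
    then have "(\<lambda>z. if z = z0 then deriv d z0 else (d z - d z0) / (z - z0)) holomorphic_on V"
      by (rule pole_lemma_open) fact
    from Suc.IH[OF this] obtain a h where h: "h holomorphic_on V"
      and a: "\<And>z. z \<in> V - {z0} \<Longrightarrow> (d z - d z0) / (z - z0) / (z - z0) ^ K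
        = (\<Sum>j=1..K. a j * g j z / (z - z0) ^ j) + h z"
      by force
    have d0: "d z0 = 0"
      unfolding d_def b_def using g(2) by simp
    have "u z / (z - z0) ^ Suc K = (\<Sum>j=1..Suc K. (a(Suc K := b)) j * g j z / (z - z0) ^ j) + h z"
      if "z \<in> V - {z0}" for z
    proof -
      have "u z / (z - z0) ^ Suc K = d z / (z - z0) / (z - z0) ^ K + b * g (Suc K) z / (z - z0) ^ Suc K"
        using that unfolding d_def by (simp add: divide_simps)
      also have "\<dots> = (\<Sum>j=1..K. (a(Suc K := b)) j * g j z / (z - z0) ^ j) + h z + b * g (Suc K) z / (z - z0) ^ Suc K"
        using a[OF that] d0 by simp
      finally show ?thesis by simp
    qed
    with h show ?case by blast
  qed
  obtain n L where L: "(\<lambda>z. (z - z0) ^ n * f z) \<midarrow>z0\<rightarrow> L"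
  proof (cases "is_pole f z0")
    case True
    from zorder_exist_pole[OF f(1) V True] obtain r where r: "r > 0"
      "zor_poly f z0 holomorphic_on cball z0 r"
      "\<And>w. w \<in> cball z0 r - {z0} \<Longrightarrow> f w = zor_poly f z0 w / (w - z0) ^ nat (- zorder f z0)"
      by blast
    have "isCont (zor_poly f z0) z0"
      using r(1,2) by (metis ball_subset_cball centre_in_ball continuous_on_eq_continuous_at
        holomorphic_on_imp_continuous_on holomorphic_on_subset open_ball)
    then have "zor_poly f z0 \<midarrow>z0\<rightarrow> zor_poly f z0 z0"
      by (simp add: isCont_def)
    moreover have "\<forall>\<^sub>F z in at z0. zor_poly f z0 z = (z - z0) ^ nat (- zorder f z0) * f z"
      using r(1,3) by (auto simp: eventually_at intro!: exI[of _ r] simp: dist_commute)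
    ultimately show ?thesis
      by (rule that[OF Lim_transform_eventually])
  next
    case False
    with f(2) obtain x where "f \<midarrow>z0\<rightarrow> x"
      unfolding not_essential_def by blast
    then show ?thesis using that[of 0] by simp
  qed
  define u where "u = (\<lambda>z. if z = z0 then L else (z - z0) ^ n * f z)"
  have "u holomorphic_on V"
  proof (rule no_isolated_singularity'[where K = "{z0}"])
    have "\<forall>\<^sub>F z in at z0. (z - z0) ^ n * f z = u z"
      by (auto simp: u_def eventually_at intro: exI[of _ 1])
    then have "u \<midarrow>z0\<rightarrow> u z0"
      using Lim_transform_eventually[OF L] by (simp add: u_def)
    then show "(u \<longlongrightarrow> u z) (at z within V)" if "z \<in> {z0}" for z
      using that Lim_at_imp_Lim_at_within by auto
    have "(\<lambda>z. (z - z0) ^ n * f z) holomorphic_on V - {z0}"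
      by (intro holomorphic_intros f)
    then show "u holomorphic_on V - {z0}"
      by (rule holomorphic_transform) (auto simp: u_def)
  qed (use V in auto)
  from step[OF this, of n] obtain a h where "h holomorphic_on V"
    "\<And>z. z \<in> V - {z0} \<Longrightarrow> u z / (z - z0) ^ n = (\<Sum>j=1..n. a j * g j z / (z - z0) ^ j) + h z"
    by blast
  then show ?thesis
    using that[of h a n] by (simp add: u_def)
qed

text \<open>
  A derivative integrates to zero over a small circle.
\<close>
lemma residue_derivative_eq_0:
  assumes "open V" "z0 \<in> V" "\<And>z. z \<in> V - {z0} \<Longrightarrow> (\<Phi> has_field_derivative f z) (at z)"
  shows "residue f z0 = 0"
proof -
  obtain r where r: "r > 0" "cball z0 r \<subseteq> V"
    using assms(1,2) open_contains_cball by blast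
  have hol: "\<Phi> holomorphic_on V - {z0}"
    using assms(1,3) by (auto simp: holomorphic_on_open open_Diff)
  then have "deriv \<Phi> holomorphic_on V - {z0}"
    using assms(1) by (intro holomorphic_deriv) (auto intro: open_Diff)
  then have "f holomorphic_on V - {z0}"
    by (rule holomorphic_transform) (use assms(3) DERIV_imp_deriv in blast)
  then have "(f has_contour_integral 2 * pi * \<i> * residue f z0) (circlepath z0 r)"
    by (rule base_residue[OF assms(1,2) r(1) _ r(2)])
  moreover have "(f has_contour_integral (\<Phi> (pathfinish (circlepath z0 r)) - \<Phi> (pathstart (circlepath z0 r))))
      (circlepath z0 r)"
  proof (rule contour_integral_primitive[where S = "V - {z0}"])
    show "path_image (circlepath z0 r) \<subseteq> V - {z0}"
      using r by (auto simp: path_image_circlepath)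
  qed (use assms(3) in \<open>auto intro: has_field_derivative_at_within\<close>)
  ultimately show ?thesis
    using has_contour_integral_unique by fastforce
qed

text \<open>
  The regular part has a primitive because \<open>V\<close> is convex, and so has every polar term of order
  at least two. What is left is a simple pole, whose coefficient has to be the residue because
  derivatives have residue zero.
\<close>
lemma meromorphic_primitive:
  assumes V: "open V" "convex V" "z0 \<in> V" and f: "f holomorphic_on V - {z0}" "not_essential f z0"
  obtains \<Phi> where "\<And>z. z \<in> V - {z0} \<Longrightarrow>
    (\<Phi> has_field_derivative f z - residue f z0 / (z - z0)) (at z)"
proof -
  obtain K a h where h: "h holomorphic_on V"
    and a: "\<And>z. z \<in> V - {z0} \<Longrightarrow> f z = (\<Sum>j=1..K. a j / (z - z0) ^ j) + h z"
    by (rule principal_part[OF V(1,3) f, of "\<lambda>_ _. 1"]) auto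
  obtain H where H: "\<And>z. z \<in> V \<Longrightarrow> (H has_field_derivative h z) (at z)"
    using holomorphic_convex_primitive'[OF V(2) V(1) h] V(1) at_within_open[of _ V] by metis
  define b where "b = (if K = 0 then 0 else a 1)"
  define \<Phi> where "\<Phi> = (\<lambda>z. H z - (\<Sum>j=2..K. a j / (of_nat (j - 1) * (z - z0) ^ (j - 1))))"
  have \<Phi>: "(\<Phi> has_field_derivative f z - b / (z - z0)) (at z)" if z: "z \<in> V - {z0}" for z
  proof -
    have nz: "z - z0 \<noteq> 0" using z by auto
    have pw: "((\<lambda>z. a j / (of_nat (j - 1) * (z - z0) ^ (j - 1))) has_field_derivative
        - a j / (z - z0) ^ j) (at z)" if j: "j \<in> {2..K}" for j
    proof -
      from j obtain i where i: "j = Suc (Suc i)"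
        by (metis Suc_1 Suc_diff_le add_Suc atLeastAtMost_iff ordered_cancel_comm_monoid_diff_class.add_diff_inverse plus_1_eq_Suc)
      have "((\<lambda>z. a j / of_nat (Suc i) * inverse (z - z0) ^ Suc i) has_field_derivative
          a j / of_nat (Suc i) * (of_nat (Suc i) * (- (inverse (z - z0) * 1 * inverse (z - z0))) * inverse (z - z0) ^ i)) (at z)"
        using nz by (intro DERIV_cmult DERIV_power_Suc DERIV_inverse' derivative_eq_intros) auto
      moreover have "a j / of_nat (Suc i) * (of_nat (Suc i) * (- (inverse (z - z0) * 1 * inverse (z - z0))) * inverse (z - z0) ^ i)
          = - a j / (z - z0) ^ j"
        unfolding i using of_nat_neq_0[of i, where 'a = complex] nz by (simp add: field_simps del: of_nat_Suc)
      moreover have "(\<lambda>z. a j / of_nat (Suc i) * inverse (z - z0) ^ Suc i)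
          = (\<lambda>z. a j / (of_nat (j - 1) * (z - z0) ^ (j - 1)))"
        unfolding i by (auto simp: field_simps simp del: of_nat_Suc)
      ultimately show ?thesis by simp
    qed
    have "(\<Phi> has_field_derivative h z - (\<Sum>j=2..K. - a j / (z - z0) ^ j)) (at z)"
      unfolding \<Phi>_def using z by (intro derivative_intros H pw) auto
    moreover have "h z - (\<Sum>j=2..K. - a j / (z - z0) ^ j) = f z - b / (z - z0)"
    proof (cases K)
      case 0
      then show ?thesis using a[OF z] by (simp add: b_def)
    next
      case (Suc k)
      then have "(\<Sum>j=1..K. a j / (z - z0) ^ j) = a 1 / (z - z0) + (\<Sum>j=2..K. a j / (z - z0) ^ j)"
        by (subst sum.atLeast_Suc_atMost) (auto simp: numeral_2_eq_2)
      then show ?thesis using a[OF z] Suc by (simp add: b_def sum_negf)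
    qed
    ultimately show ?thesis by simp
  qed
  have "residue (\<lambda>z. f z - b / (z - z0)) z0 = 0"
    using residue_derivative_eq_0[OF V(1,3) \<Phi>] .
  moreover have "residue (\<lambda>z. f z - b / (z - z0)) z0 = residue f z0 - residue (\<lambda>z. b / (z - z0)) z0"
    by (rule residue_diff[OF V(1,3) f(1)]) (auto intro!: holomorphic_intros)
  moreover have "residue (\<lambda>z. b / (z - z0)) z0 = b"
    by (rule residue_simple[OF V(1,3)]) auto
  ultimately have "b = residue f z0" by simp
  with \<Phi> that show ?thesis by blast
qed

text \<open>
  The residue belongs to the differential \<open>f w dw\<close> and is therefore preserved by a change of
  variable. Once a simple pole is split off, \<open>f\<close> is a derivative, and so is its pullback; the
  simple pole pulls back to the logarithmic derivative of \<open>\<phi> - \<phi> z0\<close>, a function with a simple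
  zero at \<open>z0\<close>.
\<close>
lemma residue_compose:
  assumes U: "open U" "z0 \<in> U" and V: "open V" "\<phi> ` (U - {z0}) \<subseteq> V - {\<phi> z0}" "\<phi> z0 \<in> V"
    and f: "f holomorphic_on V - {\<phi> z0}" "not_essential f (\<phi> z0)"
    and \<phi>: "\<And>z. z \<in> U \<Longrightarrow> (\<phi> has_field_derivative \<phi>' z) (at z)" "\<phi>' z0 \<noteq> 0"
  shows "residue (\<lambda>z. f (\<phi> z) * \<phi>' z) z0 = residue f (\<phi> z0)"
proof -
  define r where "r = residue f (\<phi> z0)"
  obtain e where e: "e > 0" "ball (\<phi> z0) e \<subseteq> V"
    using V(1,3) openE by blast
  define B where "B = ball (\<phi> z0) e"
  have "f holomorphic_on B - {\<phi> z0}"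
    using f(1) e(2) by (auto simp: B_def intro: holomorphic_on_subset)
  from meromorphic_primitive[OF _ _ _ this f(2)] obtain \<Phi> where
    \<Phi>: "\<And>w. w \<in> B - {\<phi> z0} \<Longrightarrow> (\<Phi> has_field_derivative f w - r / (w - \<phi> z0)) (at w)"
    using e(1) by (auto simp: B_def r_def)
  have \<phi>_hol: "\<phi> holomorphic_on U"
    using \<phi>(1) U(1) by (auto simp: holomorphic_on_open)
  define W where "W = U \<inter> \<phi> -` B"
  have W: "open W" "z0 \<in> W" "W \<subseteq> U"
    unfolding W_def using U \<phi>_hol e(1)
    by (auto intro!: continuous_open_preimage holomorphic_on_imp_continuous_on simp: B_def)
  have sub: "\<phi> z \<in> B - {\<phi> z0}" if "z \<in> W - {z0}" for z
    using that V(2) by (auto simp: W_def)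
  have \<phi>'_hol: "\<phi>' holomorphic_on U"
    using holomorphic_deriv[OF \<phi>_hol U(1)]
    by (rule holomorphic_transform) (use \<phi>(1) DERIV_imp_deriv in blast)
  have "residue (\<lambda>z. (f (\<phi> z) - r / (\<phi> z - \<phi> z0)) * \<phi>' z) z0 = 0"
  proof (rule residue_derivative_eq_0[OF W(1,2), of "\<Phi> \<circ> \<phi>"])
    fix z assume z: "z \<in> W - {z0}"
    show "(\<Phi> \<circ> \<phi> has_field_derivative (f (\<phi> z) - r / (\<phi> z - \<phi> z0)) * \<phi>' z) (at z)"
      using \<Phi>[OF sub[OF z]] \<phi>(1)[of z] W(3) z by (intro DERIV_chain) auto
  qed
  moreover have "(\<lambda>z. (f (\<phi> z) - r / (\<phi> z - \<phi> z0)) * \<phi>' z) =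
      (\<lambda>z. f (\<phi> z) * \<phi>' z - r * (\<phi>' z / (\<phi> z - \<phi> z0)))"
    by (auto simp: algebra_simps)
  moreover have hol1: "(\<lambda>z. f (\<phi> z) * \<phi>' z) holomorphic_on W - {z0}"
  proof (intro holomorphic_intros)
    have "f \<circ> \<phi> holomorphic_on W - {z0}"
      using W(3) sub e(2) by (intro holomorphic_on_compose_gen[OF _ f(1)] holomorphic_on_subset[OF \<phi>_hol])
        (auto simp: B_def)
    then show "(\<lambda>z. f (\<phi> z)) holomorphic_on W - {z0}" by (simp add: o_def)
    show "\<phi>' holomorphic_on W - {z0}"
      using W(3) by (intro holomorphic_on_subset[OF \<phi>'_hol]) auto
  qed
  moreover have hol2: "(\<lambda>z. \<phi>' z / (\<phi> z - \<phi> z0)) holomorphic_on W - {z0}"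
    using W(3) sub by (intro holomorphic_intros holomorphic_on_subset[OF \<phi>'_hol] holomorphic_on_subset[OF \<phi>_hol]) auto
  moreover have "residue (\<lambda>z. \<phi>' z / (\<phi> z - \<phi> z0)) z0 = 1"
  proof -
    define q where "q = (\<lambda>z. if z = z0 then deriv \<phi> z0 else (\<phi> z - \<phi> z0) / (z - z0))"
    have q: "q holomorphic_on W"
      unfolding q_def using \<phi>_hol W(1,3) by (intro pole_lemma_open) (auto intro: holomorphic_on_subset)
    have q0: "q z0 = \<phi>' z0"
      using \<phi>(1)[OF U(2)] by (simp add: q_def DERIV_imp_deriv)
    have qnz: "q z \<noteq> 0" if "z \<in> W" for z
      using that q0 \<phi>(2) sub[of z] by (auto simp: q_def split: if_splits)
    have "residue (\<lambda>z. (\<phi>' z / q z) / (z - z0)) z0 = \<phi>' z0 / q z0"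
      by (rule residue_simple[OF W(1,2)])
        (use qnz W(3) in \<open>auto intro!: holomorphic_intros q holomorphic_on_subset[OF \<phi>'_hol]\<close>)
    moreover have "residue (\<lambda>z. (\<phi>' z / q z) / (z - z0)) z0 = residue (\<lambda>z. \<phi>' z / (\<phi> z - \<phi> z0)) z0"
      by (rule residue_cong) (auto simp: q_def eventually_at intro!: exI[of _ 1])
    ultimately show ?thesis using q0 \<phi>(2) by simp
  qed
  ultimately have "residue (\<lambda>z. f (\<phi> z) * \<phi>' z) z0 - r * 1 = 0"
    using residue_diff[OF W(1,2) hol1, of "\<lambda>z. r * (\<phi>' z / (\<phi> z - \<phi> z0))"] residue_lmul[OF W(1,2) hol2, of r]
      holomorphic_on_mult[OF holomorphic_on_const[of r] hol2] by metis
  then show ?thesis by (simp add: r_def)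
qed

section \<open>The modular group\<close>

no_notation fps_nth (infixl \<open>$\<close> 75)

definition mat2 :: "int \<Rightarrow> int \<Rightarrow> int \<Rightarrow> int \<Rightarrow> int ^ 2 ^ 2"
  where "mat2 a b c d = vector [vector [a, b], vector [c, d]]"

lemma mat2_nth [simp]:
  "mat2 a b c d $ 1 $ 1 = a" "mat2 a b c d $ 1 $ 2 = b"
  "mat2 a b c d $ 2 $ 1 = c" "mat2 a b c d $ 2 $ 2 = d"
  by (simp_all add: mat2_def)

lemma mat2_eqI:
  fixes M N :: "int ^ 2 ^ 2"
  assumes "M $ 1 $ 1 = N $ 1 $ 1" "M $ 1 $ 2 = N $ 1 $ 2" "M $ 2 $ 1 = N $ 2 $ 1" "M $ 2 $ 2 = N $ 2 $ 2"
  shows "M = N"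
  using assms by (simp add: vec_eq_iff forall_2)

lemma SL2Z_iff: "M \<in> SL2Z \<longleftrightarrow> M $ 1 $ 1 * M $ 2 $ 2 - M $ 1 $ 2 * M $ 2 $ 1 = 1"
  by (simp add: SL2Z_def det_2)

lemma SL2Z_det_eq:
  assumes "M \<in> SL2Z"
  shows "(of_int (M $ 1 $ 1) * of_int (M $ 2 $ 2) - of_int (M $ 1 $ 2) * of_int (M $ 2 $ 1) :: 'a :: comm_ring_1) = 1"
proof -
  have "of_int (M $ 1 $ 1 * M $ 2 $ 2 - M $ 1 $ 2 * M $ 2 $ 1) = (of_int 1 :: 'a)"
    using assms by (simp only: SL2Z_iff)
  then show ?thesis by simp
qed

lemma mult_mat2_nth:
  fixes M N :: "int ^ 2 ^ 2"
  shows "(M ** N) $ i $ j = M $ i $ 1 * N $ 1 $ j + M $ i $ 2 * N $ 2 $ j"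
  by (simp add: matrix_matrix_mult_def sum_2)

lemma SL2Z_mult: "M \<in> SL2Z \<Longrightarrow> N \<in> SL2Z \<Longrightarrow> M ** N \<in> SL2Z"
  by (simp add: SL2Z_def det_mul)

lemma moebius_act_eq:
  "moebius_act M z = (of_int (M $ 1 $ 1) * z + of_int (M $ 1 $ 2)) / automorphy M z"
  by (simp add: moebius_act_def moebius_def automorphy_def)

lemma automorphy_nonzero:
  assumes "M \<in> SL2Z" "Im z \<noteq> 0"
  shows "automorphy M z \<noteq> 0"
proof
  assume *: "automorphy M z = 0"
  then have "M $ 2 $ 1 = 0"
    using assms(2) by (auto simp: automorphy_def complex_eq_iff)
  with * have "M $ 2 $ 2 = 0" by (simp add: automorphy_def)
  with \<open>M $ 2 $ 1 = 0\<close> assms(1) show False by (simp add: SL2Z_iff)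
qed

text \<open>
  For \<open>z' = cnj z\<close> this gives the imaginary part of an image point; with \<open>z'\<close> a fixed point or
  a pole it describes how elliptic elements and principal parts transform.
\<close>
lemma moebius_act_diff:
  assumes "M \<in> SL2Z" "Im z \<noteq> 0" "Im z' \<noteq> 0"
  shows "moebius_act M z - moebius_act M z' = (z - z') / (automorphy M z * automorphy M z')"
proof -
  have "(of_int (M $ 1 $ 1) * z + of_int (M $ 1 $ 2)) * automorphy M z'
      - (of_int (M $ 1 $ 1) * z' + of_int (M $ 1 $ 2)) * automorphy M z
    = (of_int (M $ 1 $ 1) * of_int (M $ 2 $ 2) - of_int (M $ 1 $ 2) * of_int (M $ 2 $ 1)) * (z - z')"
    unfolding automorphy_def by (simp add: algebra_simps)
  with SL2Z_det_eq[OF assms(1), where 'a = complex] show ?thesis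
    unfolding moebius_act_eq
    using automorphy_nonzero[OF assms(1,2)] automorphy_nonzero[OF assms(1,3)] by (simp add: field_simps)
qed

lemma automorphy_cnj: "automorphy M (cnj z) = cnj (automorphy M z)"
  by (simp add: automorphy_def)

lemma moebius_act_cnj: "moebius_act M (cnj z) = cnj (moebius_act M z)"
  by (simp add: moebius_act_eq automorphy_cnj)

lemma Im_moebius_act:
  assumes "M \<in> SL2Z" "Im z \<noteq> 0"
  shows "Im (moebius_act M z) = Im z / (cmod (automorphy M z))\<^sup>2"
proof -
  have "moebius_act M z - cnj (moebius_act M z) = (z - cnj z) / (automorphy M z * cnj (automorphy M z))"
    using moebius_act_diff[OF assms, of "cnj z"] assms(2) by (simp add: automorphy_cnj moebius_act_cnj)
  moreover have "w - cnj w = \<i> * of_real (2 * Im w)" for w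
    by (simp add: complex_eq_iff)
  ultimately have "\<i> * of_real (2 * Im (moebius_act M z)) = \<i> * of_real (2 * Im z) / of_real ((cmod (automorphy M z))\<^sup>2)"
    by (simp only: complex_norm_square)
  also have "\<dots> = \<i> * of_real (2 * Im z / (cmod (automorphy M z))\<^sup>2)"
    by simp
  finally have "2 * Im (moebius_act M z) = 2 * Im z / (cmod (automorphy M z))\<^sup>2"
    by (metis complex_i_not_zero mult_left_cancel of_real_eq_iff)
  then show ?thesis by simp
qed

lemma Im_moebius_act_pos: "M \<in> SL2Z \<Longrightarrow> Im z > 0 \<Longrightarrow> Im (moebius_act M z) > 0"
  using automorphy_nonzero[of M z] Im_moebius_act[of M z] by (metis less_irrefl zero_less_divide_iff zero_less_norm_iff zero_less_power)

lemma automorphy_mult: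
  assumes "N \<in> SL2Z" "Im z \<noteq> 0"
  shows "automorphy (M ** N) z = automorphy M (moebius_act N z) * automorphy N z"
  using automorphy_nonzero[OF assms]
  by (simp add: automorphy_def[of M] automorphy_def[of "M ** N"] moebius_act_eq mult_mat2_nth field_simps)
    (simp add: automorphy_def algebra_simps)

lemma moebius_act_mult:
  assumes "M \<in> SL2Z" "N \<in> SL2Z" "Im z \<noteq> 0"
  shows "moebius_act (M ** N) z = moebius_act M (moebius_act N z)"
proof -
  have *: "of_int ((M ** N) $ 1 $ 1) * z + of_int ((M ** N) $ 1 $ 2)
    = (of_int (M $ 1 $ 1) * moebius_act N z + of_int (M $ 1 $ 2)) * automorphy N z"
    using automorphy_nonzero[OF assms(2,3)]
    by (simp add: moebius_act_eq mult_mat2_nth field_simps)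
      (simp add: automorphy_def algebra_simps)
  show ?thesis
    unfolding moebius_act_eq[of "M ** N"] moebius_act_eq[of M] * automorphy_mult[OF assms(2,3)]
    using automorphy_nonzero[OF assms(2,3)] by simp
qed

lemma DERIV_moebius_act:
  assumes "M \<in> SL2Z" "Im z \<noteq> 0"
  shows "(moebius_act M has_field_derivative 1 / (automorphy M z)\<^sup>2) (at z)"
proof -
  have nz: "automorphy M z \<noteq> 0" using automorphy_nonzero[OF assms] .
  have "((\<lambda>z. (of_int (M $ 1 $ 1) * z + of_int (M $ 1 $ 2)) / automorphy M z) has_field_derivative
     (of_int (M $ 1 $ 1) * automorphy M z - (of_int (M $ 1 $ 1) * z + of_int (M $ 1 $ 2)) * of_int (M $ 2 $ 1))
       / (automorphy M z * automorphy M z)) (at z)"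
    using nz unfolding automorphy_def by (auto intro!: derivative_eq_intros)
  moreover have "of_int (M $ 1 $ 1) * automorphy M z - (of_int (M $ 1 $ 1) * z + of_int (M $ 1 $ 2)) * of_int (M $ 2 $ 1) = 1"
    using SL2Z_det_eq[OF assms(1), where 'a = complex] by (simp add: automorphy_def algebra_simps)
  ultimately show ?thesis
    by (simp add: power2_eq_square moebius_act_eq[abs_def])
qed

lemma holomorphic_on_automorphy: "automorphy M holomorphic_on A"
  unfolding automorphy_def[abs_def] by (intro holomorphic_intros)

definition coprime_pairs :: "(int \<times> int) set"
  where "coprime_pairs = {(c, d). coprime c d}"

definition bottom :: "int ^ 2 ^ 2 \<Rightarrow> int \<times> int"
  where "bottom M = (M $ 2 $ 1, M $ 2 $ 2)"

text \<open>
  The top row is determined by the bottom row up to addition of a multiple of it, which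
  translates the image point by an integer. Functions of period one do not see the choice.
\<close>
definition completion :: "int \<times> int \<Rightarrow> int ^ 2 ^ 2"
  where "completion v = (SOME M. M \<in> SL2Z \<and> bottom M = v)"

lemma bottom_coprime: "M \<in> SL2Z \<Longrightarrow> bottom M \<in> coprime_pairs"
proof -
  assume "M \<in> SL2Z"
  then have "M $ 1 $ 1 * M $ 2 $ 2 - M $ 1 $ 2 * M $ 2 $ 1 = 1" by (simp add: SL2Z_iff)
  then have "coprime (M $ 2 $ 1) (M $ 2 $ 2)"
    by (metis coprimeI dvd_diff dvd_mult)
  then show ?thesis by (simp add: bottom_def coprime_pairs_def)
qed

lemma completion:
  assumes "v \<in> coprime_pairs"
  shows "completion v \<in> SL2Z" "bottom (completion v) = v"
proof -
  obtain c d where v: "v = (c, d)" "coprime c d"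
    using assms by (auto simp: coprime_pairs_def)
  obtain x y where "x * c + y * d = gcd c d"
    using bezout_int by blast
  with v have "mat2 y (-x) c d \<in> SL2Z \<and> bottom (mat2 y (-x) c d) = v"
    by (simp add: SL2Z_iff bottom_def algebra_simps)
  then have "completion v \<in> SL2Z \<and> bottom (completion v) = v"
    unfolding completion_def by (rule someI)
  then show "completion v \<in> SL2Z" "bottom (completion v) = v" by auto
qed

lemma bottom_eq_automorphy: "bottom M = bottom N \<Longrightarrow> automorphy M z = automorphy N z"
  by (simp add: bottom_def automorphy_def)

lemma bottom_eq_translate:
  assumes "M \<in> SL2Z" "N \<in> SL2Z" "bottom M = bottom N"
  obtains j :: int where "\<And>z. Im z \<noteq> 0 \<Longrightarrow> moebius_act N z = moebius_act M z + of_int j"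
proof -
  define a b a' b' c d where abcd: "a = M $ 1 $ 1" "b = M $ 1 $ 2" "a' = N $ 1 $ 1" "b' = N $ 1 $ 2"
    "c = M $ 2 $ 1" "d = M $ 2 $ 2"
  have cd: "N $ 2 $ 1 = c" "N $ 2 $ 2 = d"
    using assms(3) by (auto simp: bottom_def abcd)
  have det: "a * d - b * c = 1" "a' * d - b' * c = 1"
    using assms(1,2) cd by (auto simp: SL2Z_iff abcd)
  \<comment> \<open>the difference of the top rows is \<open>j\<close> times the bottom row\<close>
  define j where "j = a * b' - a' * b"
  have "a' - a = j * c" "b' - b = j * d"
  proof -
    have "j * c = a * (b' * c) - a' * (b * c)" by (simp add: j_def algebra_simps)
    also have "\<dots> = a * (a' * d - 1) - a' * (a * d - 1)" using det by (simp add: algebra_simps)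
    finally show "a' - a = j * c" by (simp add: algebra_simps)
    have "j * d = (a * d) * b' - (a' * d) * b" by (simp add: j_def algebra_simps)
    also have "\<dots> = (1 + b * c) * b' - (1 + b' * c) * b" using det by (simp add: algebra_simps)
    finally show "b' - b = j * d" by (simp add: algebra_simps)
  qed
  then have top: "a' = a + j * c" "b' = b + j * d" by auto
  have "moebius_act N z = moebius_act M z + of_int j" if "Im z \<noteq> 0" for z
  proof -
    have "of_int a' * z + of_int b' = (of_int a * z + of_int b) + of_int j * automorphy M z"
      unfolding top automorphy_def abcd(5,6)[symmetric] by (simp add: algebra_simps)
    with automorphy_nonzero[OF assms(1) that] bottom_eq_automorphy[OF assms(3), of z] show ?thesis
      unfolding moebius_act_eq abcd(1-4)[symmetric] by (simp add: add_divide_distrib)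
  qed
  then show ?thesis using that by blast
qed

text \<open>
  The right action of the modular group on its cosets by the translations, a coset (together
  with a sign) being recorded by its bottom row.
\<close>
definition act_right :: "int ^ 2 ^ 2 \<Rightarrow> int \<times> int \<Rightarrow> int \<times> int"
  where "act_right M v = (fst v * M $ 1 $ 1 + snd v * M $ 2 $ 1, fst v * M $ 1 $ 2 + snd v * M $ 2 $ 2)"

lemma bottom_mult: "bottom (N ** M) = act_right M (bottom N)"
  by (simp add: bottom_def act_right_def mult_mat2_nth)

lemma act_right_coprime:
  assumes "M \<in> SL2Z" "v \<in> coprime_pairs"
  shows "act_right M v \<in> coprime_pairs"
  using bottom_coprime[OF SL2Z_mult[OF completion(1)[OF assms(2)] assms(1)]]
  by (simp add: bottom_mult completion(2)[OF assms(2)])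

lemma bij_betw_act_right:
  assumes "M \<in> SL2Z"
  shows "bij_betw (act_right M) coprime_pairs coprime_pairs"
proof -
  define N where "N = mat2 (M $ 2 $ 2) (- M $ 1 $ 2) (- M $ 2 $ 1) (M $ 1 $ 1)"
  have det: "M $ 1 $ 1 * M $ 2 $ 2 - M $ 1 $ 2 * M $ 2 $ 1 = 1"
    using assms by (simp add: SL2Z_iff)
  then have N: "N \<in> SL2Z"
    by (simp add: SL2Z_iff N_def algebra_simps)
  have inv: "act_right N (act_right M (c, d)) = (c, d)" "act_right M (act_right N (c, d)) = (c, d)" for c d
  proof -
    have 1: "c * (M $ 1 $ 1 * M $ 2 $ 2 - M $ 1 $ 2 * M $ 2 $ 1) = c"
      "d * (M $ 1 $ 1 * M $ 2 $ 2 - M $ 1 $ 2 * M $ 2 $ 1) = d" using det by simp_all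
    show "act_right N (act_right M (c, d)) = (c, d)" "act_right M (act_right N (c, d)) = (c, d)"
      using 1 by (simp_all add: act_right_def N_def algebra_simps)
  qed
  show ?thesis
    by (rule bij_betw_byWitness[where f' = "act_right N"])
      (use inv act_right_coprime assms N in auto)
qed

section \<open>Poincare series\<close>

definition cusp_exp :: "nat \<Rightarrow> complex \<Rightarrow> complex"
  where "cusp_exp n z = exp (- (2 * pi * \<i> * of_nat n * z))"

lemma cusp_exp_add_int: "cusp_exp n (z + of_int j) = cusp_exp n z"
proof -
  have "- (2 * pi * \<i> * of_nat n * (z + of_int j)) =
      - (2 * pi * \<i> * of_nat n * z) + \<i> * (of_int (- int n * j) * (of_real pi * 2))"
    by (simp add: algebra_simps)
  then show ?thesis
    unfolding cusp_exp_def by (simp only: exp_plus_2pin)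
qed

lemma norm_cusp_exp: "cmod (cusp_exp n z) = exp (2 * pi * real n * Im z)"
  by (simp add: cusp_exp_def)

text \<open>
  The terms of the Poincare series of weight \<open>\<kappa>\<close> with a pole of order \<open>n\<close> at the cusp. As the
  pair \<open>v\<close> and its negative both occur, every coset of the translations in the projective
  group is counted twice.
\<close>
definition poincare_term :: "nat \<Rightarrow> nat \<Rightarrow> int \<times> int \<Rightarrow> complex \<Rightarrow> complex"
  where "poincare_term \<kappa> n v z =
    cusp_exp n (moebius_act (completion v) z) / automorphy (completion v) z ^ \<kappa>"

definition poincare :: "nat \<Rightarrow> nat \<Rightarrow> complex \<Rightarrow> complex"
  where "poincare \<kappa> n z = (\<Sum>\<^sub>\<infinity>v\<in>coprime_pairs. poincare_term \<kappa> n v z)"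

lemma cusp_exp_moebius_act_cong:
  assumes "M \<in> SL2Z" "N \<in> SL2Z" "bottom M = bottom N" "Im z \<noteq> 0"
  shows "cusp_exp n (moebius_act M z) = cusp_exp n (moebius_act N z)"
  using bottom_eq_translate[OF assms(1-3)] assms(4) cusp_exp_add_int by metis

lemma poincare_term_bottom:
  assumes "M \<in> SL2Z" "Im z \<noteq> 0"
  shows "poincare_term \<kappa> n (bottom M) z = cusp_exp n (moebius_act M z) / automorphy M z ^ \<kappa>"
proof -
  note c = completion[OF bottom_coprime[OF assms(1)]]
  show ?thesis
    unfolding poincare_term_def cusp_exp_moebius_act_cong[OF c(1) assms(1) c(2) assms(2)]
      bottom_eq_automorphy[OF c(2)] ..
qed

lemma poincare_term_act:
  assumes "M \<in> SL2Z" "v \<in> coprime_pairs" "Im z > 0"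
  shows "poincare_term \<kappa> n v (moebius_act M z) = automorphy M z ^ \<kappa> * poincare_term \<kappa> n (act_right M v) z"
proof -
  define N where "N = completion v"
  have N: "N \<in> SL2Z" "bottom N = v"
    using completion[OF assms(2)] by (auto simp: N_def)
  have z: "Im z \<noteq> 0" "Im (moebius_act M z) \<noteq> 0"
    using assms(3) Im_moebius_act_pos[OF assms(1,3)] by auto
  have "poincare_term \<kappa> n (act_right M v) z = poincare_term \<kappa> n (bottom (N ** M)) z"
    by (simp add: bottom_mult N)
  also have "\<dots> = cusp_exp n (moebius_act N (moebius_act M z)) /
      (automorphy N (moebius_act M z) * automorphy M z) ^ \<kappa>"
    unfolding poincare_term_bottom[OF SL2Z_mult[OF N(1) assms(1)] z(1)]
      moebius_act_mult[OF N(1) assms(1) z(1)] automorphy_mult[OF assms(1) z(1)] ..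
  finally show ?thesis
    using automorphy_nonzero[OF assms(1) z(1)] poincare_term_bottom[OF N(1) z(2), of \<kappa> n]
    by (simp add: N(2) power_mult_distrib)
qed

lemma holomorphic_on_moebius_act:
  assumes "M \<in> SL2Z" "A \<subseteq> {z. Im z > 0}"
  shows "moebius_act M holomorphic_on A"
proof -
  have "(moebius_act M has_field_derivative 1 / (automorphy M z)\<^sup>2) (at z within A)" if "z \<in> A" for z
    using that assms(2) by (intro has_field_derivative_at_within[OF DERIV_moebius_act[OF assms(1)]]) auto
  then show ?thesis
    unfolding holomorphic_on_def field_differentiable_def by blast
qed

lemma holomorphic_on_poincare_term:
  assumes "v \<in> coprime_pairs" "A \<subseteq> {z. Im z > 0}"
  shows "poincare_term \<kappa> n v holomorphic_on A"
proof -
  note M = completion(1)[OF assms(1)]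
  show ?thesis
    unfolding poincare_term_def[abs_def] cusp_exp_def
    by (intro holomorphic_intros holomorphic_on_moebius_act M holomorphic_on_automorphy)
      (use assms(2) automorphy_nonzero[OF M] in auto)
qed

text \<open>
  A product of summable functions of one variable. For \<open>z\<close> in a compact subset of the upper
  half-plane it dominates \<open>1 / cmod (c z + d) ^ 4\<close> up to a constant, uniformly in the coprime
  pair \<open>(c, d)\<close>, and it serves all convergence arguments below.
\<close>
definition majorant :: "int \<times> int \<Rightarrow> real"
  where "majorant = (\<lambda>(c, d). 1 / ((1 + \<bar>of_int c\<bar>) * (1 + \<bar>of_int d\<bar>))\<^sup>2)"

lemma majorant_summable: "majorant summable_on A"
proof -
  define h :: "int \<Rightarrow> real" where "h = (\<lambda>c. 1 / (1 + \<bar>of_int c\<bar>)\<^sup>2)"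
  have "summable (\<lambda>n. 1 / real (Suc n) ^ 2)"
    using inverse_power_summable[of 2, where 'a = real] summable_Suc_iff[of "\<lambda>n. inverse (real n ^ 2)"]
    by (simp add: inverse_eq_divide)
  then have nat: "(\<lambda>n::nat. 1 / real (Suc n) ^ 2) summable_on UNIV"
    by (intro norm_summable_imp_summable_on) auto
  have "h summable_on range int" "h summable_on range (\<lambda>n. - int n)"
  proof -
    have "h \<circ> int = (\<lambda>n. 1 / real (Suc n) ^ 2)" "h \<circ> (\<lambda>n. - int n) = (\<lambda>n. 1 / real (Suc n) ^ 2)"
      by (auto simp: h_def)
    with nat show "h summable_on range int" "h summable_on range (\<lambda>n. - int n)"
      using summable_on_reindex[of int UNIV h] summable_on_reindex[of "\<lambda>n. - int n" UNIV h]
      by (simp_all add: inj_on_def)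
  qed
  then have "h summable_on range int \<union> range (\<lambda>n. - int n)"
    by (rule summable_on_union)
  moreover have "range int \<union> range (\<lambda>n. - int n) = UNIV"
  proof -
    have "x \<in> range int \<union> range (\<lambda>n. - int n)" for x
      by (cases x rule: int_cases2) auto
    then show ?thesis by blast
  qed
  ultimately have h: "h summable_on UNIV" by simp
  have hpos: "h c \<ge> 0" for c by (simp add: h_def)
  have "(\<lambda>(x, y). h x * h y) summable_on UNIV \<times> UNIV"
  proof (rule summable_on_SigmaI[where g = "\<lambda>x. h x * infsum h UNIV"])
    show "((\<lambda>y. case (x, y) of (x, y) \<Rightarrow> h x * h y) has_sum h x * infsum h UNIV) UNIV" for x
      using has_sum_cmult_right[OF has_sum_infsum[OF h]] by simp
    show "(\<lambda>x. h x * infsum h UNIV) summable_on UNIV"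
      using h by (rule summable_on_cmult_left)
  qed (use hpos in auto)
  moreover have "(\<lambda>(x, y). h x * h y) = majorant"
    by (auto simp: h_def majorant_def power_mult_distrib)
  ultimately show ?thesis using summable_on_subset[of majorant UNIV A] by simp
qed

text \<open>
  The imaginary part of \<open>c z + d\<close> controls \<open>c\<close>, and its modulus then controls \<open>d\<close>.
\<close>
lemma linear_form_lower_bound:
  fixes c d :: int and z :: complex
  assumes "Im z \<ge> y" "y > 0" "cmod z \<le> R"
  shows "\<bar>of_int c\<bar> + \<bar>of_int d\<bar> \<le> (1 + (1 + R) / y) * cmod (of_int c * z + of_int d)"
proof -
  define L where "L = cmod (of_int c * z + of_int d)"
  have "\<bar>of_int c\<bar> * y \<le> \<bar>of_int c\<bar> * Im z"
    using assms(1) by (intro mult_left_mono) auto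
  also have "\<dots> = \<bar>Im (of_int c * z + of_int d)\<bar>"
    using assms(1,2) by (simp add: abs_mult)
  also have "\<dots> \<le> L" unfolding L_def by (rule abs_Im_le_cmod)
  finally have c: "\<bar>of_int c\<bar> \<le> L / y"
    using assms(2) by (simp add: field_simps)
  have R: "R \<ge> 0" using assms(3) norm_ge_zero order_trans by blast
  have "\<bar>real_of_int d\<bar> = cmod ((of_int c * z + of_int d) - of_int c * z)" by simp
  also have "\<dots> \<le> L + cmod (of_int c * z)" unfolding L_def by (rule norm_triangle_ineq4)
  also have "\<dots> = L + \<bar>of_int c\<bar> * cmod z" by (simp add: norm_mult)
  also have "\<dots> \<le> L + L / y * R"
    using c R assms by (intro add_left_mono mult_mono) auto
  finally have "\<bar>of_int c\<bar> + \<bar>of_int d\<bar> \<le> (1 + (1 + R) / y) * L"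
    using c by (simp add: algebra_simps add_divide_distrib)
  then show ?thesis by (simp only: L_def)
qed

lemma coprime_pair_abs_sum: "(c, d) \<in> coprime_pairs \<Longrightarrow> \<bar>of_int c\<bar> + \<bar>of_int d\<bar> \<ge> (1 :: real)"
proof -
  assume "(c, d) \<in> coprime_pairs"
  then have "c \<noteq> 0 \<or> d \<noteq> 0" by (auto simp: coprime_pairs_def)
  then have "\<bar>c\<bar> + \<bar>d\<bar> \<ge> 1" by linarith
  then have "real_of_int (\<bar>c\<bar> + \<bar>d\<bar>) \<ge> 1" by linarith
  then show ?thesis by simp
qed

text \<open>
  For a coprime pair \<open>\<bar>c\<bar> + \<bar>d\<bar> \<ge> 1\<close>, so that \<open>1 + \<bar>c\<bar>\<close> and \<open>1 + \<bar>d\<bar>\<close> are both at most twice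
  this sum.
\<close>
lemma majorant_bound:
  fixes L C :: real
  assumes "(c, d) \<in> coprime_pairs" "\<bar>of_int c\<bar> + \<bar>of_int d\<bar> \<le> C * L" "C > 0"
  shows "L \<ge> 1 / C" "1 / L ^ 4 \<le> 16 * C ^ 4 * majorant (c, d)"
proof -
  define s where "s = \<bar>real_of_int c\<bar> + \<bar>real_of_int d\<bar>"
  have s: "s \<ge> 1" "s \<le> C * L"
    using coprime_pair_abs_sum[OF assms(1)] assms(2) by (auto simp: s_def)
  then show L: "L \<ge> 1 / C"
    using assms(3) by (simp add: field_simps)
  then have Lpos: "L > 0" using assms(3) by (smt (verit) divide_pos_pos)
  have "(1 + \<bar>real_of_int c\<bar>) * (1 + \<bar>real_of_int d\<bar>) \<le> (2 * s) * (2 * s)"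
    using s(1) by (intro mult_mono) (auto simp: s_def)
  also have "\<dots> \<le> (2 * (C * L)) * (2 * (C * L))"
    using s by (intro mult_mono) auto
  finally have "((1 + \<bar>real_of_int c\<bar>) * (1 + \<bar>real_of_int d\<bar>))\<^sup>2 \<le> ((2 * (C * L)) * (2 * (C * L)))\<^sup>2"
    by (intro power_mono) auto
  also have "\<dots> = 16 * C ^ 4 * L ^ 4"
    by (simp add: power2_eq_square power4_eq_xxxx)
  finally have "1 / (16 * C ^ 4 * L ^ 4) \<le> majorant (c, d)"
    unfolding majorant_def prod.case by (intro frac_le) (auto intro!: mult_pos_pos add_pos_nonneg)
  then show "1 / L ^ 4 \<le> 16 * C ^ 4 * majorant (c, d)"
    using assms(3) Lpos by (simp add: field_simps)
qed

text \<open>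
  The lower bound for \<open>cmod (c z + d)\<close> bounds the height of the image point from above and
  with it the exponential factor. Four powers of \<open>1 / cmod (c z + d)\<close> give the majorant; the
  others are bounded.
\<close>
lemma poincare_term_bound:
  assumes "\<kappa> \<ge> 4" "y > 0" "R \<ge> 0"
  obtains B where "\<And>v z. v \<in> coprime_pairs \<Longrightarrow> Im z \<ge> y \<Longrightarrow> cmod z \<le> R \<Longrightarrow>
    cmod (poincare_term \<kappa> n v z) \<le> B * majorant v"
proof -
  define C where "C = 1 + (1 + R) / y"
  have C: "C > 0" using assms by (auto simp: C_def intro: add_pos_nonneg)
  define B where "B = exp (2 * pi * real n * (R * C\<^sup>2)) * C ^ (\<kappa> - 4) * (16 * C ^ 4)"
  have "cmod (poincare_term \<kappa> n v z) \<le> B * majorant v"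
    if v: "v \<in> coprime_pairs" and z: "Im z \<ge> y" "cmod z \<le> R" for v z
  proof -
    define M where "M = completion v"
    have M: "M \<in> SL2Z" "bottom M = v" using completion[OF v] by (auto simp: M_def)
    obtain c d where cd: "v = (c, d)" by force
    define L where "L = cmod (automorphy M z)"
    have L_eq: "L = cmod (of_int c * z + of_int d)"
      using M(2) cd by (auto simp: L_def automorphy_def bottom_def)
    have le: "\<bar>of_int c\<bar> + \<bar>of_int d\<bar> \<le> C * L"
      unfolding L_eq C_def using linear_form_lower_bound[OF z(1) assms(2) z(2)] .
    note L = majorant_bound[OF v[unfolded cd] le C]
    have Lpos: "L > 0" using L(1) C by (smt (verit) divide_pos_pos)
    have z0: "Im z > 0" using z assms(2) by simp
    have inv: "1 / L \<le> C" using L(1) Lpos C by (simp add: field_simps)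
    have "Im (moebius_act M z) = Im z * (1 / L)\<^sup>2"
      using Im_moebius_act[OF M(1), of z] z0 by (simp add: L_def power_divide)
    also have "\<dots> \<le> R * C\<^sup>2"
      using inv Lpos z z0 assms abs_Im_le_cmod[of z] by (intro mult_mono power_mono) auto
    finally have e: "exp (2 * pi * real n * Im (moebius_act M z)) \<le> exp (2 * pi * real n * (R * C\<^sup>2))"
      by (simp add: mult_left_mono)
    have "L ^ \<kappa> = L ^ (\<kappa> - 4) * L ^ 4"
      using assms(1) by (simp flip: power_add)
    then have "1 / L ^ \<kappa> = (1 / L) ^ (\<kappa> - 4) * (1 / L ^ 4)"
      by (simp add: power_divide)
    also have "\<dots> \<le> C ^ (\<kappa> - 4) * (16 * C ^ 4 * majorant v)"
      using inv Lpos C L(2) by (intro mult_mono power_mono) (auto simp: cd)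
    finally have "exp (2 * pi * real n * Im (moebius_act M z)) * (1 / L ^ \<kappa>)
        \<le> exp (2 * pi * real n * (R * C\<^sup>2)) * (C ^ (\<kappa> - 4) * (16 * C ^ 4 * majorant v))"
      using e Lpos by (intro mult_mono) auto
    then show ?thesis
      by (simp add: poincare_term_def norm_divide norm_power norm_cusp_exp M_def[symmetric]
          L_def[symmetric] B_def mult.assoc)
  qed
  then show ?thesis using that by blast
qed

lemma poincare_term_summable:
  assumes "\<kappa> \<ge> 4" "Im z > 0"
  shows "(\<lambda>v. poincare_term \<kappa> n v z) summable_on coprime_pairs"
proof -
  obtain B where B: "\<And>v z'. v \<in> coprime_pairs \<Longrightarrow> Im z' \<ge> Im z \<Longrightarrow> cmod z' \<le> cmod z \<Longrightarrow>
      cmod (poincare_term \<kappa> n v z') \<le> B * majorant v"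
    using poincare_term_bound[OF assms(1,2), of "cmod z" n] by auto
  have "(\<lambda>v. B * majorant v) summable_on coprime_pairs"
    by (intro summable_on_cmult_right majorant_summable)
  then have "(\<lambda>v. cmod (poincare_term \<kappa> n v z)) summable_on coprime_pairs"
    by (rule Infinite_Sum.abs_summable_on_comparison_test') (rule B; simp)
  then show ?thesis by (rule abs_summable_summable)
qed

lemma poincare_modular:
  assumes "M \<in> SL2Z" "Im z > 0"
  shows "poincare \<kappa> n (moebius_act M z) = automorphy M z ^ \<kappa> * poincare \<kappa> n z"
proof -
  have "poincare \<kappa> n (moebius_act M z) =
      (\<Sum>\<^sub>\<infinity>v\<in>coprime_pairs. automorphy M z ^ \<kappa> * poincare_term \<kappa> n (act_right M v) z)"
    unfolding poincare_def by (intro infsum_cong poincare_term_act assms)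
  also have "\<dots> = automorphy M z ^ \<kappa> * (\<Sum>\<^sub>\<infinity>v\<in>coprime_pairs. poincare_term \<kappa> n (act_right M v) z)"
    by (rule infsum_cmult_right')
  also have "(\<Sum>\<^sub>\<infinity>v\<in>coprime_pairs. poincare_term \<kappa> n (act_right M v) z) = poincare \<kappa> n z"
    unfolding poincare_def by (rule infsum_reindex_bij_betw[OF bij_betw_act_right[OF assms(1)]])
  finally show ?thesis .
qed

lemma holomorphic_on_poincare:
  assumes "\<kappa> \<ge> 4"
  shows "poincare \<kappa> n holomorphic_on {z. Im z > 0}"
proof -
  have "poincare \<kappa> n field_differentiable (at z0)" if z0: "Im z0 > 0" for z0
  proof -
    define r where "r = Im z0 / 2"
    have sub: "Im z \<ge> r" "cmod z \<le> cmod z0 + r" if "z \<in> cball z0 r" for z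
    proof -
      have *: "cmod (z0 - z) \<le> r" using that by (simp add: dist_norm)
      show "Im z \<ge> r" using abs_Im_le_cmod[of "z0 - z"] * by (simp add: r_def)
      show "cmod z \<le> cmod z0 + r" using * norm_triangle_ineq4[of z0 "z0 - z"] by simp
    qed
    have r: "r > 0" using z0 by (simp add: r_def)
    obtain B where B: "\<And>v z. v \<in> coprime_pairs \<Longrightarrow> Im z \<ge> r \<Longrightarrow> cmod z \<le> cmod z0 + r \<Longrightarrow>
        cmod (poincare_term \<kappa> n v z) \<le> B * majorant v"
      using poincare_term_bound[OF assms(1) r, of "cmod z0 + r" n] r by auto
    have sub2: "cball z0 r \<subseteq> {z. Im z > 0}" using sub(1) r by fastforce
    have unif: "uniform_limit (cball z0 r) (\<lambda>X z. \<Sum>v\<in>X. poincare_term \<kappa> n v z) (poincare \<kappa> n)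
        (finite_subsets_at_top coprime_pairs)"
      unfolding poincare_def[abs_def]
      by (rule Weierstrass_m_test_general[where M = "\<lambda>v. B * majorant v"])
        (use B sub in \<open>auto intro: summable_on_cmult_right majorant_summable\<close>)
    have "poincare \<kappa> n holomorphic_on ball z0 r"
    proof (rule holomorphic_uniform_limit[OF _ unif])
      have hol: "(\<lambda>z. \<Sum>v\<in>X. poincare_term \<kappa> n v z) holomorphic_on A"
        if "X \<subseteq> coprime_pairs" "A \<subseteq> cball z0 r" for X A
        using that sub2 by (intro holomorphic_on_sum holomorphic_on_poincare_term) auto
      show "\<forall>\<^sub>F X in finite_subsets_at_top coprime_pairs.
          continuous_on (cball z0 r) (\<lambda>z. \<Sum>v\<in>X. poincare_term \<kappa> n v z) \<and>
          (\<lambda>z. \<Sum>v\<in>X. poincare_term \<kappa> n v z) holomorphic_on ball z0 r"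
        by (rule eventually_finite_subsets_at_top_weakI)
          (auto intro!: hol holomorphic_on_imp_continuous_on)
    qed auto
    then show ?thesis
      using r by (auto simp: holomorphic_on_open field_differentiable_def)
  qed
  then show ?thesis
    by (auto simp: holomorphic_on_def intro: field_differentiable_at_within)
qed

text \<open>
  The residue is an integral over a small circle, on which the Poincare series converges
  uniformly.
\<close>
lemma residue_mult_poincare_has_sum:
  assumes "\<kappa> \<ge> 4" "open V" "z0 \<in> V" "V \<subseteq> {z. Im z > 0}" and f: "f holomorphic_on V - {z0}"
  shows "((\<lambda>v. residue (\<lambda>z. f z * poincare_term \<kappa> n v z) z0) has_sum
    residue (\<lambda>z. f z * poincare \<kappa> n z) z0) coprime_pairs"
proof -
  obtain r where r: "r > 0" "cball z0 r \<subseteq> V"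
    using assms(2,3) open_contains_cball by blast
  define S where "S = sphere z0 r"
  have S: "compact S" "S \<subseteq> V - {z0}" using r by (auto simp: S_def)
  have S_ne: "S \<noteq> {}" using r(1) by (simp add: S_def)
  obtain F0 where F0: "\<And>z. z \<in> S \<Longrightarrow> cmod (f z) \<le> F0"
    using compact_imp_bounded[OF compact_continuous_image[OF holomorphic_on_imp_continuous_on[OF holomorphic_on_subset[OF f S(2)]] S(1)]]
    by (auto simp: bounded_iff)
  obtain x where x: "x \<in> S" "\<And>z. z \<in> S \<Longrightarrow> Im x \<le> Im z"
    using continuous_attains_inf[OF S(1) S_ne continuous_on_Im[OF continuous_on_id]] by blast
  define y where "y = Im x"
  have y: "y > 0" "\<And>z. z \<in> S \<Longrightarrow> Im z \<ge> y"
    using x S(2) assms(4) by (auto simp: y_def)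
  obtain B where B: "\<And>v z. v \<in> coprime_pairs \<Longrightarrow> Im z \<ge> y \<Longrightarrow> cmod z \<le> cmod z0 + r \<Longrightarrow>
      cmod (poincare_term \<kappa> n v z) \<le> B * majorant v"
    using poincare_term_bound[OF assms(1) y(1), of "cmod z0 + r" n] r by auto
  have B': "cmod (f z * poincare_term \<kappa> n v z) \<le> F0 * (B * majorant v)"
    if "v \<in> coprime_pairs" "z \<in> S" for v z
  proof -
    have "cmod z \<le> cmod z0 + r"
      using that(2) norm_triangle_ineq4[of z0 "z0 - z"] by (simp add: S_def dist_norm)
    then show ?thesis
      unfolding norm_mult using F0[OF that(2)] B[OF that(1) y(2)[OF that(2)]]
      by (intro mult_mono) (auto intro: order_trans[OF norm_ge_zero])
  qed
  have hol: "(\<lambda>z. f z * poincare_term \<kappa> n v z) holomorphic_on V - {z0}" if "v \<in> coprime_pairs" for v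
    using assms(4) by (intro holomorphic_intros f holomorphic_on_poincare_term that) auto
  have int: "((\<lambda>z. f z * poincare_term \<kappa> n v z) has_contour_integral
      2 * pi * \<i> * residue (\<lambda>z. f z * poincare_term \<kappa> n v z) z0) (circlepath z0 r)"
    if "v \<in> coprime_pairs" for v
    by (rule base_residue[OF assms(2,3) r(1) hol[OF that] r(2)])
  have ints: "((\<lambda>z. \<Sum>v\<in>X. f z * poincare_term \<kappa> n v z) has_contour_integral
      (\<Sum>v\<in>X. 2 * pi * \<i> * residue (\<lambda>z. f z * poincare_term \<kappa> n v z) z0)) (circlepath z0 r)"
    if "finite X" "X \<subseteq> coprime_pairs" for X
    using that by (intro has_contour_integral_sum int) auto
  have "(\<lambda>z. f z * poincare \<kappa> n z) holomorphic_on V - {z0}"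
    using assms(4) by (intro holomorphic_intros f holomorphic_on_subset[OF holomorphic_on_poincare[OF assms(1)]]) auto
  then have lim_int: "((\<lambda>z. f z * poincare \<kappa> n z) has_contour_integral
      2 * pi * \<i> * residue (\<lambda>z. f z * poincare \<kappa> n z) z0) (circlepath z0 r)"
    by (rule base_residue[OF assms(2,3) r(1) _ r(2)])
  have unif: "uniform_limit (sphere z0 r) (\<lambda>X z. \<Sum>v\<in>X. f z * poincare_term \<kappa> n v z)
      (\<lambda>z. \<Sum>\<^sub>\<infinity>v\<in>coprime_pairs. f z * poincare_term \<kappa> n v z) (finite_subsets_at_top coprime_pairs)"
    using B' by (intro Weierstrass_m_test_general[where M = "\<lambda>v. F0 * (B * majorant v)"])
      (auto simp: S_def intro!: summable_on_cmult_right majorant_summable)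
  also have "(\<lambda>z. \<Sum>\<^sub>\<infinity>v\<in>coprime_pairs. f z * poincare_term \<kappa> n v z) = (\<lambda>z. f z * poincare \<kappa> n z)"
    by (simp add: poincare_def infsum_cmult_right')
  finally have "((\<lambda>X. contour_integral (circlepath z0 r) (\<lambda>z. \<Sum>v\<in>X. f z * poincare_term \<kappa> n v z)) \<longlongrightarrow>
      contour_integral (circlepath z0 r) (\<lambda>z. f z * poincare \<kappa> n z)) (finite_subsets_at_top coprime_pairs)"
    using r(1) by (intro contour_integral_uniform_limit_circlepath)
      (auto intro!: eventually_finite_subsets_at_top_weakI has_contour_integral_integrable[OF ints])
  then have "((\<lambda>X. contour_integral (circlepath z0 r) (\<lambda>z. \<Sum>v\<in>X. f z * poincare_term \<kappa> n v z)) \<longlongrightarrow>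
      2 * pi * \<i> * residue (\<lambda>z. f z * poincare \<kappa> n z) z0) (finite_subsets_at_top coprime_pairs)"
    by (simp add: contour_integral_unique[OF lim_int])
  then have "((\<lambda>X. \<Sum>v\<in>X. 2 * pi * \<i> * residue (\<lambda>z. f z * poincare_term \<kappa> n v z) z0) \<longlongrightarrow>
      2 * pi * \<i> * residue (\<lambda>z. f z * poincare \<kappa> n z) z0) (finite_subsets_at_top coprime_pairs)"
    by (rule Lim_transform_eventually)
      (intro eventually_finite_subsets_at_top_weakI contour_integral_unique[OF ints])
  then have "((\<lambda>v. 2 * pi * \<i> * residue (\<lambda>z. f z * poincare_term \<kappa> n v z) z0) has_sum
      2 * pi * \<i> * residue (\<lambda>z. f z * poincare \<kappa> n z) z0) coprime_pairs"
    by (simp add: has_sum_def)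
  then show ?thesis
    by (subst (asm) has_sum_cmult_right_iff) auto
qed

text \<open>
  The main term comes from the two pairs with \<open>c = 0\<close>. If \<open>c \<noteq> 0\<close> and \<open>y = Im z \<ge> 1\<close>, then
  \<open>L = cmod (c z + d)\<close> is at least \<open>\<bar>c\<bar> y\<close>, so the image point has height at most one and the
  exponential factor stays bounded. Moreover \<open>(1 + \<bar>c\<bar>) y \<le> 2 L\<close> and \<open>1 + \<bar>d\<bar> \<le> 3 L\<close>; the
  square of the product of these bounds compares \<open>1 / L ^ 4\<close> with the majorant and leaves a
  factor \<open>1 / y\<^sup>2\<close>.
\<close>
lemma poincare_asymptotics:
  assumes "\<kappa> \<ge> 4" "even \<kappa>"
  obtains B where "\<And>z. Im z \<ge> 1 \<Longrightarrow> \<bar>Re z\<bar> \<le> 1 \<Longrightarrow>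
    cmod (poincare \<kappa> n z - 2 * cusp_exp n z) \<le> B / (Im z)\<^sup>2"
proof -
  define A :: "(int \<times> int) set" where "A = {(0, 1), (0, -1)}"
  define S' where "S' = coprime_pairs - A"
  define B where "B = (\<Sum>\<^sub>\<infinity>v\<in>S'. exp (2 * pi * real n) * (36 * majorant v))"
  have "cmod (poincare \<kappa> n z - 2 * cusp_exp n z) \<le> B / (Im z)\<^sup>2"
    if z: "Im z \<ge> 1" "\<bar>Re z\<bar> \<le> 1" for z
  proof -
    have bound: "cmod (poincare_term \<kappa> n v z) \<le> exp (2 * pi * real n) * (36 * majorant v) / (Im z)\<^sup>2"
      if v: "v \<in> S'" for v
    proof -
      define y where "y = Im z"
      define M where "M = completion v"
      have vS: "v \<in> coprime_pairs" using v by (auto simp: S'_def)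
      have M: "M \<in> SL2Z" "bottom M = v" using completion[OF vS] by (auto simp: M_def)
      obtain c d where cd: "v = (c, d)" by force
      define L where "L = cmod (automorphy M z)"
      have L_eq: "L = cmod (of_int c * z + of_int d)"
        using M(2) cd by (auto simp: L_def automorphy_def bottom_def)
      have "c \<noteq> 0"
        using v cd by (auto simp: S'_def coprime_pairs_def A_def)
      then have c1: "\<bar>real_of_int c\<bar> \<ge> 1" by linarith
      have "\<bar>Im (of_int c * z + of_int d)\<bar> \<le> L" unfolding L_eq by (rule abs_Im_le_cmod)
      then have cy: "\<bar>real_of_int c\<bar> * y \<le> L"
        using z(1) by (simp add: abs_mult y_def)
      have y1: "y \<ge> 1" using z(1) by (simp add: y_def)
      have cL: "\<bar>real_of_int c\<bar> \<le> L"
        using cy y1 mult_left_mono[of 1 y "\<bar>real_of_int c\<bar>"] by simp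
      then have L1: "L \<ge> 1" using c1 by simp
      have yL: "y \<le> L"
      proof -
        have "1 * y \<le> \<bar>real_of_int c\<bar> * y"
          using c1 y1 by (intro mult_right_mono) auto
        then show ?thesis using cy by linarith
      qed
      have "\<bar>Re (of_int c * z + of_int d)\<bar> \<le> L" unfolding L_eq by (rule abs_Re_le_cmod)
      then have "\<bar>real_of_int c * Re z + real_of_int d\<bar> \<le> L" by simp
      moreover have "\<bar>real_of_int c * Re z\<bar> \<le> L"
        using cL z(2) mult_mono[of "\<bar>real_of_int c\<bar>" L "\<bar>Re z\<bar>" 1] L1 by (simp add: abs_mult)
      ultimately have d: "1 + \<bar>real_of_int d\<bar> \<le> 3 * L" using L1 by linarith
      have c: "(1 + \<bar>real_of_int c\<bar>) * y \<le> 2 * L"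
        using cy yL by (simp add: algebra_simps)
      have "((1 + \<bar>real_of_int c\<bar>) * y) * (1 + \<bar>real_of_int d\<bar>) \<le> (2 * L) * (3 * L)"
        using y1 L1 by (intro mult_mono[OF c d]) auto
      then have "(((1 + \<bar>real_of_int c\<bar>) * y) * (1 + \<bar>real_of_int d\<bar>))\<^sup>2 \<le> ((2 * L) * (3 * L))\<^sup>2"
        using y1 by (intro power_mono) auto
      also have "\<dots> = 36 * L ^ 4"
        by (simp add: power2_eq_square power4_eq_xxxx)
      also have "(((1 + \<bar>real_of_int c\<bar>) * y) * (1 + \<bar>real_of_int d\<bar>))\<^sup>2 = y\<^sup>2 / majorant v"
        by (simp add: majorant_def cd power_mult_distrib)
      finally have *: "y\<^sup>2 / majorant v \<le> 36 * L ^ 4" .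
      have "majorant v > 0"
        by (auto simp: majorant_def cd intro!: mult_pos_pos add_pos_nonneg)
      with * L1 y1 have "1 / L ^ 4 \<le> 36 * majorant v / y\<^sup>2"
        by (simp add: field_simps)
      moreover have "1 / L ^ \<kappa> \<le> 1 / L ^ 4"
        using L1 assms(1) by (intro divide_left_mono power_increasing) auto
      ultimately have 1: "1 / L ^ \<kappa> \<le> 36 * majorant v / y\<^sup>2" by simp
      have "Im (moebius_act M z) = y / L\<^sup>2"
        using Im_moebius_act[OF M(1), of z] z by (simp add: L_def y_def)
      also have "\<dots> \<le> 1"
        using yL L1 y1 mult_mono[of 1 L y L] by (simp add: power2_eq_square field_simps)
      finally have "exp (2 * pi * real n * Im (moebius_act M z)) \<le> exp (2 * pi * real n)"
        by (simp add: mult_left_le)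
      then have "exp (2 * pi * real n * Im (moebius_act M z)) * (1 / L ^ \<kappa>)
          \<le> exp (2 * pi * real n) * (36 * majorant v / y\<^sup>2)"
        using 1 L1 by (intro mult_mono) auto
      then show ?thesis
        by (simp add: poincare_term_def norm_divide norm_power norm_cusp_exp M_def[symmetric]
          L_def[symmetric] y_def)
    qed
    have sumS: "(\<lambda>v. poincare_term \<kappa> n v z) summable_on coprime_pairs"
      using z by (intro poincare_term_summable assms) auto
    have A: "A = {(0, 1), (0, -1)}" "A \<subseteq> coprime_pairs" "finite A" by (auto simp: A_def coprime_pairs_def)
    have sumS': "(\<lambda>v. poincare_term \<kappa> n v z) summable_on S'"
      by (rule summable_on_subset[OF sumS]) (auto simp: S'_def)
    have "poincare \<kappa> n z = (\<Sum>\<^sub>\<infinity>v\<in>A \<union> S'. poincare_term \<kappa> n v z)"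
      unfolding poincare_def using A(2) by (intro arg_cong[of _ _ "infsum _"]) (auto simp: S'_def)
    also have "\<dots> = (\<Sum>v\<in>A. poincare_term \<kappa> n v z) + (\<Sum>\<^sub>\<infinity>v\<in>S'. poincare_term \<kappa> n v z)"
      using A(3) sumS' by (subst infsum_Un_disjoint) (auto simp: S'_def)
    also have "(\<Sum>v\<in>A. poincare_term \<kappa> n v z) = 2 * cusp_exp n z"
    proof -
      have "poincare_term \<kappa> n (bottom (mat2 1 0 0 1)) z = cusp_exp n z"
        using z(1) by (subst poincare_term_bottom) (auto simp: SL2Z_iff moebius_act_eq automorphy_def)
      moreover have "poincare_term \<kappa> n (bottom (mat2 (-1) 0 0 (-1))) z = cusp_exp n z"
        using z(1) assms(2) by (subst poincare_term_bottom) (auto simp: SL2Z_iff moebius_act_eq automorphy_def)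
      ultimately show ?thesis by (simp add: A(1) bottom_def)
    qed
    finally have "poincare \<kappa> n z - 2 * cusp_exp n z = (\<Sum>\<^sub>\<infinity>v\<in>S'. poincare_term \<kappa> n v z)" by simp
    also have "cmod \<dots> \<le> (\<Sum>\<^sub>\<infinity>v\<in>S'. exp (2 * pi * real n) * (36 * majorant v) / (Im z)\<^sup>2)"
    proof (rule norm_infsum_le)
      show "((\<lambda>v. poincare_term \<kappa> n v z) has_sum (\<Sum>\<^sub>\<infinity>v\<in>S'. poincare_term \<kappa> n v z)) S'"
        using sumS' by (rule has_sum_infsum)
      show "((\<lambda>v. exp (2 * pi * real n) * (36 * majorant v) / (Im z)\<^sup>2) has_sum
          (\<Sum>\<^sub>\<infinity>v\<in>S'. exp (2 * pi * real n) * (36 * majorant v) / (Im z)\<^sup>2)) S'"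
        unfolding divide_inverse
        by (intro has_sum_infsum summable_on_cmult_left summable_on_cmult_right majorant_summable)
    qed (use bound in auto)
    also have "\<dots> = B / (Im z)\<^sup>2"
      unfolding B_def divide_inverse by (rule infsum_cmult_left')
    finally show ?thesis .
  qed
  then show ?thesis using that by blast
qed

section \<open>Elliptic points and quadratic integers\<close>

lemma rho_eq: "rho = Complex (1 / 2) (sqrt 3 / 2)"
proof -
  have "rho = cis (pi / 3)"
  proof -
    have "complex_of_real pi * \<i> / 3 = \<i> * complex_of_real (pi / 3)" by simp
    then show ?thesis unfolding rho_def cis_conv_exp by (simp only:)
  qed
  then show ?thesis
    by (simp add: complex_eq_iff cos_60 sin_60)
qed

text \<open>
  The two elliptic points are the roots in the upper half-plane of \<open>X\<^sup>2 - t X + 1\<close> with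
  \<open>t = 0\<close> and \<open>t = 1\<close>. Most arguments below treat both at once, through the trace \<open>t\<close>.
\<close>
locale elliptic_point =
  fixes \<zz> :: complex
  assumes \<zz>_cases: "\<zz> \<in> {\<i>, rho}"
begin

definition tr :: int where "tr = (if \<zz> = \<i> then 0 else 1)"

lemma \<zz>_tr_cases:
  obtains "\<zz> = \<i>" "tr = 0" | "\<zz> = rho" "tr = 1"
  using \<zz>_cases by (auto simp: tr_def rho_eq complex_eq_iff)

lemma Re_\<zz>: "Re \<zz> = of_int tr / 2"
  by (rule \<zz>_tr_cases) (auto simp: rho_eq)

lemma Im_\<zz>_sq: "(Im \<zz>)\<^sup>2 = 1 - (of_int tr)\<^sup>2 / 4"
  by (rule \<zz>_tr_cases) (auto simp: rho_eq power_divide)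

lemma Im_\<zz>_bounds: "Im \<zz> > 0" "Im \<zz> \<le> 1" "Im \<zz> > 43 / 50"
proof -
  have s: "sqrt 3 \<le> 2"
    by (rule real_le_lsqrt) auto
  have s': "86 / 50 < sqrt 3"
    by (rule real_less_rsqrt) (simp add: power2_eq_square)
  show "Im \<zz> > 0" by (rule \<zz>_tr_cases; simp add: rho_eq)
  show "Im \<zz> \<le> 1" by (rule \<zz>_tr_cases; use s in \<open>simp add: rho_eq\<close>)
  show "Im \<zz> > 43 / 50" by (rule \<zz>_tr_cases; use s' in \<open>simp add: rho_eq\<close>)
qed

lemma Im_\<zz>_nonzero [simp]: "Im \<zz> \<noteq> 0"
  using Im_\<zz>_bounds(1) by auto

lemma tr_cases:
  obtains "tr = 0" "Re \<zz> = 0" "Im \<zz> = 1" | "tr = 1" "Re \<zz> = 1 / 2" "Im \<zz> = sqrt 3 / 2"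
  by (rule \<zz>_tr_cases) (auto simp: rho_eq)

lemma \<zz>_square: "\<zz> * \<zz> = of_int tr * \<zz> - 1"
proof -
  have "rho * rho = rho - 1" by (simp add: rho_eq complex_eq_iff)
  then show ?thesis by (rule_tac \<zz>_tr_cases) auto
qed

lemma cnj_\<zz>: "cnj \<zz> = of_int tr - \<zz>"
  using Re_\<zz> by (simp add: complex_eq_iff)

lemma \<zz>_cnj: "\<zz> * cnj \<zz> = 1"
  using \<zz>_square by (simp add: cnj_\<zz> algebra_simps)

lemma cmod_\<zz>: "cmod \<zz> = 1"
proof -
  have "(cmod \<zz>)\<^sup>2 = 1" by (simp add: cmod_power2 Re_\<zz> Im_\<zz>_sq power_divide)
  then show ?thesis by (simp add: abs_square_eq_1)
qed

text \<open>
  Elements of \<open>\<int>[\<zz>]\<close> are handled through their coordinates. The pair \<open>(c, d)\<close> stands for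
  \<open>c \<zz> + d\<close>, which is at the same time the automorphy factor at \<open>\<zz>\<close> of a matrix with bottom
  row \<open>(c, d)\<close>.
\<close>
definition elt :: "int \<times> int \<Rightarrow> complex"
  where "elt v = of_int (fst v) * \<zz> + of_int (snd v)"

definition nrm :: "int \<times> int \<Rightarrow> int"
  where "nrm v = (fst v)\<^sup>2 + tr * fst v * snd v + (snd v)\<^sup>2"

lemma automorphy_elt: "automorphy M \<zz> = elt (bottom M)"
  by (simp add: automorphy_def elt_def bottom_def)

lemma elt_mult_cnj: "elt v * cnj (elt v) = of_int (nrm v)"
proof -
  obtain c d where v: "v = (c, d)" by force
  have "elt v * cnj (elt v) = (of_int c)\<^sup>2 * (\<zz> * cnj \<zz>) + of_int c * of_int d * (\<zz> + cnj \<zz>) + (of_int d)\<^sup>2"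
    by (simp add: v elt_def algebra_simps power2_eq_square)
  also have "\<dots> = of_int (nrm v)"
    unfolding \<zz>_cnj by (simp add: cnj_\<zz> v nrm_def algebra_simps)
  finally show ?thesis .
qed

lemma cmod_elt: "(cmod (elt v))\<^sup>2 = of_int (nrm v)"
proof -
  have "of_real ((cmod (elt v))\<^sup>2) = (of_real (of_int (nrm v)) :: complex)"
    unfolding complex_norm_square elt_mult_cnj by simp
  then show ?thesis by (simp only: of_real_eq_iff)
qed

lemma elt_inject: "elt u = elt v \<longleftrightarrow> u = v"
proof
  assume *: "elt u = elt v"
  then have "Im (elt u) = Im (elt v)" by simp
  then have "fst u = fst v" by (simp add: elt_def)
  with * show "u = v" by (simp add: elt_def prod_eq_iff)
qed simp

lemma elt_eq_0: "elt v = 0 \<longleftrightarrow> v = (0, 0)"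
  using elt_inject[of v "(0, 0)"] by (simp add: elt_def)

lemma nrm_nonneg: "nrm v \<ge> 0"
proof -
  have "real_of_int (nrm v) \<ge> 0" by (simp flip: cmod_elt)
  then show ?thesis by simp
qed

lemma nrm_eq_0: "nrm v = 0 \<longleftrightarrow> v = (0, 0)"
proof -
  have "real_of_int (nrm v) = 0 \<longleftrightarrow> elt v = 0" by (simp flip: cmod_elt)
  then show ?thesis by (simp add: elt_eq_0)
qed

lemma nrm_coprime_pos: "v \<in> coprime_pairs \<Longrightarrow> nrm v \<ge> 1"
  using nrm_nonneg[of v] nrm_eq_0[of v] by (force simp: coprime_pairs_def)

definition emult :: "int \<times> int \<Rightarrow> int \<times> int \<Rightarrow> int \<times> int"
  where "emult u v = (fst u * fst v * tr + fst u * snd v + snd u * fst v, snd u * snd v - fst u * fst v)"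

lemma elt_emult: "elt (emult u v) = elt u * elt v"
proof -
  obtain a b c d where uv: "u = (a, b)" "v = (c, d)" by force
  have "elt u * elt v = of_int a * of_int c * (\<zz> * \<zz>) + (of_int a * of_int d + of_int b * of_int c) * \<zz> + of_int b * of_int d"
    by (simp add: uv elt_def algebra_simps)
  also have "\<dots> = elt (emult u v)"
    unfolding \<zz>_square by (simp add: uv elt_def emult_def algebra_simps)
  finally show ?thesis ..
qed

lemma nrm_emult: "nrm (emult u v) = nrm u * nrm v"
proof -
  have "real_of_int (nrm (emult u v)) = of_int (nrm u * nrm v)"
    using cmod_elt[of "emult u v"] cmod_elt[of u] cmod_elt[of v]
    by (simp add: elt_emult norm_mult power_mult_distrib)
  then show ?thesis by (simp only: of_int_eq_iff)
qed

definition econj :: "int \<times> int \<Rightarrow> int \<times> int"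
  where "econj v = (- fst v, snd v + tr * fst v)"

lemma elt_econj: "elt (econj v) = cnj (elt v)"
  by (simp add: elt_def econj_def cnj_\<zz> algebra_simps)

lemma econj_econj [simp]: "econj (econj v) = v"
  by (simp add: econj_def)

lemma nrm_econj [simp]: "nrm (econj v) = nrm v"
  using cmod_elt[of v] cmod_elt[of "econj v"] by (simp add: elt_econj)

definition units :: "(int \<times> int) set"
  where "units = {u. nrm u = 1}"

text \<open>
  Completing the square in the norm form, in either coordinate, bounds the coordinates of a
  unit by one.
\<close>
lemma units_eq:
  "units = {(1, 0), (-1, 0), (0, 1), (0, -1)} \<union> (if tr = 0 then {} else {(1, -1), (-1, 1)})"
proof -
  have "u \<in> units \<longleftrightarrow> u \<in> {(1, 0), (-1, 0), (0, 1), (0, -1)} \<union> (if tr = 0 then {} else {(1, -1), (-1, 1)})" for u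
  proof -
    obtain c d where u: "u = (c, d)" by force
    have bound: "c \<in> {-1, 0, 1} \<and> d \<in> {-1, 0, 1}" if "nrm u = 1"
    proof -
      have tr01: "tr = 0 \<or> tr = 1" by (simp add: tr_def)
      have "4 * nrm u = (2 * c + tr * d)\<^sup>2 + (4 - tr) * d\<^sup>2" "4 * nrm u = (2 * d + tr * c)\<^sup>2 + (4 - tr) * c\<^sup>2"
        using tr01 by (auto simp: nrm_def u power2_eq_square algebra_simps)
      then have "(4 - tr) * d\<^sup>2 \<le> 4" "(4 - tr) * c\<^sup>2 \<le> 4"
        using that zero_le_power2[of "2 * c + tr * d"] zero_le_power2[of "2 * d + tr * c"] by linarith+
      then have "3 * d\<^sup>2 \<le> 4" "3 * c\<^sup>2 \<le> 4"
        using tr01 zero_le_power2[of d] zero_le_power2[of c] by auto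
      moreover have "\<bar>x\<bar> < 2" if "3 * x\<^sup>2 \<le> 4" for x :: int
      proof (rule ccontr)
        assume "\<not> \<bar>x\<bar> < 2"
        then have "2\<^sup>2 \<le> \<bar>x\<bar>\<^sup>2" by (intro power_mono) auto
        with that show False by simp
      qed
      ultimately have "\<bar>d\<bar> < 2" "\<bar>c\<bar> < 2" by blast+
      then show ?thesis by auto
    qed
    show ?thesis
    proof
      assume "u \<in> units"
      then have n: "nrm u = 1" by (simp add: units_def)
      with bound show "u \<in> {(1, 0), (-1, 0), (0, 1), (0, -1)} \<union> (if tr = 0 then {} else {(1, -1), (-1, 1)})"
        by (auto simp: u nrm_def tr_def split: if_splits)
    next
      assume "u \<in> {(1, 0), (-1, 0), (0, 1), (0, -1)} \<union> (if tr = 0 then {} else {(1, -1), (-1, 1)})"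
      then show "u \<in> units" by (auto simp: units_def nrm_def tr_def split: if_splits)
    qed
  qed
  then show ?thesis by blast
qed

lemma finite_units: "finite units"
  by (simp add: units_eq)

text \<open>
  Multiplication by the unit \<open>u\<close> is an automorphism of the lattice spanned by \<open>\<zz>\<close> and \<open>1\<close>; its
  matrix fixes the ratio \<open>\<zz>\<close> of the basis and has automorphy factor \<open>elt u\<close> there.
\<close>
definition stab :: "int \<times> int \<Rightarrow> int ^ 2 ^ 2"
  where "stab u = mat2 (snd u + tr * fst u) (- fst u) (fst u) (snd u)"

lemma bottom_stab [simp]: "bottom (stab u) = u"
  by (simp add: bottom_def stab_def)

lemma act_right_stab: "act_right (stab u) v = emult u v"
  by (simp add: act_right_def stab_def emult_def algebra_simps)

lemma stab_SL2Z: "u \<in> units \<Longrightarrow> stab u \<in> SL2Z"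
  by (simp add: SL2Z_iff stab_def units_def nrm_def power2_eq_square algebra_simps)

lemma unit_nonzero: "u \<in> units \<Longrightarrow> elt u \<noteq> 0"
  by (auto simp: elt_eq_0 units_def nrm_def)

lemma stab_fixes:
  assumes "u \<in> units"
  shows "moebius_act (stab u) \<zz> = \<zz>"
proof -
  have "of_int (stab u $ 1 $ 1) * \<zz> + of_int (stab u $ 1 $ 2) = \<zz> * elt u"
  proof -
    have "\<zz> * elt u = of_int (fst u) * (\<zz> * \<zz>) + of_int (snd u) * \<zz>"
      by (simp add: elt_def algebra_simps)
    then show ?thesis
      unfolding \<zz>_square by (simp add: stab_def algebra_simps)
  qed
  then show ?thesis
    using unit_nonzero[OF assms] by (simp add: moebius_act_eq automorphy_elt)
qed

text \<open>
  A matrix that fixes \<open>\<zz>\<close> preserves its height, so the automorphy factor is a unit; and the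
  automorphy factor determines a matrix with a given image point.
\<close>
lemma fixes_\<zz>_imp_stab:
  assumes "M \<in> SL2Z" "moebius_act M \<zz> = \<zz>"
  shows "bottom M \<in> units" "M = stab (bottom M)"
proof -
  define u where "u = bottom M"
  have "Im \<zz> = Im \<zz> / of_int (nrm u)"
    using Im_moebius_act[OF assms(1), of \<zz>] assms(2) by (simp add: automorphy_elt u_def cmod_elt)
  moreover have "nrm u \<noteq> 0"
    using nrm_coprime_pos[OF bottom_coprime[OF assms(1)]] by (simp add: u_def)
  ultimately have "real_of_int (nrm u) = 1"
    by (simp add: field_simps)
  then show u: "bottom M \<in> units" by (simp add: units_def u_def)
  have "of_int (M $ 1 $ 1) * \<zz> + of_int (M $ 1 $ 2) = \<zz> * elt u"
    using assms(2) unit_nonzero[OF u]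
    by (simp add: moebius_act_eq automorphy_elt u_def field_simps)
  also have "\<dots> = of_int (stab u $ 1 $ 1) * \<zz> + of_int (stab u $ 1 $ 2)"
    using stab_fixes[OF u] unit_nonzero[OF u]
    by (simp add: moebius_act_eq automorphy_elt u_def field_simps)
  finally have "elt (M $ 1 $ 1, M $ 1 $ 2) = elt (stab u $ 1 $ 1, stab u $ 1 $ 2)"
    by (simp add: elt_def)
  then have "M $ 1 $ 1 = stab u $ 1 $ 1" "M $ 1 $ 2 = stab u $ 1 $ 2"
    by (auto simp: elt_inject)
  moreover have "M $ 2 $ 1 = stab u $ 2 $ 1" "M $ 2 $ 2 = stab u $ 2 $ 2"
    by (auto simp: u_def stab_def bottom_def)
  ultimately show "M = stab (bottom M)"
    unfolding u_def by (intro mat2_eqI)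
qed

lemma uminus_stab: "- stab u = stab (- fst u, - snd u)"
  by (intro mat2_eqI) (simp_all add: stab_def)

lemma stab_inject: "stab u = stab v \<longleftrightarrow> u = v"
  by (metis bottom_stab)

lemma uminus_units: "u \<in> units \<Longrightarrow> (- fst u, - snd u) \<in> units"
  by (simp add: units_def nrm_def)

text \<open>
  The stabiliser in the projective group is the group of units modulo sign.
\<close>
lemma omega_eq: "omega \<zz> = nat (2 + tr)"
proof -
  define f where "f = (\<lambda>u. {stab u, stab (- fst u, - snd u)})"
  have "{P \<in> PSL2Z. \<forall>M\<in>P. moebius_act M \<zz> = \<zz>} = f ` units"
  proof (intro equalityI subsetI)
    fix P assume P: "P \<in> {P \<in> PSL2Z. \<forall>M\<in>P. moebius_act M \<zz> = \<zz>}"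
    then obtain M where M: "M \<in> SL2Z" "P = {M, - M}" "moebius_act M \<zz> = \<zz>"
      by (auto simp: PSL2Z_def)
    define u where "u = bottom M"
    have u: "u \<in> units" "M = stab u"
      using fixes_\<zz>_imp_stab[OF M(1,3)] by (simp_all only: u_def)
    have "P = f u" unfolding M(2) u(2) f_def uminus_stab ..
    with u(1) show "P \<in> f ` units" by blast
  next
    fix P assume "P \<in> f ` units"
    then obtain u where u: "u \<in> units" "P = f u" by auto
    then have "P = {stab u, - stab u}" by (simp add: f_def uminus_stab)
    moreover from u have "\<forall>M\<in>P. moebius_act M \<zz> = \<zz>"
      using stab_fixes uminus_units by (auto simp: f_def)
    ultimately show "P \<in> {P \<in> PSL2Z. \<forall>M\<in>P. moebius_act M \<zz> = \<zz>}"
      using stab_SL2Z[OF u(1)] by (auto simp: PSL2Z_def)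
  qed
  also have "f ` units = f ` ({(1, 0), (0, 1)} \<union> (if tr = 0 then {} else {(1, -1)}))"
  proof -
    have "f (-1, 0) = f (1, 0)" "f (0, -1) = f (0, 1)" "f (-1, 1) = f (1, -1)"
      unfolding f_def by (simp_all add: insert_commute)
    then show ?thesis by (auto simp: units_eq)
  qed
  also have "card \<dots> = nat (2 + tr)"
  proof -
    have "inj_on f ({(1, 0), (0, 1)} \<union> (if tr = 0 then {} else {(1, -1)}))"
      by (auto simp: inj_on_def f_def doubleton_eq_iff stab_inject)
    then have "card (f ` ({(1, 0), (0, 1)} \<union> (if tr = 0 then {} else {(1, -1)})))
        = card ({(1, 0), (0, 1)} \<union> (if tr = 0 then {} else {(1, -1 :: int)}) :: (int \<times> int) set)"
      by (rule card_image)
    then show ?thesis by (simp add: tr_def)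
  qed
  finally show ?thesis by (simp add: omega_def)
qed

lemma card_units: "card units = 2 * omega \<zz>"
  by (simp add: units_eq omega_eq tr_def)

lemma \<zz>_cis: "\<zz> = cis (pi / omega \<zz>)"
proof (rule \<zz>_tr_cases)
  assume "\<zz> = rho" "tr = 1"
  then show ?thesis by (simp add: omega_eq rho_eq complex_eq_iff cos_60 sin_60)
next
  assume "\<zz> = \<i>" "tr = 0"
  then show ?thesis by (simp add: omega_eq complex_eq_iff)
qed

lemma \<zz>_power_eq_1_iff: "\<zz> ^ k = 1 \<longleftrightarrow> 2 * omega \<zz> dvd k"
proof -
  have om: "omega \<zz> > 0" by (simp add: omega_eq tr_def)
  have "\<zz> ^ k = cis (2 * pi * (real k / real (2 * omega \<zz>)))"
  proof -
    have "\<zz> ^ k = cis (pi / omega \<zz>) ^ k" using \<zz>_cis by simp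
    also have "\<dots> = cis (real k * (pi / omega \<zz>))" by (rule Complex.DeMoivre)
    also have "real k * (pi / omega \<zz>) = 2 * pi * (real k / real (2 * omega \<zz>))" by simp
    finally show ?thesis .
  qed
  also have "\<dots> = 1 \<longleftrightarrow> real k / real (2 * omega \<zz>) \<in> \<int>"
  proof -
    have "cis (2 * pi * x) = 1 \<longleftrightarrow> x \<in> \<int>" for x
    proof -
      have "cis (2 * pi * x) = exp (2 * of_real pi * \<i> * of_real x)"
        by (simp add: cis_conv_exp mult_ac)
      also have "\<dots> = 1 \<longleftrightarrow> (\<exists>n::int. x = of_int n)"
        unfolding exp_eq_1 by simp
      finally show ?thesis by (auto elim: Ints_cases)
    qed
    then show ?thesis .
  qed
  also have "\<dots> \<longleftrightarrow> 2 * omega \<zz> dvd k"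
  proof
    assume "real k / real (2 * omega \<zz>) \<in> \<int>"
    then obtain j :: int where j: "real k / real (2 * omega \<zz>) = of_int j" by (auto elim: Ints_cases)
    then have "real_of_int (int k) = of_int (j * int (2 * omega \<zz>))"
      using om by (simp add: field_simps)
    then have "int k = j * int (2 * omega \<zz>)" by (simp only: of_int_eq_iff)
    then have "int (2 * omega \<zz>) dvd int k" by simp
    then show "2 * omega \<zz> dvd k" by (simp only: int_dvd_int_iff)
  next
    assume "2 * omega \<zz> dvd k"
    then obtain j where "k = 2 * omega \<zz> * j" by (rule dvdE)
    then show "real k / real (2 * omega \<zz>) \<in> \<int>" using om by simp
  qed
  finally show ?thesis .
qed

text \<open>
  Up to sign every unit is a power of \<open>\<zz>\<close>, and \<open>k\<close> is even.
\<close>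
lemma unit_power_eq_1:
  assumes "u \<in> units" "2 * omega \<zz> dvd k"
  shows "elt u ^ k = 1"
proof -
  have zk: "\<zz> ^ k = 1" using assms(2) by (simp add: \<zz>_power_eq_1_iff)
  have ev: "even k" using assms(2) by (metis dvd_mult_left)
  have z2: "\<zz>\<^sup>2 = \<zz> - 1" if "tr = 1" using \<zz>_square that by (simp add: power2_eq_square)
  have "elt u = \<zz> \<or> elt u = - \<zz> \<or> elt u = 1 \<or> elt u = -1 \<or> tr = 1 \<and> (elt u = \<zz> - 1 \<or> elt u = - (\<zz> - 1))"
    using assms(1) unfolding units_eq by (auto simp: tr_def elt_def split: if_splits)
  then consider "elt u = \<zz>" | "elt u = - \<zz>" | "elt u = 1" | "elt u = -1" | "elt u = \<zz>\<^sup>2" | "elt u = - \<zz>\<^sup>2"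
    using z2 by auto
  then show ?thesis
    using zk ev by cases (simp_all add: power_mult[symmetric] mult.commute[of 2], simp_all add: power_mult)
qed

lemma Im_orbit:
  assumes "M \<in> SL2Z"
  shows "Im (moebius_act M \<zz>) = Im \<zz> / of_int (nrm (bottom M))"
  using Im_moebius_act[OF assms, of \<zz>] by (simp add: automorphy_elt cmod_elt)

lemma orbit_unit_multiple:
  assumes "M \<in> SL2Z" "N \<in> SL2Z" "u \<in> units" "bottom N = emult u (bottom M)"
  obtains j :: int where "moebius_act N \<zz> = moebius_act M \<zz> + of_int j"
proof -
  have "bottom (M ** stab u) = bottom N"
    by (simp add: bottom_mult act_right_stab assms(4))
  then obtain j where "\<And>z. Im z \<noteq> 0 \<Longrightarrow> moebius_act N z = moebius_act (M ** stab u) z + of_int j"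
    using bottom_eq_translate[OF SL2Z_mult[OF assms(1) stab_SL2Z[OF assms(3)]] assms(2)] by blast
  then have "moebius_act N \<zz> = moebius_act M \<zz> + of_int j"
    using moebius_act_mult[OF assms(1) stab_SL2Z[OF assms(3)], of \<zz>] stab_fixes[OF assms(3)] by simp
  then show ?thesis using that by blast
qed

text \<open>
  The height of an orbit point is \<open>Im \<zz>\<close> divided by the norm of the bottom row, which is an
  integer; norm one means that the point is a translate of \<open>\<zz>\<close>.
\<close>
lemma orbit_height:
  assumes "M \<in> SL2Z"
  shows "Im (moebius_act M \<zz>) \<le> Im \<zz> / 2 \<or> (\<exists>j::int. moebius_act M \<zz> = \<zz> + of_int j)"
proof (cases "nrm (bottom M) = 1")
  case True
  then have u: "bottom M \<in> units" by (simp add: units_def)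
  obtain j where "\<And>z. Im z \<noteq> 0 \<Longrightarrow> moebius_act M z = moebius_act (stab (bottom M)) z + of_int j"
    using bottom_eq_translate[OF stab_SL2Z[OF u] assms] by auto
  then show ?thesis using stab_fixes[OF u] by auto
next
  case False
  then have "nrm (bottom M) \<ge> 2" using nrm_coprime_pos[OF bottom_coprime[OF assms]] by simp
  then have "real_of_int (nrm (bottom M)) \<ge> 2" by linarith
  then have "Im \<zz> / of_int (nrm (bottom M)) \<le> Im \<zz> / 2"
    using less_imp_le[OF Im_\<zz>_bounds(1)] by (intro divide_left_mono) auto
  then show ?thesis by (simp only: Im_orbit[OF assms] simp_thms)
qed

text \<open>
  Conjugating the matrix by the reflection \<open>z \<mapsto> - cnj z\<close> reflects the orbit point, because
  \<open>- cnj \<zz> = \<zz> - t\<close> with the integer \<open>t = tr\<close>.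
\<close>
lemma orbit_econj:
  assumes "M \<in> SL2Z" "N \<in> SL2Z" "bottom N = econj (bottom M)"
  obtains j :: int where "Re (moebius_act N \<zz>) = - Re (moebius_act M \<zz>) + of_int j"
proof -
  define M' where "M' = mat2 (M $ 1 $ 1) (- M $ 1 $ 2 - tr * M $ 1 $ 1) (- M $ 2 $ 1) (M $ 2 $ 2 + tr * M $ 2 $ 1)"
  have M': "M' \<in> SL2Z" "bottom M' = bottom N"
    using assms(1,3) by (auto simp: SL2Z_iff M'_def bottom_def econj_def algebra_simps)
  obtain j where "\<And>z. Im z \<noteq> 0 \<Longrightarrow> moebius_act N z = moebius_act M' z + of_int j"
    using bottom_eq_translate[OF M'(1) assms(2) M'(2)] by blast
  moreover have "moebius_act M' \<zz> = - cnj (moebius_act M \<zz>)"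
  proof -
    have "automorphy M' \<zz> = cnj (automorphy M \<zz>)"
      using M'(2) assms(3) by (simp add: automorphy_elt elt_econj)
    moreover have "of_int (M' $ 1 $ 1) * \<zz> + of_int (M' $ 1 $ 2) =
        - cnj (of_int (M $ 1 $ 1) * \<zz> + of_int (M $ 1 $ 2))"
      by (simp add: M'_def cnj_\<zz> algebra_simps)
    ultimately show ?thesis
      by (simp only: moebius_act_eq complex_cnj_divide minus_divide_left)
  qed
  ultimately have "Re (moebius_act N \<zz>) = - Re (moebius_act M \<zz>) + of_int j" by simp
  then show ?thesis using that by blast
qed

section \<open>Primitive ideals and coprime pairs\<close>

abbreviation "R \<equiv> int_ring \<zz>"

lemma carrier_R: "carrier R = range elt"
proof -
  have "of_int m + of_int n * \<zz> = elt (n, m)" for m n by (simp add: elt_def)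
  then show ?thesis by (auto simp: int_ring_def image_iff)
qed

lemma R_simps [simp]:
  "x \<otimes>\<^bsub>R\<^esub> y = x * y" "x \<oplus>\<^bsub>R\<^esub> y = x + y" "\<one>\<^bsub>R\<^esub> = 1" "\<zero>\<^bsub>R\<^esub> = 0"
  by (simp_all add: int_ring_def)

definition eadd :: "int \<times> int \<Rightarrow> int \<times> int \<Rightarrow> int \<times> int"
  where "eadd u v = (fst u + fst v, snd u + snd v)"

definition escale :: "int \<Rightarrow> int \<times> int \<Rightarrow> int \<times> int"
  where "escale g v = (g * fst v, g * snd v)"

lemma elt_eadd: "elt (eadd u v) = elt u + elt v"
  by (simp add: elt_def eadd_def algebra_simps)

lemma elt_escale: "elt (escale g v) = of_int g * elt v"
  by (simp add: elt_def escale_def algebra_simps)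

lemma elt_int: "elt (0, g) = of_int g"
  by (simp add: elt_def)

lemma elt_closed [intro]:
  "x \<in> range elt \<Longrightarrow> y \<in> range elt \<Longrightarrow> x + y \<in> range elt"
  "x \<in> range elt \<Longrightarrow> y \<in> range elt \<Longrightarrow> x * y \<in> range elt"
  "of_int g \<in> range elt" "x \<in> range elt \<Longrightarrow> - x \<in> range elt"
proof -
  show "x \<in> range elt \<Longrightarrow> y \<in> range elt \<Longrightarrow> x + y \<in> range elt"
  proof -
    assume "x \<in> range elt" "y \<in> range elt"
    then obtain u v where "x = elt u" "y = elt v" by blast
    then have "x + y = elt (eadd u v)" by (simp add: elt_eadd)
    then show ?thesis by (rule range_eqI)
  qed
  show "x \<in> range elt \<Longrightarrow> y \<in> range elt \<Longrightarrow> x * y \<in> range elt"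
  proof -
    assume "x \<in> range elt" "y \<in> range elt"
    then obtain u v where "x = elt u" "y = elt v" by blast
    then have "x * y = elt (emult u v)" by (simp add: elt_emult)
    then show ?thesis by (rule range_eqI)
  qed
  show "of_int g \<in> range elt"
    unfolding elt_int[symmetric] by (rule rangeI)
  show "- x \<in> range elt" if "x \<in> range elt"
  proof -
    from that obtain v where "x = elt v" by blast
    then have "- x = elt (escale (- 1) v)" by (simp add: elt_escale)
    then show ?thesis by (rule range_eqI)
  qed
qed

lemma cring_R: "cring R"
proof (rule cringI)
  show "abelian_group R"
  proof (rule abelian_groupI)
    fix x assume x: "x \<in> carrier R"
    then have "- x \<in> carrier R" using elt_closed(4) by (simp add: carrier_R)
    then show "\<exists>y\<in>carrier R. y \<oplus>\<^bsub>R\<^esub> x = \<zero>\<^bsub>R\<^esub>" by (intro bexI[of _ "- x"]) auto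
  next
    show "\<zero>\<^bsub>R\<^esub> \<in> carrier R" using elt_closed(3)[of 0] by (simp add: carrier_R)
  qed (use elt_closed(1) in \<open>auto simp: carrier_R algebra_simps\<close>)
  show "comm_monoid R"
  proof (rule comm_monoidI)
    show "\<one>\<^bsub>R\<^esub> \<in> carrier R" using elt_closed(3)[of 1] by (simp add: carrier_R)
  qed (use elt_closed(2) in \<open>auto simp: carrier_R algebra_simps\<close>)
qed (auto simp: algebra_simps)

definition gen :: "int \<times> int \<Rightarrow> complex set"
  where "gen v = PIdl\<^bsub>R\<^esub> (elt v)"

lemma gen_eq_range: "gen v = range (\<lambda>w. elt w * elt v)"
  by (auto simp: gen_def cgenideal_def carrier_R)

lemma genI: "elt w * elt v \<in> gen v"
  unfolding gen_eq_range by (rule rangeI)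

lemma genE:
  assumes "x \<in> gen v"
  obtains w where "x = elt w * elt v"
  using assms unfolding gen_eq_range by blast

lemma ideal_gen: "ideal (gen v) R"
  unfolding gen_def by (rule cring.cgenideal_ideal[OF cring_R]) (simp add: carrier_R)

lemma elt_in_gen: "elt v \<in> gen v"
proof -
  have "elt v = elt (0, 1) * elt v" by (simp add: elt_def)
  then show ?thesis unfolding gen_eq_range by (rule range_eqI)
qed

lemma gen_subset_ideal:
  assumes "ideal b R" "elt v \<in> b"
  shows "gen v \<subseteq> b"
  using ideal.I_l_closed[OF assms] by (auto simp: gen_eq_range carrier_R)

text \<open>
  Rounding the coordinates one after the other leaves a real and an imaginary part of at most
  \<open>1 / 2\<close>, hence an error of modulus at most \<open>sqrt (1 / 2)\<close>. This makes the norm Euclidean.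
\<close>
lemma lattice_approximation: "\<exists>q. cmod (x - elt q) < 1"
proof -
  define c where "c = round (Im x / Im \<zz>)"
  define d where "d = round (Re x - of_int c * Re \<zz>)"
  have "\<bar>Im x / Im \<zz> - of_int c\<bar> \<le> 1 / 2"
    unfolding c_def using of_int_round_abs_le[of "Im x / Im \<zz>"] by (simp add: abs_minus_commute)
  then have "\<bar>Im x / Im \<zz> - of_int c\<bar> * Im \<zz> \<le> 1 / 2 * 1"
    using Im_\<zz>_bounds by (intro mult_mono) auto
  also have "\<bar>Im x / Im \<zz> - of_int c\<bar> * Im \<zz> = \<bar>(Im x / Im \<zz> - of_int c) * Im \<zz>\<bar>"
    by (simp only: abs_mult abs_of_pos[OF Im_\<zz>_bounds(1)])
  also have "(Im x / Im \<zz> - of_int c) * Im \<zz> = Im (x - elt (c, d))"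
    by (simp add: elt_def algebra_simps)
  finally have i: "\<bar>Im (x - elt (c, d))\<bar> \<le> 1 / 2" by simp
  have r: "\<bar>Re (x - elt (c, d))\<bar> \<le> 1 / 2"
    using of_int_round_abs_le[of "Re x - of_int c * Re \<zz>"]
    by (simp add: elt_def d_def abs_minus_commute algebra_simps)
  have "(cmod (x - elt (c, d)))\<^sup>2 \<le> (1 / 2)\<^sup>2 + (1 / 2)\<^sup>2"
    unfolding cmod_power2 using i r by (intro add_mono) (auto simp: abs_le_square_iff[symmetric])
  then have "(cmod (x - elt (c, d)))\<^sup>2 < 1\<^sup>2" by (simp add: power2_eq_square)
  then have "cmod (x - elt (c, d)) < 1" by (rule power_less_imp_less_base) simp
  then show ?thesis by blast
qed

text \<open>
  Division with remainder by a nonzero element of least norm.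
\<close>
lemma ideal_principal:
  assumes b: "ideal b R" "b \<noteq> {0}"
  obtains v where "v \<noteq> (0, 0)" "b = gen v"
proof -
  have sub: "b \<subseteq> range elt"
    using ideal.axioms(1)[OF b(1)] additive_subgroup.a_subset carrier_R by blast
  have "0 \<in> b"
    using additive_subgroup.zero_closed[OF ideal.axioms(1)[OF b(1)]] by simp
  then obtain x where "x \<in> b" "x \<noteq> 0" using b(2) by blast
  moreover from \<open>x \<in> b\<close> sub obtain v0 where "x = elt v0" by blast
  ultimately have "elt v0 \<in> b \<and> v0 \<noteq> (0, 0)" using elt_eq_0[of v0] by simp
  from ex_has_least_nat[of "\<lambda>v. elt v \<in> b \<and> v \<noteq> (0, 0)", OF this, of "\<lambda>v. nat (nrm v)"]
  obtain v where v: "elt v \<in> b" "v \<noteq> (0, 0)"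
    and least: "\<And>w. elt w \<in> b \<Longrightarrow> w \<noteq> (0, 0) \<Longrightarrow> nat (nrm v) \<le> nat (nrm w)"
    by blast
  have v0: "elt v \<noteq> 0" using v(2) by (simp add: elt_eq_0)
  have "b \<subseteq> gen v"
  proof
    fix x assume x: "x \<in> b"
    then obtain w where w: "x = elt w" using sub by auto
    obtain q where q: "cmod (x / elt v - elt q) < 1" using lattice_approximation by blast
    define r where "r = eadd w (escale (-1) (emult q v))"
    have r: "elt r = x - elt q * elt v" by (simp add: r_def elt_eadd elt_escale elt_emult w)
    have "elt (emult (escale (-1) q) v) \<in> b"
      unfolding elt_emult using ideal.I_l_closed[OF b(1) v(1), of "elt (escale (-1) q)"] by (simp add: carrier_R)
    then have "x + elt (emult (escale (-1) q) v) \<in> b"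
      using additive_subgroup.a_closed[OF ideal.axioms(1)[OF b(1)] x] by simp
    then have "elt r \<in> b" by (simp add: r elt_emult elt_escale)
    moreover have "nrm r < nrm v"
    proof -
      have "elt r = (x / elt v - elt q) * elt v" using v0 by (simp add: r field_simps)
      then have "cmod (elt r) < 1 * cmod (elt v)"
        unfolding norm_mult using q v0 by (simp add: norm_mult)
      then have "(cmod (elt r))\<^sup>2 < (cmod (elt v))\<^sup>2"
        by (intro power_strict_mono) auto
      then show ?thesis by (simp add: cmod_elt)
    qed
    ultimately have "r = (0, 0)"
      using least[of r] nrm_nonneg[of r] by (cases "r = (0, 0)") auto
    then have "x = elt q * elt v" using r elt_eq_0[of r] by simp
    then show "x \<in> gen v" by (simp only: genI)
  qed
  with gen_subset_ideal[OF b(1) v(1)] v(2) that show ?thesis by blast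
qed

lemma gen_unit_multiple:
  assumes "u \<in> units"
  shows "gen (emult u v) = gen v"
proof
  have "elt (econj u) * elt u = 1"
    using assms elt_mult_cnj[of u] by (simp add: elt_econj units_def mult.commute)
  then have "elt (econj u) * elt (emult u v) = elt v"
    by (simp add: elt_emult flip: mult.assoc)
  then have "elt v \<in> gen (emult u v)" using genI by metis
  then show "gen v \<subseteq> gen (emult u v)" by (rule gen_subset_ideal[OF ideal_gen])
  have "elt (emult u v) \<in> gen v" unfolding elt_emult by (rule genI)
  then show "gen (emult u v) \<subseteq> gen v" by (rule gen_subset_ideal[OF ideal_gen])
qed

text \<open>
  Two generators divide each other, so the norm of their quotient is a unit of the integers.
\<close>
lemma gen_eqD:
  assumes "gen v = gen w" "v \<noteq> (0, 0)"
  obtains u where "u \<in> units" "w = emult u v"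
proof -
  obtain x where x: "elt w = elt x * elt v"
    using elt_in_gen[of w] unfolding assms(1)[symmetric] by (rule genE)
  obtain y where y: "elt v = elt y * elt w"
    using elt_in_gen[of v] unfolding assms(1) by (rule genE)
  have "elt v * (elt (emult y x)) = elt v * elt (0, 1)"
  proof -
    have "elt v * elt (emult y x) = elt y * (elt x * elt v)" by (simp add: elt_emult)
    also have "\<dots> = elt v" using x y by simp
    finally show ?thesis by (simp add: elt_def[of "(0, 1)"])
  qed
  then have "emult y x = (0, 1)"
    using assms(2) by (simp only: mult_left_cancel elt_eq_0 elt_inject mult_cancel_left simp_thms)
  then have "nrm y * nrm x = 1"
    using nrm_emult[of y x] by (simp add: nrm_def)
  then have "nrm x = 1"
    using nrm_nonneg[of x] by (auto simp: zmult_eq_1_iff)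
  moreover have "w = emult x v"
    using x by (metis elt_emult elt_inject)
  ultimately show ?thesis using that by (simp add: units_def)
qed

lemma coprime_pair_dvd:
  assumes "(c, d) \<in> coprime_pairs" "N dvd n * c" "N dvd n * d"
  shows "N dvd (n :: int)"
proof -
  obtain x y where "x * c + y * d = gcd c d" using bezout_int by blast
  then have one: "x * c + y * d = 1"
    using assms(1) by (simp add: coprime_pairs_def)
  have "x * (n * c) + y * (n * d) = n * (x * c + y * d)" by (simp add: algebra_simps)
  then have "n = x * (n * c) + y * (n * d)" using one by simp
  moreover have "N dvd x * (n * c) + y * (n * d)" using assms(2,3) by (intro dvd_add dvd_mult[OF assms(2)] dvd_mult[OF assms(3)])
  ultimately show ?thesis by simp
qed

text \<open>
  The integers that divide a principal ideal are those that divide both coordinates of its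
  generator.
\<close>
lemma primitive_ideals_eq: "primitive_ideals \<zz> = gen ` coprime_pairs"
proof (intro equalityI subsetI)
  fix b assume "b \<in> gen ` coprime_pairs"
  then obtain c d where v: "(c, d) \<in> coprime_pairs" "b = gen (c, d)" by auto
  have "(c, d) \<noteq> (0, 0)" using v(1) by (auto simp: coprime_pairs_def)
  then have "b \<noteq> {0}" using elt_in_gen[of "(c, d)"] v(2) elt_eq_0 by blast
  moreover have "\<not> divisible_by \<zz> b (PIdl\<^bsub>R\<^esub> (of_int g))" if g: "\<bar>g\<bar> > 1" for g
  proof
    assume "divisible_by \<zz> b (PIdl\<^bsub>R\<^esub> (of_int g))"
    then obtain I where I: "ideal I R" "b = ideal_prod R (PIdl\<^bsub>R\<^esub> (of_int g)) I"
      by (auto simp: divisible_by_def)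
    have I_sub: "I \<subseteq> range elt"
      using ideal.axioms(1)[OF I(1)] additive_subgroup.a_subset carrier_R by blast
    have "\<exists>w. x = of_int g * elt w" if "x \<in> ideal_prod R (PIdl\<^bsub>R\<^esub> (of_int g)) I" for x
      using that
    proof induction
      case (prod i j)
      then obtain a where "i = elt a * of_int g" by (auto simp: cgenideal_def carrier_R)
      moreover obtain w where "j = elt w" using prod(2) I_sub by auto
      ultimately have "i \<otimes>\<^bsub>R\<^esub> j = of_int g * elt (emult a w)" by (simp add: elt_emult)
      then show ?case by blast
    next
      case (sum s t)
      then obtain x y where "s = of_int g * elt x" "t = of_int g * elt y" by auto
      then have "s \<oplus>\<^bsub>R\<^esub> t = of_int g * elt (eadd x y)" by (simp add: elt_eadd algebra_simps)
      then show ?case by blast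
    qed
    then obtain w where "elt (c, d) = of_int g * elt w"
      using elt_in_gen[of "(c, d)"] v(2) I(2) by blast
    then have "(c, d) = escale g w" by (metis elt_escale elt_inject)
    then have "g dvd c" "g dvd d" by (auto simp: escale_def)
    then have "g dvd 1" using v(1) by (auto simp: coprime_pairs_def coprime_def)
    then show False using g by simp
  qed
  ultimately show "b \<in> primitive_ideals \<zz>"
    using ideal_gen v(2) by (auto simp: primitive_ideals_def)
next
  fix b assume b: "b \<in> primitive_ideals \<zz>"
  then obtain v where v: "v \<noteq> (0, 0)" "b = gen v"
    using ideal_principal by (auto simp: primitive_ideals_def)
  define g where "g = gcd (fst v) (snd v)"
  have g0: "g > 0" using v(1) by (auto simp: g_def prod_eq_iff)
  define w where "w = (fst v div g, snd v div g)"
  have vw: "v = escale g w" by (simp add: escale_def w_def g_def)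
  have "gen v = ideal_prod R (PIdl\<^bsub>R\<^esub> (of_int g)) (gen w)"
  proof (intro equalityI subsetI)
    fix x assume "x \<in> gen v"
    then obtain a where "x = elt a * elt v" by (rule genE)
    then have "x = of_int g \<otimes>\<^bsub>R\<^esub> (elt a * elt w)" by (simp add: vw elt_escale)
    moreover have "of_int g \<in> PIdl\<^bsub>R\<^esub> (of_int g)"
      using elt_closed(3)[of 1] by (auto simp: cgenideal_def carrier_R intro!: exI[of _ 1])
    moreover have "elt a * elt w \<in> gen w" by (rule genI)
    ultimately show "x \<in> ideal_prod R (PIdl\<^bsub>R\<^esub> (of_int g)) (gen w)"
      using ideal_prod.prod by metis
  next
    fix x assume "x \<in> ideal_prod R (PIdl\<^bsub>R\<^esub> (of_int g)) (gen w)"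
    then show "x \<in> gen v"
    proof induction
      case (prod i j)
      then obtain a where "i = elt a * of_int g" by (auto simp: cgenideal_def carrier_R)
      moreover obtain y where "j = elt y * elt w" using prod(2) by (rule genE)
      ultimately have "i \<otimes>\<^bsub>R\<^esub> j = elt (emult a y) * elt v" by (simp add: elt_emult vw elt_escale)
      then show ?case by (simp only: genI)
    next
      case (sum s t)
      then show ?case
        using additive_subgroup.a_closed[OF ideal.axioms(1)[OF ideal_gen]] by blast
    qed
  qed
  then have "divisible_by \<zz> b (PIdl\<^bsub>R\<^esub> (of_int g))"
    unfolding divisible_by_def v(2) by (intro exI[of _ "gen w"] conjI ideal_gen)
  with b have "\<not> \<bar>g\<bar> > 1" by (auto simp: primitive_ideals_def)
  then have "g = 1" using g0 by simp
  then have "v \<in> coprime_pairs"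
    by (auto simp: coprime_pairs_def g_def coprime_iff_gcd_eq_1 case_prod_unfold)
  then show "b \<in> gen ` coprime_pairs" using v(2) by blast
qed

text \<open>
  Multiplication by the conjugate of the generator turns membership into divisibility by the
  norm of the multiples \<open>n c\<close> and \<open>n d\<close> of the coordinates, and these are coprime.
\<close>
lemma of_int_in_gen_iff:
  assumes "v \<in> coprime_pairs"
  shows "of_int n \<in> gen v \<longleftrightarrow> nrm v dvd n"
proof
  assume "of_int n \<in> gen v"
  then obtain w where "of_int n = elt w * elt v" by (rule genE)
  then have "of_int n * cnj (elt v) = elt w * (elt v * cnj (elt v))" by simp
  then have "elt (escale n (econj v)) = elt (escale (nrm v) w)"
    unfolding elt_mult_cnj elt_escale elt_econj by (simp only: mult.commute[of "elt w"])
  then have "escale n (econj v) = escale (nrm v) w" by (simp add: elt_inject)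
  then have 1: "n * (- fst v) = nrm v * fst w" "n * (snd v + tr * fst v) = nrm v * snd w"
    unfolding escale_def econj_def by simp_all
  then have "n * fst v = nrm v * (- fst w)" by simp
  then have d1: "nrm v dvd n * fst v" by (rule dvdI)
  have "n * snd v = n * (snd v + tr * fst v) - tr * (n * fst v)"
    by (simp add: algebra_simps)
  then have "n * snd v = nrm v * snd w - tr * (n * fst v)" unfolding 1(2) .
  moreover have "nrm v dvd nrm v * snd w - tr * (n * fst v)"
    by (rule dvd_diff[OF dvd_triv_left dvd_mult[OF d1]])
  ultimately have "nrm v dvd n * snd v" by (simp only:)
  with d1 show "nrm v dvd n"
    using coprime_pair_dvd[of "fst v" "snd v" "nrm v" n] assms by simp
next
  assume "nrm v dvd n"
  then obtain m where "n = nrm v * m" by (rule dvdE)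
  then have "of_int n = of_int m * (elt v * cnj (elt v))"
    unfolding elt_mult_cnj by simp
  also have "\<dots> = (of_int m * cnj (elt v)) * elt v"
    by (simp only: mult.assoc mult.commute[of "elt v"])
  also have "\<dots> = elt (escale m (econj v)) * elt v" by (simp add: elt_escale elt_econj)
  finally show "of_int n \<in> gen v" by (simp only: genI)
qed

text \<open>
  If \<open>a d - b c = 1\<close>, then \<open>- (a * cnj \<zz> + b) * (c * \<zz> + d)\<close> differs from \<open>\<zz>\<close> by an integer.
\<close>
lemma \<zz>_congruent_int:
  assumes "v \<in> coprime_pairs"
  obtains t :: int where "\<zz> - of_int t \<in> gen v"
proof -
  define M where "M = completion v"
  have M: "M \<in> SL2Z" "bottom M = v" using completion[OF assms] by (auto simp: M_def)
  define a b c d where abcd: "a = M $ 1 $ 1" "b = M $ 1 $ 2" "c = M $ 2 $ 1" "d = M $ 2 $ 2"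
  have v: "v = (c, d)" using M(2) by (simp add: bottom_def abcd)
  have det: "of_int a * of_int d - of_int b * of_int c = (1 :: complex)"
    using SL2Z_det_eq[OF M(1), where 'a = complex] by (simp add: abcd)
  have "elt (a, - b - a * tr) * elt v = - (of_int a * cnj \<zz> + of_int b) * elt v"
    by (simp add: elt_def cnj_\<zz> algebra_simps)
  also have "\<dots> = - (of_int a * of_int c * (\<zz> * cnj \<zz>) + of_int b * of_int d + of_int a * of_int d * cnj \<zz> + of_int b * of_int c * \<zz>)"
    by (simp add: elt_def v algebra_simps)
  also have "\<dots> = (of_int a * of_int d - of_int b * of_int c) * \<zz> - of_int (a * c + b * d + a * d * tr)"
    unfolding \<zz>_cnj by (simp add: cnj_\<zz> algebra_simps)
  also have "\<dots> = \<zz> - of_int (a * c + b * d + a * d * tr)"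
    unfolding det by simp
  finally have "\<zz> - of_int (a * c + b * d + a * d * tr) \<in> gen v"
    using genI by metis
  then show ?thesis using that by blast
qed

text \<open>
  Since \<open>\<zz>\<close> is congruent to an integer, every residue class contains an integer, and integers
  are congruent if and only if they are so modulo \<open>nrm v\<close>. Thus the quotient is the ring of
  integers modulo \<open>nrm v\<close>.
\<close>
lemma ideal_norm_gen:
  assumes "v \<in> coprime_pairs"
  shows "ideal_norm \<zz> (gen v) = nat (nrm v)"
proof -
  interpret I: ideal "gen v" R by (rule ideal_gen)
  define coset where "coset = (\<lambda>x. gen v +>\<^bsub>R\<^esub> x)"
  have add: "x + y \<in> gen v" if "x \<in> gen v" "y \<in> gen v" for x y
    using additive_subgroup.a_closed[OF ideal.axioms(1)[OF ideal_gen] that] by simp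
  have coset_eq: "coset x = coset y \<longleftrightarrow> x - y \<in> gen v" if "x \<in> range elt" "y \<in> range elt" for x y
  proof -
    have "\<ominus>\<^bsub>R\<^esub> y = - y"
      using that(2) elt_closed(4)[OF that(2)] by (intro I.minus_equality) (auto simp: carrier_R)
    then show ?thesis
      using I.quotient_eq_iff_same_a_r_cos[OF ideal_gen, of x y] that by (simp add: coset_def a_minus_def carrier_R)
  qed
  have "carrier (R Quot gen v) = coset ` range elt"
    by (auto simp: FactRing_def A_RCOSETS_def' carrier_R coset_def)
  also have "\<dots> = (\<lambda>n. coset (of_int n)) ` {0..<nrm v}"
  proof (intro equalityI subsetI)
    fix C assume "C \<in> coset ` range elt"
    then obtain w where C: "C = coset (elt w)" by auto
    obtain t where t: "\<zz> - of_int t \<in> gen v" using \<zz>_congruent_int[OF assms] by blast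
    define m where "m = fst w * t + snd w"
    have "of_int (fst w) * (\<zz> - of_int t) \<in> gen v"
      using I.I_l_closed[OF t, of "of_int (fst w)"] elt_closed(3) by (simp add: carrier_R)
    moreover have "of_int (m - m mod nrm v) \<in> gen v"
      unfolding of_int_in_gen_iff[OF assms] by (rule dvd_minus_mod)
    ultimately have "of_int (fst w) * (\<zz> - of_int t) + of_int (m - m mod nrm v) \<in> gen v"
      by (rule add)
    also have "of_int (fst w) * (\<zz> - of_int t) + of_int (m - m mod nrm v) = elt w - of_int (m mod nrm v)"
      by (simp add: m_def elt_def algebra_simps)
    finally have "C = coset (of_int (m mod nrm v))" unfolding C using elt_closed(3) by (subst coset_eq) auto
    moreover have "m mod nrm v \<in> {0..<nrm v}" using nrm_coprime_pos[OF assms] by simp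
    ultimately show "C \<in> (\<lambda>n. coset (of_int n)) ` {0..<nrm v}" by blast
  qed (use elt_closed(3) in auto)
  also have "card \<dots> = card {0..<nrm v}"
  proof (rule card_image, rule inj_onI)
    fix m n assume mn: "m \<in> {0..<nrm v}" "n \<in> {0..<nrm v}" "coset (of_int m) = coset (of_int n)"
    then have "of_int (m - n) \<in> gen v" using elt_closed(3) by (subst (asm) coset_eq) auto
    then have "nrm v dvd m - n" by (simp only: of_int_in_gen_iff[OF assms])
    then have "m mod nrm v = n mod nrm v" by (simp add: mod_eq_dvd_iff)
    with mn show "m = n" by simp
  qed
  finally show ?thesis by (simp add: ideal_norm_def)
qed

text \<open>
  The generator of the ideal which enters into \<^const>\<open>C_coeff\<close>.
\<close>
definition rep :: "complex set \<Rightarrow> int \<times> int"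
  where "rep b = bottom (ideal_matrix \<zz> b)"

lemma ideal_matrix:
  assumes "b \<in> primitive_ideals \<zz>"
  shows "ideal_matrix \<zz> b \<in> SL2Z" "rep b \<in> coprime_pairs" "gen (rep b) = b"
proof -
  obtain v where v: "v \<in> coprime_pairs" "b = gen v" using assms by (auto simp: primitive_ideals_eq)
  have "completion v \<in> SL2Z \<and> b = PIdl\<^bsub>R\<^esub> (automorphy (completion v) \<zz>)"
    using completion[OF v(1)] v(2) by (simp add: automorphy_elt gen_def)
  then have *: "ideal_matrix \<zz> b \<in> SL2Z \<and> b = PIdl\<^bsub>R\<^esub> (automorphy (ideal_matrix \<zz> b) \<zz>)"
    unfolding ideal_matrix_def by (rule someI)
  then show "ideal_matrix \<zz> b \<in> SL2Z" by blast
  then show "rep b \<in> coprime_pairs" unfolding rep_def by (rule bottom_coprime)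
  show "gen (rep b) = b" using * by (simp add: gen_def rep_def automorphy_elt)
qed

lemma bij_betw_emult_unit: "u \<in> units \<Longrightarrow> bij_betw (emult u) coprime_pairs coprime_pairs"
  using bij_betw_act_right[OF stab_SL2Z] unfolding act_right_stab[abs_def] .

lemma emult_unit_coprime: "u \<in> units \<Longrightarrow> v \<in> coprime_pairs \<Longrightarrow> emult u v \<in> coprime_pairs"
  by (rule bij_betwE[OF bij_betw_emult_unit, rule_format])

lemma econj_coprime: "v \<in> coprime_pairs \<Longrightarrow> econj v \<in> coprime_pairs"
proof -
  assume v: "v \<in> coprime_pairs"
  define M where "M = completion v"
  have M: "M \<in> SL2Z" "bottom M = v" using completion[OF v] by (auto simp: M_def)
  have "mat2 (M $ 1 $ 1) (- M $ 1 $ 2 - tr * M $ 1 $ 1) (- M $ 2 $ 1) (M $ 2 $ 2 + tr * M $ 2 $ 1) \<in> SL2Z"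
    using M(1) by (auto simp: SL2Z_iff algebra_simps)
  from bottom_coprime[OF this] M(2)[symmetric] show ?thesis by (simp add: bottom_def econj_def)
qed

text \<open>
  The coprime pairs are the generators of the primitive ideals, and the generators of one
  ideal form one orbit under the units.
\<close>
lemma bij_betw_ideals_units:
  "bij_betw (\<lambda>(b, u). emult u (rep b)) (primitive_ideals \<zz> \<times> units) coprime_pairs"
  unfolding bij_betw_def
proof
  show "inj_on (\<lambda>(b, u). emult u (rep b)) (primitive_ideals \<zz> \<times> units)"
  proof (rule inj_onI, clarify)
    fix b u b' u'
    assume b: "b \<in> primitive_ideals \<zz>" "b' \<in> primitive_ideals \<zz>" and u: "u \<in> units" "u' \<in> units"
      and eq: "emult u (rep b) = emult u' (rep b')"
    have "gen (rep b) = gen (rep b')"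
      using eq gen_unit_multiple[OF u(1), of "rep b"] gen_unit_multiple[OF u(2), of "rep b'"] by simp
    then have bb: "b = b'" using ideal_matrix(3) b by simp
    have "elt (rep b) \<noteq> 0"
      using ideal_matrix(2)[OF b(1)] by (auto simp: elt_eq_0 coprime_pairs_def)
    moreover have "elt u * elt (rep b) = elt u' * elt (rep b)"
      using eq by (metis bb elt_emult)
    ultimately have "u = u'" by (simp add: elt_inject)
    with bb show "b = b' \<and> u = u'" by simp
  qed
  show "(\<lambda>(b, u). emult u (rep b)) ` (primitive_ideals \<zz> \<times> units) = coprime_pairs"
  proof (intro equalityI subsetI)
    fix v assume v: "v \<in> coprime_pairs"
    then have b: "gen v \<in> primitive_ideals \<zz>" by (simp add: primitive_ideals_eq)
    have "rep (gen v) \<noteq> (0, 0)"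
      using ideal_matrix(2)[OF b] by (auto simp: coprime_pairs_def)
    then obtain u where "u \<in> units" "v = emult u (rep (gen v))"
      using gen_eqD[OF ideal_matrix(3)[OF b]] by blast
    with b show "v \<in> (\<lambda>(b, u). emult u (rep b)) ` (primitive_ideals \<zz> \<times> units)"
      by (intro image_eqI[of _ _ "(gen v, u)"]) auto
  next
    fix v assume "v \<in> (\<lambda>(b, u). emult u (rep b)) ` (primitive_ideals \<zz> \<times> units)"
    then obtain x where x: "x \<in> primitive_ideals \<zz> \<times> units" "v = emult (snd x) (rep (fst x))"
      unfolding case_prod_unfold by blast
    then show "v \<in> coprime_pairs"
      using emult_unit_coprime[of "snd x" "rep (fst x)"] ideal_matrix(2)[of "fst x"] by (auto simp: mem_Times_iff)
  qed
qed

end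

section \<open>Sums over primitive ideals\<close>

lemma power_le_fact_exp:
  fixes x :: real
  assumes "x \<ge> 0"
  shows "x ^ r \<le> fact r * exp x"
proof -
  have "(\<Sum>n\<in>{r}. x ^ n /\<^sub>R fact n) \<le> exp x"
    unfolding exp_def using assms summable_exp_generic[of x] by (intro sum_le_suminf) auto
  then show ?thesis by (simp add: field_simps)
qed

context elliptic_point
begin

definition phase :: "nat \<Rightarrow> real \<Rightarrow> complex"
  where "phase n x = cusp_exp n (of_real x)"

lemma phase_add_int: "phase n (x + of_int j) = phase n x"
  using cusp_exp_add_int[of n "of_real x" j] by (simp add: phase_def)

lemma phase_minus: "phase n (- x) = cnj (phase n x)"
  by (simp add: phase_def cusp_exp_def exp_cnj)

lemma norm_phase: "cmod (phase n x) = 1"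
  by (simp add: phase_def norm_cusp_exp)

definition direction :: "int \<times> int \<Rightarrow> complex"
  where "direction v = cnj (elt v) / of_real (cmod (elt v))"

text \<open>
  The unimodular part of a term of the Poincare series at \<open>\<zz>\<close>: the phase of
  \<open>exp (- 2 \<pi> i n M \<zz>)\<close> times that of \<open>(c \<zz> + d) ^ (- k)\<close>. It is the complex number of which
  \<^const>\<open>C_coeff\<close> takes the real part.
\<close>
definition theta :: "nat \<Rightarrow> nat \<Rightarrow> int \<times> int \<Rightarrow> complex"
  where "theta k n v = phase n (Re (moebius_act (completion v) \<zz>)) * direction v ^ k"

lemma theta_bottom:
  assumes "M \<in> SL2Z"
  shows "theta k n (bottom M) = phase n (Re (moebius_act M \<zz>)) * direction (bottom M) ^ k"
proof -
  note N = completion[OF bottom_coprime[OF assms]]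
  obtain j where "\<And>z. Im z \<noteq> 0 \<Longrightarrow> moebius_act (completion (bottom M)) z = moebius_act M z + of_int j"
    using bottom_eq_translate[OF assms N(1) N(2)[symmetric]] by blast
  then have "Re (moebius_act (completion (bottom M)) \<zz>) = Re (moebius_act M \<zz>) + of_int j" by simp
  then show ?thesis by (simp only: theta_def phase_add_int)
qed

lemma theta_unit:
  assumes "u \<in> units" "v \<in> coprime_pairs"
  shows "theta k n (emult u v) = cnj (elt u) ^ k * theta k n v"
proof -
  note M = completion[OF assms(2)] and N = completion[OF emult_unit_coprime[OF assms]]
  obtain j where "moebius_act (completion (emult u v)) \<zz> = moebius_act (completion v) \<zz> + of_int j"
    using orbit_unit_multiple[OF M(1) N(1) assms(1)] M(2) N(2) by auto
  then have "Re (moebius_act (completion (emult u v)) \<zz>) = Re (moebius_act (completion v) \<zz>) + of_int j"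
    by simp
  moreover have "cmod (elt u) = 1"
    using cmod_elt[of u] assms(1) by (simp add: units_def abs_square_eq_1)
  then have "direction (emult u v) = cnj (elt u) * direction v"
    by (simp add: direction_def elt_emult norm_mult)
  ultimately show ?thesis
    by (simp add: theta_def phase_add_int power_mult_distrib)
qed

lemma theta_econj:
  assumes "v \<in> coprime_pairs"
  shows "theta k n (econj v) = cnj (theta k n v)"
proof -
  note M = completion[OF assms] and N = completion[OF econj_coprime[OF assms]]
  obtain j where "Re (moebius_act (completion (econj v)) \<zz>) = - Re (moebius_act (completion v) \<zz>) + of_int j"
    using orbit_econj[OF M(1) N(1)] M(2) N(2) by auto
  moreover have "direction (econj v) = cnj (direction v)"
    by (simp add: direction_def elt_econj)
  ultimately show ?thesis
    by (simp only: theta_def phase_add_int phase_minus complex_cnj_mult complex_cnj_power)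
qed

lemma norm_theta:
  assumes "v \<in> coprime_pairs"
  shows "cmod (theta k n v) = 1"
proof -
  have "elt v \<noteq> 0" using assms by (auto simp: elt_eq_0 coprime_pairs_def)
  then have "cmod (direction v) = 1" by (simp add: direction_def norm_divide)
  then show ?thesis by (simp add: theta_def norm_mult norm_power norm_phase)
qed

text \<open>
  Reindexing by the unit \<open>\<zz>\<close> multiplies the sum by \<open>cnj (\<zz> ^ k)\<close>, which differs from one.
\<close>
lemma theta_sum_eq_0:
  assumes "\<not> 2 * omega \<zz> dvd k"
  shows "(\<Sum>\<^sub>\<infinity>v\<in>coprime_pairs. theta k n v * of_real (W (nrm v))) = 0"
proof -
  define s where "s = (\<Sum>\<^sub>\<infinity>v\<in>coprime_pairs. theta k n v * of_real (W (nrm v)))"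
  have u: "(1, 0) \<in> units" by (simp add: units_eq)
  have "s = (\<Sum>\<^sub>\<infinity>v\<in>coprime_pairs. theta k n (emult (1, 0) v) * of_real (W (nrm (emult (1, 0) v))))"
    unfolding s_def by (rule infsum_reindex_bij_betw[OF bij_betw_emult_unit[OF u], symmetric])
  also have "\<dots> = (\<Sum>\<^sub>\<infinity>v\<in>coprime_pairs. cnj (elt (1, 0)) ^ k * (theta k n v * of_real (W (nrm v))))"
  proof (rule infsum_cong)
    fix v assume v: "v \<in> coprime_pairs"
    have "nrm (emult (1, 0) v) = nrm v" by (simp add: nrm_emult) (simp add: nrm_def)
    then show "theta k n (emult (1, 0) v) * of_real (W (nrm (emult (1, 0) v)))
        = cnj (elt (1, 0)) ^ k * (theta k n v * of_real (W (nrm v)))"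
      by (simp add: theta_unit[OF u v])
  qed
  also have "\<dots> = cnj (elt (1, 0)) ^ k * s"
    unfolding s_def by (rule infsum_cmult_right')
  also have "cnj (elt (1, 0)) ^ k = cnj (\<zz> ^ k)" by (simp add: elt_def)
  finally have "(1 - cnj (\<zz> ^ k)) * s = 0" by (simp add: algebra_simps)
  moreover have "cnj (\<zz> ^ k) \<noteq> 1"
    using assms \<zz>_power_eq_1_iff[of k] by (metis complex_cnj_one_iff)
  ultimately show ?thesis by (simp add: s_def)
qed

text \<open>
  Reindexing by complex conjugation on \<open>\<int>[\<zz>]\<close> conjugates the sum.
\<close>
lemma theta_sum_real:
  "Im (\<Sum>\<^sub>\<infinity>v\<in>coprime_pairs. theta k n v * of_real (W (nrm v))) = 0"
proof -
  define s where "s = (\<Sum>\<^sub>\<infinity>v\<in>coprime_pairs. theta k n v * of_real (W (nrm v)))"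
  have bij: "bij_betw econj coprime_pairs coprime_pairs"
    by (rule bij_betw_byWitness[where f' = econj]) (use econj_coprime in auto)
  have "s = (\<Sum>\<^sub>\<infinity>v\<in>coprime_pairs. theta k n (econj v) * of_real (W (nrm (econj v))))"
    unfolding s_def by (rule infsum_reindex_bij_betw[OF bij, symmetric])
  also have "\<dots> = (\<Sum>\<^sub>\<infinity>v\<in>coprime_pairs. cnj (theta k n v * of_real (W (nrm v))))"
    by (rule infsum_cong) (simp add: theta_econj)
  also have "\<dots> = cnj s" unfolding s_def by (rule infsum_cnj)
  finally have "Im s = Im (cnj s)" by simp
  then show ?thesis by (simp add: s_def)
qed

lemma inj_on_rep: "inj_on rep (primitive_ideals \<zz>)"
  using ideal_matrix(3) by (intro inj_on_inverseI[of _ gen]) auto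

lemma summable_on_rep:
  fixes f :: "int \<times> int \<Rightarrow>
    'b :: {uniform_topological_group_add, topological_comm_monoid_add, ab_group_add, complete_uniform_space}"
  assumes "f summable_on coprime_pairs"
  shows "(\<lambda>b. f (rep b)) summable_on primitive_ideals \<zz>"
proof -
  have "f summable_on rep ` primitive_ideals \<zz>"
    by (rule summable_on_subset[OF assms]) (use ideal_matrix(2) in blast)
  then show ?thesis
    using summable_on_reindex[OF inj_on_rep, of f] by (simp add: o_def)
qed

text \<open>
  If \<open>2 * omega \<zz>\<close> divides \<open>k\<close>, the summand takes the same value on all \<open>2 * omega \<zz>\<close>
  generators of an ideal. As the whole sum is real, the terms may be replaced by their real
  parts.
\<close>
lemma theta_sum_ideals:
  assumes k: "2 * omega \<zz> dvd k"
    and summable: "(\<lambda>v. theta k n v * of_real (W (nrm v))) summable_on coprime_pairs"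
  shows "(\<Sum>\<^sub>\<infinity>v\<in>coprime_pairs. theta k n v * of_real (W (nrm v)))
    = of_nat (2 * omega \<zz>) * of_real (\<Sum>\<^sub>\<infinity>b\<in>primitive_ideals \<zz>. Re (theta k n (rep b)) * W (nrm (rep b)))"
proof -
  define f where "f = (\<lambda>v. theta k n v * of_real (W (nrm v)))"
  define P where "P = primitive_ideals \<zz>"
  have unit: "f (emult u v) = f v" if "u \<in> units" "v \<in> coprime_pairs" for u v
  proof -
    have "nrm (emult u v) = nrm v" using that(1) by (simp add: nrm_emult units_def)
    moreover have "cnj (elt u) ^ k = 1"
      using unit_power_eq_1[OF that(1) k] by (metis complex_cnj_one complex_cnj_power)
    ultimately show ?thesis by (simp add: f_def theta_unit[OF that])
  qed
  have fs: "f summable_on coprime_pairs" using summable by (simp add: f_def)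
  have fP: "(\<lambda>b. f (rep b)) summable_on P"
    unfolding P_def by (rule summable_on_rep[OF fs])
  have "(f has_sum infsum f coprime_pairs) coprime_pairs"
    using fs by (rule has_sum_infsum)
  then have "((\<lambda>x. f ((\<lambda>(b, u). emult u (rep b)) x)) has_sum infsum f coprime_pairs) (P \<times> units)"
    unfolding P_def by (subst has_sum_reindex_bij_betw[OF bij_betw_ideals_units])
  then have "((\<lambda>b. of_nat (2 * omega \<zz>) * f (rep b)) has_sum infsum f coprime_pairs) P"
  proof (rule has_sum_SigmaD)
    fix b assume b: "b \<in> P"
    have "((\<lambda>u. f (rep b)) has_sum of_nat (card units) * f (rep b)) units"
      by (rule has_sum_finiteI[OF finite_units]) simp
    also have "?this \<longleftrightarrow> ((\<lambda>u. f (case (b, u) of (b, u) \<Rightarrow> emult u (rep b))) has_sum of_nat (2 * omega \<zz>) * f (rep b)) units"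
      unfolding card_units using unit b ideal_matrix(2)
      by (intro has_sum_cong) (simp add: P_def)
    finally show "((\<lambda>u. f (case (b, u) of (b, u) \<Rightarrow> emult u (rep b))) has_sum of_nat (2 * omega \<zz>) * f (rep b)) units" .
  qed
  then have "infsum f coprime_pairs = (\<Sum>\<^sub>\<infinity>b\<in>P. of_nat (2 * omega \<zz>) * f (rep b))"
    by (simp only: infsumI)
  also have "\<dots> = of_nat (2 * omega \<zz>) * (\<Sum>\<^sub>\<infinity>b\<in>P. f (rep b))"
    by (rule infsum_cmult_right')
  finally have eq: "infsum f coprime_pairs = of_nat (2 * omega \<zz>) * (\<Sum>\<^sub>\<infinity>b\<in>P. f (rep b))" .
  have om: "omega \<zz> > 0" by (simp add: omega_eq tr_def)
  have "Im (infsum f coprime_pairs) = 0" unfolding f_def by (rule theta_sum_real)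
  then have "Im (\<Sum>\<^sub>\<infinity>b\<in>P. f (rep b)) = 0" unfolding eq using om by simp
  moreover have "Re (\<Sum>\<^sub>\<infinity>b\<in>P. f (rep b)) = (\<Sum>\<^sub>\<infinity>b\<in>P. Re (f (rep b)))"
    using infsum_Re[OF fP] by simp
  ultimately have "(\<Sum>\<^sub>\<infinity>b\<in>P. f (rep b)) = of_real (\<Sum>\<^sub>\<infinity>b\<in>P. Re (f (rep b)))"
    by (simp add: complex_eq_iff)
  with eq show ?thesis by (simp add: f_def P_def)
qed

text \<open>
  This identifies the rational number in the exponent of \<^const>\<open>C_coeff\<close>: it is the real part of an
  orbit point.
\<close>
lemma Re_orbit:
  "Re (moebius_act M \<zz>) = (of_int (M $ 1 $ 1) * of_int (M $ 2 $ 1) * (cmod \<zz>)\<^sup>2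
      + of_int (M $ 1 $ 2) * of_int (M $ 2 $ 2)
      + Re \<zz> * (of_int (M $ 1 $ 1) * of_int (M $ 2 $ 2) + of_int (M $ 1 $ 2) * of_int (M $ 2 $ 1)))
    / of_int (nrm (bottom M))"
proof -
  define al where "al = elt (bottom M)"
  have al: "Re al = of_int (M $ 2 $ 1) * Re \<zz> + of_int (M $ 2 $ 2)" "Im al = of_int (M $ 2 $ 1) * Im \<zz>"
    by (simp_all add: al_def elt_def bottom_def)
  have D: "(Re al)\<^sup>2 + (Im al)\<^sup>2 = of_int (nrm (bottom M))"
    using cmod_elt[of "bottom M"] by (simp add: al_def cmod_power2)
  show ?thesis
    unfolding moebius_act_eq automorphy_elt al_def[symmetric] Re_divide D cmod_power2
    by (simp add: al power2_eq_square algebra_simps)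
qed

lemma cis_minus_Arg_elt:
  assumes "elt v \<noteq> 0"
  shows "cis (- Arg (elt v)) = direction v"
proof -
  have "cis (- Arg (elt v)) = cnj (cis (Arg (elt v)))" by (simp add: cis_cnj)
  also have "\<dots> = cnj (sgn (elt v))" using assms by (simp add: cis_Arg)
  finally show ?thesis by (simp add: direction_def sgn_div_norm scaleR_conv_of_real divide_inverse mult.commute)
qed

lemma C_coeff_eq:
  assumes "b \<in> primitive_ideals \<zz>"
  shows "C_coeff k \<zz> b n = Re (theta k n (rep b))"
proof -
  define M where "M = ideal_matrix \<zz> b"
  note im = ideal_matrix[OF assms]
  have M: "M \<in> SL2Z" "bottom M = rep b" using im by (auto simp: M_def rep_def)
  have N1: "nrm (rep b) \<ge> 1" by (rule nrm_coprime_pos[OF im(2)])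
  have N: "real (ideal_norm \<zz> b) = of_int (nrm (rep b))"
    using ideal_norm_gen[OF im(2)] im(3) N1 by simp
  have nz: "elt (rep b) \<noteq> 0" using im(2) by (auto simp: elt_eq_0 coprime_pairs_def)
  define x where "x = Re (moebius_act M \<zz>)"
  have "C_coeff k \<zz> b n = Re (e (- (real n * x) - real k / (2 * pi) * Arg (elt (rep b))))"
  proof -
    have "of_real (of_int (M $ 2 $ 1)) * \<zz> + of_real (of_int (M $ 2 $ 2)) = elt (rep b)"
      unfolding M(2)[symmetric] by (simp add: elt_def bottom_def)
    moreover have "- (real n / N') * X = - (real n * (X / N'))" for N' X :: real by simp
    ultimately show ?thesis
      unfolding C_coeff_def Let_def M_def[symmetric] N x_def Re_orbit M(2) by (simp only:)
  qed
  also have "e (- (real n * x) - real k / (2 * pi) * Arg (elt (rep b))) = theta k n (rep b)"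
  proof -
    have "2 * pi * \<i> * of_real (- (real n * x) - real k / (2 * pi) * Arg (elt (rep b)))
      = - (2 * pi * \<i> * of_nat n * of_real x) + of_nat k * (\<i> * of_real (- Arg (elt (rep b))))"
      by (simp add: field_simps)
    then have "e (- (real n * x) - real k / (2 * pi) * Arg (elt (rep b))) =
        phase n x * cis (- Arg (elt (rep b))) ^ k"
      unfolding e_def phase_def cusp_exp_def cis_conv_exp by (simp only: exp_add exp_of_nat_mult)
    also have "\<dots> = theta k n (rep b)"
      by (simp only: theta_bottom[OF M(1), unfolded M(2)] cis_minus_Arg_elt[OF nz] x_def)
    finally show ?thesis .
  qed
  finally show ?thesis .
qed

text \<open>
  The part of a term of the expansions that depends on the ideal only through its norm.
\<close>
definition weight :: "nat \<Rightarrow> nat \<Rightarrow> nat \<Rightarrow> nat \<Rightarrow> int \<Rightarrow> real"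
  where "weight k l r n N = 1 / real_of_int N powr (real k / 2 - real l) * real n ^ r *
    exp (2 * pi * real n / real_of_int N * Im \<zz>)"

lemma F_term_eq:
  assumes "b \<in> primitive_ideals \<zz>"
  shows "F_term k l r \<zz> n b = Re (theta k n (rep b)) * weight k l r n (nrm (rep b))"
proof -
  note im = ideal_matrix[OF assms]
  have N1: "nrm (rep b) \<ge> 1" by (rule nrm_coprime_pos[OF im(2)])
  have "real (ideal_norm \<zz> b) = of_int (nrm (rep b))"
    using ideal_norm_gen[OF im(2)] im(3) N1 by simp
  then show ?thesis
    by (simp add: F_term_def C_coeff_eq[OF assms] weight_def)
qed

lemma inverse_nrm_square_bound:
  obtains B where "B \<ge> 0" "\<And>v. v \<in> coprime_pairs \<Longrightarrow> 1 / (real_of_int (nrm v))\<^sup>2 \<le> B * majorant v"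
proof -
  define C where "C = 1 + (1 + cmod \<zz>) / Im \<zz>"
  have C: "C > 0" using Im_\<zz>_bounds(1) by (auto simp: C_def intro!: add_pos_nonneg divide_nonneg_pos)
  have "1 / (real_of_int (nrm v))\<^sup>2 \<le> 16 * C ^ 4 * majorant v" if v: "v \<in> coprime_pairs" for v
  proof -
    obtain c d where cd: "v = (c, d)" by force
    have "\<bar>of_int c\<bar> + \<bar>of_int d\<bar> \<le> C * cmod (elt v)"
      unfolding C_def elt_def cd fst_conv snd_conv
      by (rule linear_form_lower_bound) (use Im_\<zz>_bounds in auto)
    then have "1 / cmod (elt v) ^ 4 \<le> 16 * C ^ 4 * majorant (c, d)"
      using v C by (intro majorant_bound) (auto simp: cd)
    moreover have "cmod (elt v) ^ 4 = (real_of_int (nrm v))\<^sup>2"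
      unfolding cmod_elt[symmetric] by simp
    ultimately show ?thesis by (simp add: cd)
  qed
  then show ?thesis using that[of "16 * C ^ 4"] C by simp
qed

lemma inverse_nrm_square_summable:
  "(\<lambda>v. 1 / (real_of_int (nrm v))\<^sup>2) summable_on coprime_pairs"
proof -
  obtain B where B: "\<And>v. v \<in> coprime_pairs \<Longrightarrow> 1 / (real_of_int (nrm v))\<^sup>2 \<le> B * majorant v"
    using inverse_nrm_square_bound by metis
  have "(\<lambda>v. B * majorant v) summable_on coprime_pairs"
    by (intro summable_on_cmult_right majorant_summable)
  then show ?thesis
    by (rule summable_on_comparison_test) (use B in auto)
qed

lemma weight_bound:
  assumes "real k / 2 - real l \<ge> 2" "N \<ge> 1"
  shows "\<bar>weight k l r n N\<bar> \<le> real n ^ r * exp (2 * pi * real n * Im \<zz>) * (1 / (real_of_int N)\<^sup>2)"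
proof -
  have N: "real_of_int N \<ge> 1" using assms(2) by simp
  have "real_of_int N powr 2 \<le> real_of_int N powr (real k / 2 - real l)"
    using assms(1) N by (intro powr_mono) auto
  then have 1: "1 / real_of_int N powr (real k / 2 - real l) \<le> 1 / (real_of_int N)\<^sup>2"
    using N by (intro divide_left_mono) (auto simp: powr_numeral intro!: mult_pos_pos)
  have "2 * pi * real n / real_of_int N * Im \<zz> \<le> 2 * pi * real n * Im \<zz>"
  proof (rule mult_right_mono)
    show "2 * pi * real n / real_of_int N \<le> 2 * pi * real n"
      using N divide_left_mono[of 1 "real_of_int N" "2 * pi * real n"] by simp
  qed (use Im_\<zz>_bounds in auto)
  then have 2: "exp (2 * pi * real n / real_of_int N * Im \<zz>) \<le> exp (2 * pi * real n * Im \<zz>)" by simp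
  have "\<bar>weight k l r n N\<bar> = 1 / real_of_int N powr (real k / 2 - real l) * real n ^ r *
      exp (2 * pi * real n / real_of_int N * Im \<zz>)"
    by (simp add: weight_def abs_mult)
  also have "\<dots> \<le> 1 / (real_of_int N)\<^sup>2 * real n ^ r * exp (2 * pi * real n * Im \<zz>)"
    by (intro mult_mono 1 2) auto
  finally show ?thesis by (simp add: mult_ac)
qed

lemma theta_weight_summable:
  assumes "real k / 2 - real l \<ge> 2"
  shows "(\<lambda>v. theta k n v * of_real (weight k l r n (nrm v))) summable_on coprime_pairs"
proof -
  have "(\<lambda>v. real n ^ r * exp (2 * pi * real n * Im \<zz>) * (1 / (real_of_int (nrm v))\<^sup>2)) summable_on coprime_pairs"
    by (intro summable_on_cmult_right inverse_nrm_square_summable)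
  then have "(\<lambda>v. cmod (theta k n v * of_real (weight k l r n (nrm v)))) summable_on coprime_pairs"
  proof (rule Infinite_Sum.abs_summable_on_comparison_test')
    fix v assume v: "v \<in> coprime_pairs"
    show "cmod (theta k n v * of_real (weight k l r n (nrm v)))
        \<le> real n ^ r * exp (2 * pi * real n * Im \<zz>) * (1 / (real_of_int (nrm v))\<^sup>2)"
      using weight_bound[OF assms nrm_coprime_pos[OF v], of r n] norm_theta[OF v] by (simp add: norm_mult)
  qed
  then show ?thesis by (rule abs_summable_summable)
qed

lemma F_coeff_eq_sum_pairs:
  assumes "2 * omega \<zz> dvd k" "real k / 2 - real l \<ge> 2"
  shows "(\<Sum>\<^sub>\<infinity>v\<in>coprime_pairs. theta k n v * of_real (weight k l r n (nrm v)))
    = of_nat (2 * omega \<zz>) * of_real (F_coeff k l r \<zz> n)"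
proof -
  have "(\<Sum>\<^sub>\<infinity>b\<in>primitive_ideals \<zz>. Re (theta k n (rep b)) * weight k l r n (nrm (rep b))) = F_coeff k l r \<zz> n"
    unfolding F_coeff_def by (rule infsum_cong) (simp add: F_term_eq)
  then show ?thesis
    using theta_sum_ideals[OF assms(1) theta_weight_summable[OF assms(2)]] by simp
qed

lemma F_term_bound:
  assumes "real k / 2 - real l \<ge> 2" "b \<in> primitive_ideals \<zz>"
  shows "\<bar>F_term k l r \<zz> n b\<bar> \<le> real n ^ r * exp (2 * pi * real n * Im \<zz>) * (1 / (real_of_int (nrm (rep b)))\<^sup>2)"
proof -
  note im = ideal_matrix[OF assms(2)]
  have "\<bar>Re (theta k n (rep b))\<bar> \<le> 1"
    using abs_Re_le_cmod[of "theta k n (rep b)"] norm_theta[OF im(2)] by simp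
  then have "\<bar>F_term k l r \<zz> n b\<bar> \<le> 1 * \<bar>weight k l r n (nrm (rep b))\<bar>"
    unfolding F_term_eq[OF assms(2)] abs_mult by (intro mult_right_mono) auto
  also have "\<dots> \<le> real n ^ r * exp (2 * pi * real n * Im \<zz>) * (1 / (real_of_int (nrm (rep b)))\<^sup>2)"
    using weight_bound[OF assms(1) nrm_coprime_pos[OF im(2)]] by simp
  finally show ?thesis .
qed

lemma F_term_summable:
  assumes "real k / 2 - real l \<ge> 2"
  shows "F_term k l r \<zz> n summable_on primitive_ideals \<zz>"
proof -
  have "(\<lambda>b. real n ^ r * exp (2 * pi * real n * Im \<zz>) * (1 / (real_of_int (nrm (rep b)))\<^sup>2)) summable_on primitive_ideals \<zz>"
    by (intro summable_on_cmult_right summable_on_rep inverse_nrm_square_summable)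
  then have "(\<lambda>b. norm (F_term k l r \<zz> n b)) summable_on primitive_ideals \<zz>"
    by (rule Infinite_Sum.abs_summable_on_comparison_test') (simp only: real_norm_def F_term_bound[OF assms])
  then show ?thesis by (rule abs_summable_summable)
qed

text \<open>
  The exponential factor is largest for norm one. The coefficients therefore grow like
  \<open>exp (2 \<pi> n Im \<zz>)\<close>, which makes \<open>Im z = Im \<zz>\<close> the boundary of the region of convergence
  below.
\<close>
lemma F_coeff_bound:
  assumes "real k / 2 - real l \<ge> 2"
  obtains D where "D \<ge> 0" "\<And>n. \<bar>F_coeff k l r \<zz> n\<bar> \<le> D * real n ^ r * exp (2 * pi * real n * Im \<zz>)"
proof -
  define D where "D = (\<Sum>\<^sub>\<infinity>b\<in>primitive_ideals \<zz>. 1 / (real_of_int (nrm (rep b)))\<^sup>2)"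
  have "\<bar>F_coeff k l r \<zz> n\<bar> \<le> D * real n ^ r * exp (2 * pi * real n * Im \<zz>)" for n
  proof -
    define E where "E = real n ^ r * exp (2 * pi * real n * Im \<zz>)"
    have "norm (F_coeff k l r \<zz> n) \<le> (\<Sum>\<^sub>\<infinity>b\<in>primitive_ideals \<zz>. E * (1 / (real_of_int (nrm (rep b)))\<^sup>2))"
    proof (rule norm_infsum_le)
      show "(F_term k l r \<zz> n has_sum F_coeff k l r \<zz> n) (primitive_ideals \<zz>)"
        unfolding F_coeff_def by (rule has_sum_infsum[OF F_term_summable[OF assms]])
      show "((\<lambda>b. E * (1 / (real_of_int (nrm (rep b)))\<^sup>2)) has_sum
          (\<Sum>\<^sub>\<infinity>b\<in>primitive_ideals \<zz>. E * (1 / (real_of_int (nrm (rep b)))\<^sup>2))) (primitive_ideals \<zz>)"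
        by (intro has_sum_infsum summable_on_cmult_right summable_on_rep inverse_nrm_square_summable)
    qed (simp only: real_norm_def F_term_bound[OF assms] E_def)
    also have "\<dots> = E * D" unfolding D_def by (rule infsum_cmult_right')
    finally show ?thesis by (simp add: E_def mult_ac)
  qed
  moreover have "D \<ge> 0" unfolding D_def by (rule infsum_nonneg) simp
  ultimately show ?thesis using that by blast
qed

lemma F_series_summable:
  assumes "real k / 2 - real l \<ge> 2" "cmod q < exp (- 2 * pi * Im \<zz>)"
  shows "summable (\<lambda>n. of_real (F_coeff k l r \<zz> n) * q ^ n :: complex)"
proof -
  obtain D where D: "D \<ge> 0" "\<And>n. \<bar>F_coeff k l r \<zz> n\<bar> \<le> D * real n ^ r * exp (2 * pi * real n * Im \<zz>)"
    using F_coeff_bound[OF assms(1)] by blast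
  define x where "x = cmod q * exp (2 * pi * Im \<zz>)"
  have x: "0 \<le> x" "x < 1"
  proof -
    have "x < exp (- 2 * pi * Im \<zz>) * exp (2 * pi * Im \<zz>)"
      unfolding x_def using assms(2) by (intro mult_strict_right_mono) auto
    also have "\<dots> = 1" by (simp flip: exp_add)
    finally show "x < 1" .
  qed (simp add: x_def)
  \<comment> \<open>half of the room between \<open>x\<close> and one is spent on the factor \<open>n ^ r\<close>\<close>
  obtain \<delta> where \<delta>: "\<delta> > 0" "exp \<delta> * x < 1"
  proof (cases "x = 0")
    case True
    then show ?thesis using that[of 1] by simp
  next
    case False
    then have "0 < x" using x by simp
    then have "exp (- ln x / 2) * x < 1"
    proof -
      have "exp (- ln x / 2) * x = exp (- ln x / 2) * exp (ln x)" using \<open>0 < x\<close> by simp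
      also have "\<dots> = exp (ln x / 2)" by (simp flip: exp_add)
      also have "\<dots> < 1" using x(2) \<open>0 < x\<close> by simp
      finally show ?thesis .
    qed
    then show ?thesis using that[of "- ln x / 2"] x(2) \<open>0 < x\<close> by simp
  qed
  have "summable (\<lambda>n. D * (fact r / \<delta> ^ r) * (exp \<delta> * x) ^ n)"
    using \<delta> x by (intro summable_mult summable_geometric) simp
  then show ?thesis
  proof (rule summable_comparison_test'[of _ 0])
    fix n :: nat
    have "real n ^ r \<le> fact r / \<delta> ^ r * exp \<delta> ^ n"
    proof -
      have "(\<delta> * real n) ^ r \<le> fact r * exp (\<delta> * real n)"
        using \<delta> by (intro power_le_fact_exp) simp
      also have "exp (\<delta> * real n) = exp \<delta> ^ n"
        by (metis exp_of_nat_mult mult.commute)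
      finally show ?thesis using \<delta> by (simp add: field_simps power_mult_distrib)
    qed
    moreover have "exp (2 * pi * real n * Im \<zz>) = exp (2 * pi * Im \<zz>) ^ n"
      by (simp add: mult_ac flip: exp_of_nat_mult)
    ultimately have "\<bar>F_coeff k l r \<zz> n\<bar> \<le> D * (fact r / \<delta> ^ r * exp \<delta> ^ n) * exp (2 * pi * Im \<zz>) ^ n"
      using D by (smt (verit) exp_gt_zero mult_left_mono mult_right_mono zero_le_power)
    then have "\<bar>F_coeff k l r \<zz> n\<bar> * cmod q ^ n \<le> D * (fact r / \<delta> ^ r * exp \<delta> ^ n) * exp (2 * pi * Im \<zz>) ^ n * cmod q ^ n"
      by (intro mult_right_mono) auto
    also have "\<dots> = D * (fact r / \<delta> ^ r) * (exp \<delta> * x) ^ n"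
      by (simp add: x_def power_mult_distrib mult_ac)
    finally show "norm (of_real (F_coeff k l r \<zz> n) * q ^ n) \<le> D * (fact r / \<delta> ^ r) * (exp \<delta> * x) ^ n"
      by (simp add: norm_mult norm_power)
  qed
qed

end

section \<open>Fourier coefficients as residues\<close>

lemma cusp_exp_eq: "cusp_exp n z = inverse (exp (2 * pi * \<i> * z) ^ n)"
proof -
  have "- (2 * pi * \<i> * of_nat n * z) = - (of_nat n * (2 * pi * \<i> * z))" by (simp add: mult_ac)
  then show ?thesis
    unfolding cusp_exp_def by (simp only: exp_minus exp_of_nat_mult)
qed

text \<open>
  In the variable \<open>q = exp (2 \<pi> i z)\<close> the integrand is, up to the factor \<open>2 \<pi> i\<close>, the
  differential \<open>g q / q ^ (n + 1) dq\<close>, whose residue at \<open>0\<close> is the Taylor coefficient \<open>c\<close>. A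
  primitive is therefore \<open>c z\<close> plus a function of \<open>q\<close>, and only \<open>c z\<close> changes over a period.
\<close>
lemma fourier_coefficient_integral:
  assumes g: "g holomorphic_on ball 0 \<rho>" "\<rho> > 0"
    and z0: "cmod (exp (2 * pi * \<i> * z0)) < \<rho>"
  shows "((\<lambda>z. g (exp (2 * pi * \<i> * z)) * cusp_exp n z) has_contour_integral (deriv ^^ n) g 0 / fact n)
    (linepath z0 (z0 + 1))"
proof -
  define c where "c = (deriv ^^ n) g 0 / fact n"
  define q where "q = (\<lambda>z. exp (2 * pi * \<i> * z))"
  define \<phi> where "\<phi> = (\<lambda>w. g w / w ^ Suc n)"
  have \<phi>: "\<phi> holomorphic_on ball 0 \<rho> - {0}"
    unfolding \<phi>_def by (intro holomorphic_intros holomorphic_on_subset[OF g(1)]) auto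
  have "not_essential \<phi> 0"
    unfolding \<phi>_def using g
    by (intro not_essential_divide not_essential_analytic isolated_singularity_at_analytic
        holomorphic_on_imp_analytic_at[OF g(1)] analytic_intros) auto
  moreover have res: "residue \<phi> 0 = c"
    using residue_holomorphic_over_power[of "ball 0 \<rho>" 0 g n] g by (simp add: \<phi>_def c_def)
  ultimately obtain \<Phi> where \<Phi>: "\<And>w. w \<in> ball 0 \<rho> - {0} \<Longrightarrow> (\<Phi> has_field_derivative \<phi> w - c / w) (at w)"
    using meromorphic_primitive[of "ball 0 \<rho>" 0 \<phi>] \<phi> g(2) by auto
  define P where "P = (\<lambda>z. \<Phi> (q z) / (2 * pi * \<i>) + c * z)"
  have norm_q: "cmod (q z) = exp (- (2 * pi * Im z))" for z by (simp add: q_def)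
  have der: "(P has_field_derivative g (q z) * cusp_exp n z) (at z)" if "cmod (q z) < \<rho>" for z
  proof -
    have nz: "q z \<noteq> 0" by (simp add: q_def)
    have dq: "(q has_field_derivative 2 * pi * \<i> * q z) (at z)"
      unfolding q_def by (auto intro!: derivative_eq_intros)
    have d1: "((\<lambda>z. \<Phi> (q z)) has_field_derivative (\<phi> (q z) - c / q z) * (2 * pi * \<i> * q z)) (at z)"
      using that nz by (intro DERIV_chain2[OF \<Phi> dq]) auto
    have "(P has_field_derivative (\<phi> (q z) - c / q z) * (2 * pi * \<i> * q z) / (2 * pi * \<i>) + c * 1) (at z)"
      unfolding P_def by (intro DERIV_add DERIV_cdivide[OF d1] DERIV_cmult DERIV_ident)
    moreover have "(\<phi> (q z) - c / q z) * (2 * pi * \<i> * q z) / (2 * pi * \<i>) + c * 1 = \<phi> (q z) * q z"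
      using nz by (simp add: field_simps)
    moreover have "cusp_exp n z = inverse (q z ^ n)" by (simp only: cusp_exp_eq q_def)
    then have "\<phi> (q z) * q z = g (q z) * cusp_exp n z"
      using nz by (simp add: \<phi>_def field_simps)
    ultimately show ?thesis by simp
  qed
  have Im_seg: "Im x = Im z0" if "x \<in> closed_segment z0 (z0 + 1)" for x
    using that by (auto simp: closed_segment_def algebra_simps)
  have "((\<lambda>z. g (q z) * cusp_exp n z) has_contour_integral
      (P (pathfinish (linepath z0 (z0 + 1))) - P (pathstart (linepath z0 (z0 + 1))))) (linepath z0 (z0 + 1))"
  proof (rule contour_integral_primitive[of "closed_segment z0 (z0 + 1)"])
    fix x assume x: "x \<in> closed_segment z0 (z0 + 1)"
    have "cmod (q x) < \<rho>" using z0 Im_seg[OF x] by (simp add: q_def)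
    then show "(P has_field_derivative g (q x) * cusp_exp n x) (at x within closed_segment z0 (z0 + 1))"
      by (rule has_field_derivative_at_within[OF der])
  qed auto
  moreover have "q (z0 + 1) = q z0"
  proof -
    have "2 * pi * \<i> * (z0 + 1) = 2 * pi * \<i> * z0 + \<i> * (of_int 1 * (of_real pi * 2))"
      by (simp add: algebra_simps)
    then show ?thesis unfolding q_def by (simp only: exp_plus_2pin)
  qed
  then have "P (z0 + 1) - P z0 = c" by (simp add: P_def algebra_simps)
  ultimately show ?thesis by (simp add: q_def c_def)
qed

context elliptic_point
begin

definition orbit :: "complex set"
  where "orbit = {moebius_act M \<zz> | M. M \<in> SL2Z}"

text \<open>
  A convex set that contains segments of length one at every height above \<open>Im \<zz> / 2\<close>, although
  it meets the orbit only in \<open>\<zz>\<close>: primitives exist on it after removal of a single residue.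
\<close>
definition half_strip :: "complex set"
  where "half_strip = {z. Im z > Im \<zz> / 2 \<and> \<bar>Re z - Re \<zz>\<bar> < 1}"

lemma half_strip_inter: "half_strip = {z. Im z > Im \<zz> / 2} \<inter> {z. Re z > Re \<zz> - 1} \<inter> {z. Re z < Re \<zz> + 1}"
  by (auto simp: half_strip_def)

lemma open_half_strip: "open half_strip"
  unfolding half_strip_inter by (intro open_Int open_halfspace_Im_gt open_halfspace_Re_gt open_halfspace_Re_lt)

lemma convex_half_strip: "convex half_strip"
  unfolding half_strip_inter by (intro convex_Int convex_halfspace_Im_gt convex_halfspace_Re_gt convex_halfspace_Re_lt)

lemma \<zz>_in_half_strip: "\<zz> \<in> half_strip"
  using Im_\<zz>_bounds(1) by (simp add: half_strip_def)

lemma Im_half_strip: "z \<in> half_strip \<Longrightarrow> Im z > 0"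
  using Im_\<zz>_bounds(1) by (auto simp: half_strip_def)

lemma orbit_half_strip: "orbit \<inter> half_strip = {\<zz>}"
proof -
  have "\<tau> = \<zz>" if \<tau>: "\<tau> \<in> orbit" "\<tau> \<in> half_strip" for \<tau>
  proof -
    obtain M where M: "M \<in> SL2Z" "\<tau> = moebius_act M \<zz>" using \<tau>(1) unfolding orbit_def by blast
    have "\<not> Im \<tau> \<le> Im \<zz> / 2" using \<tau>(2) by (auto simp: half_strip_def)
    then obtain j :: int where j: "\<tau> = \<zz> + of_int j" using orbit_height[OF M(1)] M(2) by blast
    then have "\<bar>real_of_int j\<bar> < 1" using \<tau>(2) by (simp add: half_strip_def)
    then have "j = 0" by linarith
    with j show ?thesis by simp
  qed
  moreover have "(0, 1) \<in> units" by (simp add: units_eq)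
  then have "\<zz> \<in> orbit" using stab_fixes stab_SL2Z unfolding orbit_def by force
  ultimately show ?thesis using \<zz>_in_half_strip by blast
qed

text \<open>
  The elliptic element \<open>z \<mapsto> t - 1 / z\<close> with \<open>t = tr\<close>, of order \<open>omega \<zz>\<close> in the projective
  group.
\<close>
definition rot :: "int ^ 2 ^ 2" where "rot = stab (1, 0)"

lemma rot_SL2Z: "rot \<in> SL2Z"
  unfolding rot_def by (rule stab_SL2Z) (simp add: units_eq)

lemma automorphy_rot: "automorphy rot z = z"
  by (simp add: rot_def stab_def automorphy_def)

lemma rot_act: "moebius_act rot z = (of_int tr * z - 1) / z"
  unfolding moebius_act_eq automorphy_rot by (simp add: rot_def stab_def)

lemma rot_\<zz>: "moebius_act rot \<zz> = \<zz>"
  unfolding rot_def by (rule stab_fixes) (simp add: units_eq)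

lemma rot_diff:
  assumes "Im z > 0"
  shows "moebius_act rot z - \<zz> = (z - \<zz>) / (z * \<zz>)"
    "moebius_act rot z - cnj \<zz> = (z - cnj \<zz>) / (z * cnj \<zz>)"
proof -
  have z: "Im z \<noteq> 0" using assms by simp
  have c: "Im (cnj \<zz>) \<noteq> 0" by simp
  show "moebius_act rot z - \<zz> = (z - \<zz>) / (z * \<zz>)"
    using moebius_act_diff[OF rot_SL2Z z, of \<zz>] by (simp add: rot_\<zz> automorphy_rot)
  show "moebius_act rot z - cnj \<zz> = (z - cnj \<zz>) / (z * cnj \<zz>)"
    using moebius_act_diff[OF rot_SL2Z z c] by (simp add: moebius_act_cnj rot_\<zz> automorphy_rot)
qed

lemma rot_order:
  assumes "Im z > 0"
  shows "tr = 0 \<Longrightarrow> moebius_act rot (moebius_act rot z) = z"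
    "tr = 1 \<Longrightarrow> moebius_act rot (moebius_act rot (moebius_act rot z)) = z"
proof -
  have z: "z \<noteq> 0" using assms by auto
  have z1: "z \<noteq> 1" using assms by auto
  show "tr = 0 \<Longrightarrow> moebius_act rot (moebius_act rot z) = z"
    using z by (simp add: rot_act)
  assume t: "tr = 1"
  have 1: "moebius_act rot z = (z - 1) / z" using t by (simp add: rot_act)
  have 2: "moebius_act rot ((z - 1) / z) = - 1 / (z - 1)"
    using t z z1 by (simp add: rot_act divide_simps)
  have 3: "moebius_act rot (- 1 / (z - 1)) = z"
    using t z z1 by (simp add: rot_act divide_simps)
  show "moebius_act rot (moebius_act rot (moebius_act rot z)) = z" unfolding 1 2 3 ..
qed

text \<open>
  The logarithmic derivative of \<open>X = (z - \<zz>) / (z - cnj \<zz>)\<close>. In the coordinate \<open>X\<close> the map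
  \<^const>\<open>rot\<close> is multiplication by \<open>cnj \<zz> ^ 2\<close>, so \<open>\<xi> z dz = dX / X\<close> is an invariant differential
  with residue one at \<open>\<zz>\<close>.
\<close>
definition \<xi> :: "complex \<Rightarrow> complex"
  where "\<xi> z = 1 / (z - \<zz>) - 1 / (z - cnj \<zz>)"

lemma ne_cnj_\<zz>: "Im z > 0 \<Longrightarrow> z \<noteq> cnj \<zz>"
  using Im_\<zz>_bounds(1) by auto

lemma \<xi>_rot:
  assumes "Im z > 0" "z \<noteq> \<zz>"
  shows "\<xi> (moebius_act rot z) / z\<^sup>2 = \<xi> z"
proof -
  have z: "z \<noteq> 0" "z \<noteq> cnj \<zz>" "\<zz> \<noteq> 0" "z - \<zz> \<noteq> 0" "z - cnj \<zz> \<noteq> 0"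
    using assms ne_cnj_\<zz>[OF assms(1)] Im_\<zz>_bounds(1) by auto
  define A B where "A = z - \<zz>" and "B = z - cnj \<zz>"
  have AB: "A \<noteq> 0" "B \<noteq> 0" using z by (auto simp: A_def B_def)
  have "\<xi> (moebius_act rot z) / z\<^sup>2 = 1 / (A / (z * \<zz>)) / z\<^sup>2 - 1 / (B / (z * cnj \<zz>)) / z\<^sup>2"
    unfolding \<xi>_def rot_diff[OF assms(1)] A_def B_def by (rule diff_divide_distrib)
  also have "\<dots> = (\<zz> * B - cnj \<zz> * A) / (z * (A * B))"
    using z AB by (simp add: field_simps power2_eq_square)
  also have "\<zz> * B - cnj \<zz> * A = z * (B - A)"
    by (simp add: A_def B_def algebra_simps)
  also have "z * (B - A) / (z * (A * B)) = 1 / A - 1 / B"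
    using z AB by (simp add: field_simps)
  finally show ?thesis by (simp only: \<xi>_def A_def B_def)
qed

text \<open>
  A hyperbolic disc around \<open>\<zz>\<close>, on which \<^const>\<open>rot\<close> acts. The radius \<open>3 / 10\<close> is small enough for
  the disc to lie in the half-strip and large enough for it to contain the point \<open>base_pt\<close>
  below, for which \<open>\<bar>X\<bar>\<^sup>2 = (2 - sqrt 3) / (2 + sqrt 3)\<close>.
\<close>
definition disc :: "complex set"
  where "disc = {z. cmod (z - \<zz>) < 3 / 10 * cmod (z - cnj \<zz>)}"

lemma disc_subset_half_strip: "disc \<subseteq> half_strip"
proof
  fix z assume "z \<in> disc"
  then have lt: "cmod (z - \<zz>) < 3 / 10 * cmod (z - cnj \<zz>)" by (simp add: disc_def)
  define u where "u = Re z - Re \<zz>"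
  define y where "y = Im z"
  define \<eta> where "\<eta> = Im \<zz>"
  have \<eta>: "\<eta> > 0" "\<eta> \<le> 1" using Im_\<zz>_bounds by (auto simp: \<eta>_def)
  have "(cmod (z - \<zz>))\<^sup>2 < (3 / 10 * cmod (z - cnj \<zz>))\<^sup>2"
    using lt by (intro power_strict_mono) auto
  moreover have "(cmod (z - \<zz>))\<^sup>2 = u\<^sup>2 + (y - \<eta>)\<^sup>2" "(cmod (z - cnj \<zz>))\<^sup>2 = u\<^sup>2 + (y + \<eta>)\<^sup>2"
    by (simp_all add: cmod_power2 u_def y_def \<eta>_def)
  ultimately have "u\<^sup>2 + (y - \<eta>)\<^sup>2 < 9 / 100 * (u\<^sup>2 + (y + \<eta>)\<^sup>2)"
    by (simp add: power_mult_distrib power_divide)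
  then have 1: "91 / 100 * u\<^sup>2 + (y - \<eta>)\<^sup>2 < 9 / 100 * (y + \<eta>)\<^sup>2" by (simp add: algebra_simps)
  have "(3 / 10 * (y + \<eta>))\<^sup>2 = 9 / 100 * (y + \<eta>)\<^sup>2" by (simp add: power2_eq_square algebra_simps)
  with 1 have "(y - \<eta>)\<^sup>2 < (3 / 10 * (y + \<eta>))\<^sup>2"
    using zero_le_power2[of u] by linarith
  then have "\<bar>y - \<eta>\<bar> < \<bar>3 / 10 * (y + \<eta>)\<bar>"
    using abs_le_square_iff[of "3 / 10 * (y + \<eta>)" "y - \<eta>"] by linarith
  then have 2: "\<bar>y - \<eta>\<bar> < 3 / 10 * \<bar>y + \<eta>\<bar>"
    unfolding abs_mult by simp
  have "y + \<eta> > 0"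
  proof (rule ccontr)
    assume *: "\<not> y + \<eta> > 0"
    then have "\<bar>y + \<eta>\<bar> = - (y + \<eta>)" "\<bar>y - \<eta>\<bar> = \<eta> - y" using \<eta> by auto
    with 2 * \<eta> show False by simp
  qed
  then have "\<bar>y - \<eta>\<bar> < 3 / 10 * (y + \<eta>)" using 2 by simp
  then have "y > \<eta> / 2 \<and> y + \<eta> < 3 * \<eta>" using \<eta> unfolding abs_less_iff by simp
  with \<open>y + \<eta> > 0\<close> have 3: "y > \<eta> / 2" "y + \<eta> < 3 * \<eta>" "y + \<eta> > 0" by blast+
  have "91 / 100 * u\<^sup>2 < 9 / 100 * (y + \<eta>)\<^sup>2"
    using 1 zero_le_power2[of "y - \<eta>"] by linarith
  also have "(y + \<eta>)\<^sup>2 \<le> 3\<^sup>2"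
    using 3 \<eta> by (intro power_mono) auto
  finally have "u\<^sup>2 < 1\<^sup>2" by (simp add: power2_eq_square)
  then have "\<bar>u\<bar> < 1" using abs_square_less_1[of u] by simp
  with 3 show "z \<in> half_strip" by (simp add: half_strip_def u_def y_def \<eta>_def)
qed

lemma rot_disc:
  assumes "z \<in> disc - {\<zz>}"
  shows "moebius_act rot z \<in> disc - {\<zz>}"
proof -
  have z: "Im z > 0" using assms disc_subset_half_strip Im_half_strip by blast
  have z0: "z \<noteq> 0" "\<zz> \<noteq> 0" using z Im_\<zz>_bounds(1) by auto
  have "cmod (moebius_act rot z - \<zz>) = cmod (z - \<zz>) / cmod z"
    "cmod (moebius_act rot z - cnj \<zz>) = cmod (z - cnj \<zz>) / cmod z"
    unfolding rot_diff[OF z] by (simp_all add: norm_divide norm_mult cmod_\<zz>)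
  moreover have "moebius_act rot z - \<zz> \<noteq> 0"
    unfolding rot_diff(1)[OF z] using assms z0 by simp
  moreover have "cmod (z - \<zz>) / cmod z < 3 / 10 * cmod (z - cnj \<zz>) / cmod z"
    using assms z0 by (intro divide_strict_right_mono) (auto simp: disc_def)
  ultimately have "cmod (moebius_act rot z - \<zz>) < 3 / 10 * cmod (moebius_act rot z - cnj \<zz>)"
    by (simp only: times_divide_eq_right)
  with \<open>moebius_act rot z - \<zz> \<noteq> 0\<close> show ?thesis by (simp add: disc_def)
qed

lemma open_disc: "open disc"
  unfolding disc_def by (intro open_Collect_less continuous_intros)

text \<open>
  The image of a punctured Euclidean ball under the inverse of the coordinate \<open>X\<close>.
\<close>
lemma connected_punctured_disc: "connected (disc - {\<zz>})"
proof -
  define h where "h = (\<lambda>X. (\<zz> - cnj \<zz> * X) / (1 - X))"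
  have d: "\<zz> - cnj \<zz> \<noteq> 0" using ne_cnj_\<zz>[of \<zz>] Im_\<zz>_bounds(1) by simp
  have "disc - {\<zz>} = h ` (ball 0 (3 / 10) - {0})"
  proof (intro equalityI subsetI)
    fix z assume z: "z \<in> disc - {\<zz>}"
    then have nz: "z - cnj \<zz> \<noteq> 0" using ne_cnj_\<zz>[of z] disc_subset_half_strip Im_half_strip by auto
    define X where "X = (z - \<zz>) / (z - cnj \<zz>)"
    have "cmod X < 3 / 10" using z nz by (simp add: X_def disc_def norm_divide field_simps)
    moreover have "X \<noteq> 0" using z nz by (simp add: X_def)
    moreover have "h X = z"
    proof -
      have 1: "1 - X = (\<zz> - cnj \<zz>) / (z - cnj \<zz>)" using nz by (simp add: X_def field_simps)
      have 2: "\<zz> - cnj \<zz> * X = z * (\<zz> - cnj \<zz>) / (z - cnj \<zz>)" using nz by (simp add: X_def field_simps)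
      show ?thesis unfolding h_def 1 2 using nz d by simp
    qed
    ultimately show "z \<in> h ` (ball 0 (3 / 10) - {0})" by (intro image_eqI[of _ _ X]) auto
  next
    fix z assume "z \<in> h ` (ball 0 (3 / 10) - {0})"
    then obtain X where X': "z = h X" "X \<in> ball 0 (3 / 10) - {0}" by blast
    then have X: "z = h X" "cmod X < 3 / 10" "X \<noteq> 0" by auto
    have X1: "1 - X \<noteq> 0" using X(2) by auto
    have 2: "z - cnj \<zz> = (\<zz> - cnj \<zz>) / (1 - X)"
      unfolding X(1) h_def using X1 by (simp add: field_simps)
    have "z - \<zz> = X * ((\<zz> - cnj \<zz>) / (1 - X))"
      unfolding X(1) h_def using X1 by (simp add: field_simps)
    note 1 = this[folded 2] 2
    then have "z - cnj \<zz> \<noteq> 0" using d X1 by simp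
    then have "cmod X * cmod (z - cnj \<zz>) < 3 / 10 * cmod (z - cnj \<zz>)"
      using X(2) by (intro mult_strict_right_mono) auto
    moreover have "cmod (z - \<zz>) = cmod X * cmod (z - cnj \<zz>)" by (simp only: 1(1) norm_mult)
    moreover have "z - \<zz> \<noteq> 0" unfolding 1(1) using X(3) \<open>z - cnj \<zz> \<noteq> 0\<close> by simp
    ultimately show "z \<in> disc - {\<zz>}" by (simp add: disc_def)
  qed
  moreover have "connected (ball (0::complex) (3 / 10) - {0})"
    by (rule connected_punctured_ball) simp
  moreover have "continuous_on (ball 0 (3 / 10) - {0}) h"
    unfolding h_def by (intro continuous_intros) auto
  ultimately show ?thesis
    by (simp only: connected_continuous_image)
qed

text \<open>
  At this point the rotation about \<open>\<zz>\<close> agrees with the translation by one. It is \<open>rho - 1\<close> for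
  \<open>\<zz> = \<i>\<close> and \<open>\<i>\<close> for \<open>\<zz> = rho\<close>, where the left side of the fundamental domain centred at \<open>\<zz>\<close>
  meets the adjacent arc.
\<close>
definition base_pt :: complex
  where "base_pt = Complex (Re \<zz> - 1 / 2) (if tr = 0 then sqrt 3 / 2 else 1)"

lemma rot_base_pt: "moebius_act rot base_pt = base_pt + 1"
proof (rule tr_cases)
  assume t: "tr = 0" "Re \<zz> = 0"
  then have base_pt: "base_pt = Complex (- 1 / 2) (sqrt 3 / 2)" by (simp add: base_pt_def)
  then have "base_pt \<noteq> 0" by (simp add: complex_eq_iff)
  moreover have "base_pt * (base_pt + 1) = - 1" unfolding base_pt by (simp add: complex_eq_iff)
  ultimately show ?thesis using t by (simp add: rot_act field_simps)
next
  assume t: "tr = 1" "Re \<zz> = 1 / 2"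
  then have base_pt: "base_pt = \<i>" by (simp add: base_pt_def complex_eq_iff)
  show ?thesis unfolding base_pt rot_act t by (simp add: field_simps)
qed

lemma base_pt_disc: "base_pt \<in> disc - {\<zz>}"
proof -
  have s3: "167 / 100 < sqrt 3" by (rule real_less_rsqrt) (simp add: power2_eq_square)
  have "(cmod (base_pt - \<zz>))\<^sup>2 = 2 - sqrt 3 \<and> (cmod (base_pt - cnj \<zz>))\<^sup>2 = 2 + sqrt 3"
  proof (rule tr_cases)
    assume t: "tr = 0" "Re \<zz> = 0" "Im \<zz> = 1"
    show ?thesis unfolding cmod_power2 by (simp add: base_pt_def t power2_eq_square algebra_simps)
  next
    assume t: "tr = 1" "Re \<zz> = 1 / 2" "Im \<zz> = sqrt 3 / 2"
    show ?thesis unfolding cmod_power2 by (simp add: base_pt_def t power2_eq_square algebra_simps)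
  qed
  moreover from s3 have "2 - sqrt 3 < (3 / 10)\<^sup>2 * (2 + sqrt 3)"
    by (simp add: power2_eq_square)
  ultimately have "(cmod (base_pt - \<zz>))\<^sup>2 < (3 / 10 * cmod (base_pt - cnj \<zz>))\<^sup>2"
    unfolding power_mult_distrib by simp
  then have "cmod (base_pt - \<zz>) < 3 / 10 * cmod (base_pt - cnj \<zz>)"
    by (rule power_less_imp_less_base) simp
  moreover have "base_pt \<noteq> \<zz>" by (auto simp: base_pt_def complex_eq_iff)
  ultimately show ?thesis by (simp add: disc_def)
qed

lemma Im_base_pt: "Im base_pt > Im \<zz> / 2" "Im base_pt > 0" "Re base_pt = Re \<zz> - 1 / 2"
  using base_pt_disc disc_subset_half_strip Im_half_strip[of base_pt] by (auto simp: half_strip_def base_pt_def)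

text \<open>
  A logarithm of \<open>X = (z - \<zz>) / (z - cnj \<zz>)\<close>; the factor \<open>- \<i>\<close> turns the branch cuts into the
  vertical rays that lead downwards from \<open>\<zz>\<close> and \<open>cnj \<zz>\<close>.
\<close>
definition log_ratio :: "complex \<Rightarrow> complex"
  where "log_ratio z = Ln (- \<i> * (z - \<zz>)) - Ln (- \<i> * (z - cnj \<zz>))"

lemma log_ratio_derivative:
  assumes "Im z > 0" "Re z \<noteq> Re \<zz> \<or> Im z > Im \<zz>"
  shows "(log_ratio has_field_derivative \<xi> z) (at z)"
proof -
  have 1: "- \<i> * (z - \<zz>) \<notin> \<real>\<^sub>\<le>\<^sub>0"
    using assms by (auto simp: complex_nonpos_Reals_iff)
  have 2: "- \<i> * (z - cnj \<zz>) \<notin> \<real>\<^sub>\<le>\<^sub>0"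
    using assms Im_\<zz>_bounds(1) by (auto simp: complex_nonpos_Reals_iff)
  have "(log_ratio has_field_derivative inverse (- \<i> * (z - \<zz>)) * (- \<i>) - inverse (- \<i> * (z - cnj \<zz>)) * (- \<i>)) (at z)"
    unfolding log_ratio_def
    by (intro DERIV_diff DERIV_chain2[where f = Ln and g = "\<lambda>z. - \<i> * (z - \<zz>)", OF has_field_derivative_Ln[OF 1]]
        DERIV_chain2[where f = Ln and g = "\<lambda>z. - \<i> * (z - cnj \<zz>)", OF has_field_derivative_Ln[OF 2]])
      (auto intro!: derivative_eq_intros)
  moreover have "inverse (- \<i> * (z - \<zz>)) * (- \<i>) - inverse (- \<i> * (z - cnj \<zz>)) * (- \<i>) = \<xi> z"
    by (simp add: \<xi>_def inverse_eq_divide)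
  ultimately show ?thesis by simp
qed

text \<open>
  As \<open>base_pt + 1\<close> is the image of \<open>base_pt\<close> under the rotation, which multiplies \<open>X\<close> by
  \<open>cnj \<zz> ^ 2\<close>, the value is known up to multiples of \<open>2 \<pi> i\<close>. The two points are mirror images
  in the vertical line through \<open>\<zz>\<close>, so the two logarithms are conjugate, and crude bounds for
  the arguments of the two factors of \<open>X\<close> decide which multiple it is.
\<close>
lemma log_ratio_base_pt: "log_ratio (base_pt + 1) - log_ratio base_pt = - (2 * pi * \<i> / omega \<zz>)"
proof -
  define a where "a = - \<i> * (base_pt - \<zz>)"
  define b where "b = - \<i> * (base_pt - cnj \<zz>)"
  have ab: "Im a = 1 / 2" "Im b = 1 / 2" "Re b > 0"
    using Im_base_pt Im_\<zz>_bounds(1) by (auto simp: a_def b_def)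
  have a': "- \<i> * (base_pt + 1 - \<zz>) = cnj a" and b': "- \<i> * (base_pt + 1 - cnj \<zz>) = cnj b"
    using Im_base_pt(3) by (auto simp: a_def b_def complex_eq_iff)
  have nr: "a \<notin> \<real>\<^sub>\<le>\<^sub>0" "b \<notin> \<real>\<^sub>\<le>\<^sub>0" using ab by (auto simp: complex_nonpos_Reals_iff)
  then have nz: "a \<noteq> 0" "b \<noteq> 0" by auto
  define A where "A = Im (Ln a) - Im (Ln b)"
  have lp: "log_ratio base_pt = Ln a - Ln b" by (simp add: log_ratio_def a_def b_def)
  have lp1: "log_ratio (base_pt + 1) = cnj (log_ratio base_pt)"
    unfolding log_ratio_def[of "base_pt + 1"] a' b' lp using cnj_Ln[OF nr(1)] cnj_Ln[OF nr(2)] by simp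
  have diff: "log_ratio (base_pt + 1) - log_ratio base_pt = - (\<i> * of_real (2 * A))"
    unfolding lp1 lp by (simp add: complex_eq_iff A_def)
  have "0 < Im (Ln a)" "Im (Ln a) < pi" "\<bar>Im (Ln b)\<bar> < pi / 2" "0 < Im (Ln b)"
    using Im_Ln_pos_lt_imp[of a] Im_Ln_pos_lt_imp[of b] Re_Ln_pos_lt_imp[of b] ab by auto
  then have A: "- pi < 2 * A" "2 * A < 2 * pi" by (auto simp: A_def)
  have "exp (\<i> * of_real (2 * A)) = exp (log_ratio base_pt - log_ratio (base_pt + 1))"
  proof -
    have "log_ratio base_pt - log_ratio (base_pt + 1) = - (log_ratio (base_pt + 1) - log_ratio base_pt)" by simp
    then show ?thesis unfolding diff by (simp only: minus_minus)
  qed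
  also have "\<dots> = (a / b) / (cnj a / cnj b)"
  proof -
    have "exp (log_ratio base_pt) = a / b" unfolding lp using nz by (simp add: exp_diff)
    moreover have "exp (log_ratio (base_pt + 1)) = cnj a / cnj b" unfolding lp1 using calculation by (simp add: exp_cnj[symmetric])
    ultimately show ?thesis by (simp add: exp_diff)
  qed
  also have "\<dots> = \<zz>\<^sup>2"
  proof -
    have base_pt: "Im base_pt > 0" "base_pt \<noteq> \<zz>" using base_pt_disc Im_base_pt by auto
    have p0: "base_pt \<noteq> 0" using base_pt by auto
    have nc: "\<zz> \<noteq> 0" using Im_\<zz>_bounds(1) by auto
    have "cnj a = - \<i> * ((base_pt - \<zz>) / (base_pt * \<zz>))"
      using rot_diff(1)[OF base_pt(1)] a' by (simp add: rot_base_pt)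
    then have 1: "cnj a = a / (base_pt * \<zz>)" by (simp add: a_def)
    have "cnj b = - \<i> * ((base_pt - cnj \<zz>) / (base_pt * cnj \<zz>))"
      using rot_diff(2)[OF base_pt(1)] b' by (simp add: rot_base_pt)
    then have 2: "cnj b = b / (base_pt * cnj \<zz>)" by (simp add: b_def)
    have "(a / b) / (cnj a / cnj b) = \<zz> / cnj \<zz>"
      unfolding 1 2 using nz p0 nc by (simp add: field_simps)
    also have "\<dots> = \<zz>\<^sup>2" using \<zz>_cnj nc by (simp add: field_simps power2_eq_square)
    finally show ?thesis .
  qed
  also have "\<dots> = exp (\<i> * of_real (2 * pi / omega \<zz>))"
  proof -
    have "\<zz>\<^sup>2 = cis (pi / omega \<zz>) ^ 2" using \<zz>_cis by simp
    also have "\<dots> = cis (real 2 * (pi / omega \<zz>))" by (rule Complex.DeMoivre)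
    finally show ?thesis by (simp add: cis_conv_exp)
  qed
  finally obtain j :: int where j: "\<i> * of_real (2 * A) = \<i> * of_real (2 * pi / omega \<zz>) + (of_int (2 * j) * pi) * \<i>"
    unfolding exp_eq by blast
  then have "Im (\<i> * of_real (2 * A)) = Im (\<i> * of_real (2 * pi / omega \<zz>) + (of_int (2 * j) * pi) * \<i>)" by (simp only:)
  then have eq: "2 * A = 2 * pi / omega \<zz> + 2 * pi * of_int j" by simp
  have om: "omega \<zz> = 2 \<or> omega \<zz> = 3" by (simp add: omega_eq tr_def)
  have "j = 0"
  proof (rule ccontr)
    assume "j \<noteq> 0"
    then have "j \<ge> 1 \<or> j \<le> -1" by linarith
    then have "real_of_int j \<ge> 1 \<or> real_of_int j \<le> -1" by linarith
    then have "2 * pi * of_int j \<ge> 2 * pi * 1 \<or> 2 * pi * of_int j \<le> 2 * pi * (-1)"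
      by (metis mult_le_cancel_left_pos mult_pos_pos pi_gt_zero zero_less_numeral)
    moreover have "2 * pi / omega \<zz> > 0" "2 * pi / omega \<zz> \<le> pi" using om by auto
    ultimately show False using eq A by linarith
  qed
  with eq have "2 * A = 2 * pi / omega \<zz>" by simp
  then show ?thesis unfolding diff by simp
qed

text \<open>
  The residue theorem on the quotient by the modular group, for the invariant differential
  \<open>f dz\<close> with \<open>f = F * poincare (m + 2) n\<close>. Let \<open>r\<close> be the residue of \<open>f\<close> at \<open>\<zz>\<close>. Then
  \<open>f - r * \<xi>\<close> has a primitive \<open>\<Phi>\<close> on the half-strip. Invariance of both differentials shows
  that \<open>\<Phi> \<circ> rot - \<Phi>\<close> is constant near \<open>\<zz>\<close>, and the constant is zero because the rotation has
  finite order. So \<open>\<Phi>\<close> takes the same value at \<open>base_pt\<close> and at \<open>base_pt + 1\<close>, and a primitive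
  of \<open>f\<close> increases between these points by \<open>r\<close> times the increment of \<^const>\<open>log_ratio\<close>. By
  periodicity this is the integral of \<open>f\<close> over a period at every height; far up in the cusp,
  where the Poincare series is close to \<open>2 * cusp_exp n\<close>, the integral tends to twice the
  coefficient.
\<close>
lemma fourier_coefficient_eq_residue:
  fixes F g :: "complex \<Rightarrow> complex"
  assumes m: "m \<ge> 2" "even m"
    and hol: "F holomorphic_on {z. Im z > 0} - orbit" and ness: "not_essential F \<zz>"
    and modular: "\<And>M z. M \<in> SL2Z \<Longrightarrow> Im z > 0 \<Longrightarrow> F (moebius_act M z) = F z / automorphy M z ^ m"
    and g: "g holomorphic_on ball 0 \<rho>" "\<rho> > 0" "\<And>z. Im z > Y \<Longrightarrow> F z = g (exp (2 * pi * \<i> * z))"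
  shows "2 * ((deriv ^^ n) g 0 / fact n) =
    - (2 * pi * \<i> / omega \<zz>) * residue (\<lambda>z. F z * poincare (m + 2) n z) \<zz>"
proof -
  define Q where "Q = poincare (m + 2) n"
  define f where "f = (\<lambda>z. F z * Q z)"
  define r where "r = residue f \<zz>"
  define c where "c = (deriv ^^ n) g 0 / fact n"
  have m4: "m + 2 \<ge> 4" using m by simp
  have Q_hol: "Q holomorphic_on {z. Im z > 0}"
    unfolding Q_def by (rule holomorphic_on_poincare[OF m4])
  have V_sub: "half_strip - {\<zz>} \<subseteq> {z. Im z > 0} - orbit"
    using orbit_half_strip Im_half_strip by auto
  have f_hol: "f holomorphic_on half_strip - {\<zz>}"
    unfolding f_def using V_sub
    by (intro holomorphic_intros holomorphic_on_subset[OF hol] holomorphic_on_subset[OF Q_hol]) auto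
  have F_V: "F holomorphic_on half_strip - {\<zz>}"
    by (rule holomorphic_on_subset[OF hol V_sub])
  have Q_an: "Q analytic_on {\<zz>}"
    using holomorphic_on_subset[OF Q_hol, of half_strip] Im_half_strip open_half_strip \<zz>_in_half_strip by (auto simp: analytic_at)
  have f_ness: "not_essential f \<zz>"
    unfolding f_def
    by (intro not_essential_times ness not_essential_analytic[OF Q_an] isolated_singularity_at_analytic[OF Q_an]
        isolated_singularity_at_holomorphic[OF F_V open_half_strip \<zz>_in_half_strip])
  have f_act: "f (moebius_act M z) = automorphy M z ^ 2 * f z" if "M \<in> SL2Z" "Im z > 0" for M z
  proof -
    have "automorphy M z \<noteq> 0" using automorphy_nonzero[OF that(1)] that(2) by simp
    then show ?thesis
      unfolding f_def Q_def modular[OF that] poincare_modular[OF that] by (simp add: power_add power2_eq_square)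
  qed
  have f_rot: "f (moebius_act rot z) / z\<^sup>2 = f z" if "Im z > 0" for z
    using f_act[OF rot_SL2Z that] that by (auto simp: automorphy_rot)
  have f_T: "f (z + 1) = f z" if "Im z > 0" for z
  proof -
    have "mat2 1 1 0 1 \<in> SL2Z" by (simp add: SL2Z_iff)
    from f_act[OF this that] show ?thesis by (simp add: moebius_act_eq automorphy_def)
  qed
  obtain \<Phi>0 where \<Phi>00: "\<And>z. z \<in> half_strip - {\<zz>} \<Longrightarrow>
      (\<Phi>0 has_field_derivative f z - residue f \<zz> / (z - \<zz>)) (at z)"
    by (rule meromorphic_primitive[OF open_half_strip convex_half_strip \<zz>_in_half_strip f_hol f_ness]) (rule that, blast)
  note \<Phi>0 = \<Phi>00[folded r_def]
  define \<Phi> where "\<Phi> = (\<lambda>z. \<Phi>0 z + r * Ln (- \<i> * (z - cnj \<zz>)))"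
  have \<Phi>: "(\<Phi> has_field_derivative f z - r * \<xi> z) (at z)" if z: "z \<in> half_strip - {\<zz>}" for z
  proof -
    have 2: "- \<i> * (z - cnj \<zz>) \<notin> \<real>\<^sub>\<le>\<^sub>0"
      using Im_half_strip[of z] z Im_\<zz>_bounds(1) by (auto simp: complex_nonpos_Reals_iff)
    have d2: "((\<lambda>z. - \<i> * (z - cnj \<zz>)) has_field_derivative - \<i>) (at z)"
      by (auto intro!: derivative_eq_intros)
    have "(\<Phi> has_field_derivative (f z - r / (z - \<zz>)) + r * (inverse (- \<i> * (z - cnj \<zz>)) * (- \<i>))) (at z)"
      unfolding \<Phi>_def
      by (intro DERIV_add \<Phi>0[OF z] DERIV_cmult
          DERIV_chain2[where f = Ln and g = "\<lambda>z. - \<i> * (z - cnj \<zz>)", OF has_field_derivative_Ln[OF 2] d2])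
    moreover have "(f z - r / (z - \<zz>)) + r * (inverse (- \<i> * (z - cnj \<zz>)) * (- \<i>)) = f z - r * \<xi> z"
    proof -
      have inv: "inverse (- \<i> * A) * (- \<i>) = 1 / A" for A by (simp add: inverse_eq_divide)
      show ?thesis unfolding inv by (simp add: \<xi>_def right_diff_distrib)
    qed
    ultimately show ?thesis by (simp only:)
  qed

  \<comment> \<open>invariance of the primitive under the rotation \<open>rot\<close>\<close>
  define D where "D = disc - {\<zz>}"
  have D: "D \<subseteq> half_strip - {\<zz>}" "open D" "connected D" "\<And>z. z \<in> D \<Longrightarrow> moebius_act rot z \<in> D"
    unfolding D_def by (use disc_subset_half_strip in blast, intro open_delete open_disc, rule connected_punctured_disc, rule rot_disc)
  have "((\<lambda>z. \<Phi> (moebius_act rot z) - \<Phi> z) has_field_derivative 0) (at z)" if z: "z \<in> D" for z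
  proof -
    have Imz: "Im z > 0" "z \<noteq> \<zz>" using z D(1) Im_half_strip by auto
    have d_rot: "(moebius_act rot has_field_derivative 1 / z\<^sup>2) (at z)"
      using DERIV_moebius_act[OF rot_SL2Z, of z] Imz by (simp add: automorphy_rot)
    have "((\<lambda>z. \<Phi> (moebius_act rot z) - \<Phi> z) has_field_derivative
        (f (moebius_act rot z) - r * \<xi> (moebius_act rot z)) * (1 / z\<^sup>2) - (f z - r * \<xi> z)) (at z)"
      using D z by (intro DERIV_diff DERIV_chain2[OF \<Phi> d_rot] \<Phi>) auto
    moreover have "(f (moebius_act rot z) - r * \<xi> (moebius_act rot z)) * (1 / z\<^sup>2) - (f z - r * \<xi> z) = 0"
    proof -
      have "(a - r * b) * (1 / z\<^sup>2) = a / z\<^sup>2 - r * (b / z\<^sup>2)" for a b by (simp add: diff_divide_distrib)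
      then show ?thesis by (simp only: f_rot[OF Imz(1)] \<xi>_rot[OF Imz] diff_self)
    qed
    ultimately show ?thesis by (simp only:)
  qed
  then have "(\<lambda>z. \<Phi> (moebius_act rot z) - \<Phi> z) constant_on D"
    by (rule has_field_derivative_0_imp_constant_on[OF _ D(3,2)])
  then obtain k where k: "\<And>z. z \<in> D \<Longrightarrow> \<Phi> (moebius_act rot z) - \<Phi> z = k"
    unfolding constant_on_def by blast
  have base_pt: "base_pt \<in> D" "Im base_pt > 0" using base_pt_disc Im_base_pt(2) by (auto simp: D_def)
  have "k = 0"
  proof (cases "tr = 0")
    case True
    have "k + k = \<Phi> (moebius_act rot (moebius_act rot base_pt)) - \<Phi> base_pt"
      using k[OF base_pt(1)] k[OF D(4)[OF base_pt(1)]] by (simp add: algebra_simps)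
    then show ?thesis unfolding rot_order(1)[OF base_pt(2) True] by simp
  next
    case False
    then have t: "tr = 1" by (simp add: tr_def split: if_splits)
    have "k + k + k = \<Phi> (moebius_act rot (moebius_act rot (moebius_act rot base_pt))) - \<Phi> base_pt"
      using k[OF base_pt(1)] k[OF D(4)[OF base_pt(1)]] k[OF D(4)[OF D(4)[OF base_pt(1)]]] by (simp add: algebra_simps)
    then show ?thesis unfolding rot_order(2)[OF base_pt(2) t] by simp
  qed
  then have \<Phi>_p: "\<Phi> (base_pt + 1) = \<Phi> base_pt"
    using k[OF base_pt(1)] by (simp add: rot_base_pt)

  \<comment> \<open>the increment of a primitive of \<open>f\<close> over a period does not depend on the height\<close>
  define L where "L = (\<lambda>z. \<Phi> z + r * log_ratio z)"
  have L: "(L has_field_derivative f z) (at z)" if z: "z \<in> half_strip" "Re z \<noteq> Re \<zz> \<or> Im z > Im \<zz>" for z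
  proof -
    have "z \<noteq> \<zz>" using z by auto
    then have "(L has_field_derivative (f z - r * \<xi> z) + r * \<xi> z) (at z)"
      unfolding L_def using z Im_half_strip[OF z(1)] by (intro DERIV_add \<Phi> DERIV_cmult log_ratio_derivative) auto
    then show ?thesis by simp
  qed
  define S where "S = {z. Im z > Im \<zz> / 2} \<inter> {z. Re z > Re \<zz> - 1} \<inter> {z. Re z < Re \<zz>}"
  have S: "convex S"
    unfolding S_def by (intro convex_Int convex_halfspace_Im_gt convex_halfspace_Re_gt convex_halfspace_Re_lt)
  have "((\<lambda>z. L (z + 1) - L z) has_field_derivative 0) (at z within S)" if z: "z \<in> S" for z
  proof -
    have z1: "z \<in> half_strip" "z + 1 \<in> half_strip" "Re z \<noteq> Re \<zz>" "Re (z + 1) \<noteq> Re \<zz>" using z by (auto simp: S_def half_strip_def)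
    have "(L has_field_derivative f (z + 1)) (at (z + 1))" "(L has_field_derivative f z) (at z)"
      using z1 by (simp_all add: L)
    then have "((\<lambda>z. L (z + 1) - L z) has_field_derivative f (z + 1) - f z) (at z)"
      unfolding DERIV_shift by (rule DERIV_diff)
    then have "((\<lambda>z. L (z + 1) - L z) has_field_derivative 0) (at z)"
      using f_T[OF Im_half_strip[OF z1(1)]] by simp
    then show ?thesis by (rule has_field_derivative_at_within)
  qed
  from has_field_derivative_zero_constant[OF S this]
  obtain u where u: "\<And>z. z \<in> S \<Longrightarrow> L (z + 1) - L z = u" by blast
  have pS: "base_pt + \<i> * of_real t \<in> S" if "t \<ge> 0" for t
    using Im_base_pt that by (simp add: S_def)
  have u_eq: "u = - (2 * pi * \<i> / omega \<zz>) * r"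
  proof -
    have "u = L (base_pt + 1) - L base_pt" using u[OF pS[of 0]] by simp
    also have "\<dots> = r * (log_ratio (base_pt + 1) - log_ratio base_pt)" unfolding L_def \<Phi>_p by (simp add: right_diff_distrib)
    finally show ?thesis unfolding log_ratio_base_pt by simp
  qed

  \<comment> \<open>far up in the cusp only the constant term of \<open>f\<close> contributes to the increment\<close>
  have "even (m + 2)" using m(2) by simp
  then obtain B where B0: "\<And>z. Im z \<ge> 1 \<Longrightarrow> \<bar>Re z\<bar> \<le> 1 \<Longrightarrow>
      cmod (poincare (m + 2) n z - 2 * cusp_exp n z) \<le> B / (Im z)\<^sup>2"
    by (rule poincare_asymptotics[OF m4, where n = n]) (rule that, blast)
  note B = B0[folded Q_def]
  have "compact (g ` cball 0 (\<rho> / 2))"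
    using g(1,2) by (intro compact_continuous_image holomorphic_on_imp_continuous_on holomorphic_on_subset[OF g(1)]) auto
  then have "bounded (g ` cball 0 (\<rho> / 2))" by (rule compact_imp_bounded)
  then obtain G0 where "\<forall>x\<in>g ` cball 0 (\<rho> / 2). cmod x \<le> G0"
    unfolding bounded_iff by blast
  then have G0: "cmod (g w) \<le> G0" if "cmod w \<le> \<rho> / 2" for w
    using that by simp
  have "cmod (g 0) \<le> G0" using G0[of 0] g(2) by simp
  then have G0_nonneg: "0 \<le> G0" using norm_ge_zero[of "g 0"] by linarith
  have est: "cmod (u - 2 * c) \<le> \<bar>G0 * B\<bar> / y"
    if y: "y \<ge> Im base_pt" "y > Y" "y \<ge> 1" "y > Im \<zz>" "exp (- (2 * pi * y)) \<le> \<rho> / 2" for y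
  proof -
    define z0 where "z0 = base_pt + \<i> * of_real (y - Im base_pt)"
    have z0: "Im z0 = y" "Re z0 = Re \<zz> - 1 / 2" "z0 \<in> S"
      using pS[of "y - Im base_pt"] y(1) Im_base_pt(3) by (auto simp: z0_def)
    have seg: "Im x = y" "\<bar>Re x - Re \<zz>\<bar> \<le> 1 / 2" if "x \<in> closed_segment z0 (z0 + 1)" for x
    proof -
      from that obtain s where s: "0 \<le> s" "s \<le> 1" "x = (1 - s) *\<^sub>R z0 + s *\<^sub>R (z0 + 1)"
        unfolding in_segment by blast
      then have x: "x = z0 + of_real s" by (simp add: scaleR_conv_of_real algebra_simps)
      show "Im x = y" unfolding x using z0(1) by simp
      have "Re x - Re \<zz> = s - 1 / 2" unfolding x using z0(2) by simp
      with s(1,2) show "\<bar>Re x - Re \<zz>\<bar> \<le> 1 / 2" by linarith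
    qed
    have norm_q: "cmod (exp (2 * pi * \<i> * x)) = exp (- (2 * pi * Im x))" for x by simp
    have "(f has_contour_integral (L (pathfinish (linepath z0 (z0 + 1))) - L (pathstart (linepath z0 (z0 + 1)))))
        (linepath z0 (z0 + 1))"
    proof (rule contour_integral_primitive[of "closed_segment z0 (z0 + 1)"])
      fix x assume x: "x \<in> closed_segment z0 (z0 + 1)"
      then have "x \<in> half_strip" "Im x > Im \<zz>" using seg[OF x] y Im_\<zz>_bounds(1) by (auto simp: half_strip_def)
      then show "(L has_field_derivative f x) (at x within closed_segment z0 (z0 + 1))"
        by (intro has_field_derivative_at_within[OF L]) auto
    qed auto
    then have i1: "(f has_contour_integral u) (linepath z0 (z0 + 1))"
      using u[OF z0(3)] by simp
    have "exp (- (2 * pi * y)) < \<rho>" using y(5) g(2) by linarith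
    then have "cmod (exp (2 * pi * \<i> * z0)) < \<rho>" unfolding norm_q z0(1) .
    from has_contour_integral_lmul[OF fourier_coefficient_integral[OF g(1,2) this, of n], of 2]
    have i2: "((\<lambda>z. 2 * (g (exp (2 * pi * \<i> * z)) * cusp_exp n z)) has_contour_integral 2 * c) (linepath z0 (z0 + 1))"
      by (simp only: c_def)
    have "cmod (u - 2 * c) \<le> (\<bar>G0 * B\<bar> / y) * cmod ((z0 + 1) - z0)"
    proof (rule has_contour_integral_bound_linepath[OF has_contour_integral_diff[OF i1 i2]])
      fix x assume x: "x \<in> closed_segment z0 (z0 + 1)"
      have "cmod (g (exp (2 * pi * \<i> * x))) \<le> G0"
        by (rule G0) (use y(5) in \<open>simp only: norm_q seg(1)[OF x]\<close>)
      moreover have "\<bar>Re x\<bar> \<le> 1"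
      proof -
        have "0 \<le> Re \<zz>" "Re \<zz> \<le> 1 / 2" by (auto simp: Re_\<zz> tr_def)
        with seg(2)[OF x] show ?thesis by linarith
      qed
      then have "cmod (Q x - 2 * cusp_exp n x) \<le> B / (Im x)\<^sup>2"
        using B[of x] seg(1)[OF x] y(3) by simp
      ultimately have "cmod (g (exp (2 * pi * \<i> * x)) * (Q x - 2 * cusp_exp n x)) \<le> G0 * (B / y\<^sup>2)"
        unfolding norm_mult seg(1)[OF x] using G0_nonneg by (intro mult_mono) simp_all
      also have "\<dots> \<le> \<bar>G0 * B\<bar> / y\<^sup>2" by (simp add: divide_right_mono)
      also have "\<dots> \<le> \<bar>G0 * B\<bar> / y"
        using y(3) by (intro divide_left_mono) (auto simp: power2_eq_square)
      finally show "cmod (f x - 2 * (g (exp (2 * pi * \<i> * x)) * cusp_exp n x)) \<le> \<bar>G0 * B\<bar> / y"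
        using g(3)[of x] y(2) seg(1)[OF x] by (simp add: f_def algebra_simps)
    next
      show "0 \<le> \<bar>G0 * B\<bar> / y" using y(3) by simp
    qed
    then show ?thesis by simp
  qed
  have "u = 2 * c"
  proof (rule ccontr)
    assume "u \<noteq> 2 * c"
    then have d: "cmod (u - 2 * c) > 0" by simp
    define t where "t = \<bar>G0 * B\<bar> / cmod (u - 2 * c)"
    have t: "t \<ge> 0" by (simp add: t_def)
    define y where "y = \<bar>Im base_pt\<bar> + \<bar>Y\<bar> + 1 + \<bar>Im \<zz>\<bar> + \<bar>ln (\<rho> / 2)\<bar> + t"
    have y: "y \<ge> Im base_pt" "y > Y" "y \<ge> 1" "y > Im \<zz>" "y \<ge> \<bar>ln (\<rho> / 2)\<bar>" "t < y"
      unfolding y_def using t by linarith+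
    have "- (2 * pi * y) \<le> - \<bar>ln (\<rho> / 2)\<bar>"
    proof -
      have "1 * y \<le> 2 * pi * y" using y(3) pi_gt3 by (intro mult_right_mono) auto
      then show ?thesis using y(5) by linarith
    qed
    also have "\<dots> \<le> ln (\<rho> / 2)" by simp
    finally have "exp (- (2 * pi * y)) \<le> exp (ln (\<rho> / 2))" by simp
    also have "\<dots> = \<rho> / 2" using g(2) by simp
    finally have e: "exp (- (2 * pi * y)) \<le> \<rho> / 2" .
    have "cmod (u - 2 * c) \<le> \<bar>G0 * B\<bar> / y" by (rule est[OF y(1-4) e])
    moreover have "\<bar>G0 * B\<bar> / y < cmod (u - 2 * c)"
      using y(3,6) d unfolding t_def by (simp add: pos_divide_less_eq mult.commute)
    ultimately show False by (meson less_le_not_le order_trans)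
  qed
  from trans[OF this[symmetric] u_eq] show ?thesis unfolding c_def r_def f_def Q_def .
qed

end

section \<open>Residues of the terms of a Poincare series\<close>

lemma residue_binomial_exp:
  fixes A c :: complex
  assumes "s' < M"
  shows "residue (\<lambda>x. (x + A) ^ M * exp (c * x) / x ^ Suc s') 0
    = (\<Sum>k\<le>s'. of_nat (M choose k) * A ^ (M - k) * (c ^ (s' - k) / fact (s' - k)))"
proof -
  have exps: "(\<lambda>x. (x + A) ^ M * exp (c * x)) has_fps_expansion (fps_X + fps_const A) ^ M * fps_exp c"
    by (intro has_fps_expansion_mult has_fps_expansion_power has_fps_expansion_add
        has_fps_expansion_fps_X has_fps_expansion_const has_fps_expansion_exp)
  have "(fps_X + fps_const A) ^ M * fps_exp c
      = (\<Sum>k\<le>M. fps_const (of_nat (M choose k) * A ^ (M - k)) * (fps_X ^ k * fps_exp c))"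
    unfolding binomial_ring sum_distrib_right
    by (intro sum.cong refl) (simp add: fps_const_power fps_of_nat[symmetric] mult_ac flip: fps_const_mult)
  then have "fps_nth ((fps_X + fps_const A) ^ M * fps_exp c) s'
      = (\<Sum>k\<le>M. of_nat (M choose k) * A ^ (M - k) * (if s' < k then 0 else c ^ (s' - k) / fact (s' - k)))"
    by (simp add: fps_sum_nth fps_X_power_mult_nth cong: if_cong)
  also have "\<dots> = (\<Sum>k\<le>s'. of_nat (M choose k) * A ^ (M - k) * (c ^ (s' - k) / fact (s' - k)))"
    using assms by (intro sum.mono_neutral_cong_right) auto
  finally show ?thesis
    using residue_fps_expansion_over_power_at_0[OF exps] by simp
qed

context elliptic_point
begin

text \<open>
  The factors of the residues that depend neither on the pair nor on the coefficient index
  \<open>n\<close>.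
\<close>
definition res_coeff :: "nat \<Rightarrow> nat \<Rightarrow> nat \<Rightarrow> complex"
  where "res_coeff m \<nu> s = of_nat ((m + \<nu>) choose s) * (2 * \<i> * of_real (Im \<zz>)) ^ (m + \<nu> - s)
    * ((- (2 * pi * \<i>)) ^ (\<nu> - 1 - s) / fact (\<nu> - 1 - s))"

lemma residue_elliptic_term:
  assumes M: "M \<in> SL2Z" and \<nu>: "\<nu> \<ge> 1"
  defines "\<tau> \<equiv> moebius_act M \<zz>"
  shows "residue (\<lambda>z. (z - cnj \<tau>) ^ (m + \<nu>) / (z - \<tau>) ^ \<nu> * cusp_exp n z) \<tau>
    = (\<Sum>s<\<nu>. of_nat ((m + \<nu>) choose s) * (2 * \<i> * of_real (Im \<tau>)) ^ (m + \<nu> - s)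
        * ((- (2 * pi * \<i> * of_nat n)) ^ (\<nu> - 1 - s) / fact (\<nu> - 1 - s))) * cusp_exp n \<tau>"
proof -
  define A where "A = 2 * \<i> * complex_of_real (Im \<tau>)"
  define c where "c = - (2 * pi * \<i> * of_nat n)"
  obtain s' where s': "\<nu> = Suc s'" using \<nu> by (cases \<nu>) auto
  have A: "\<tau> + x - cnj \<tau> = x + A" for x by (simp add: A_def complex_eq_iff)
  have E: "cusp_exp n (\<tau> + x) = exp (c * x) * cusp_exp n \<tau>" for x
    by (simp add: cusp_exp_def c_def algebra_simps flip: exp_add)
  have "residue (\<lambda>z. (z - cnj \<tau>) ^ (m + \<nu>) / (z - \<tau>) ^ \<nu> * cusp_exp n z) \<tau>
      = residue (\<lambda>x. (\<tau> + x - cnj \<tau>) ^ (m + \<nu>) / (\<tau> + x - \<tau>) ^ \<nu> * cusp_exp n (\<tau> + x)) 0"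
    by (rule residue_shift_0)
  also have "(\<lambda>x. (\<tau> + x - cnj \<tau>) ^ (m + \<nu>) / (\<tau> + x - \<tau>) ^ \<nu> * cusp_exp n (\<tau> + x))
      = (\<lambda>x. (x + A) ^ (m + \<nu>) * exp (c * x) / x ^ Suc s' * cusp_exp n \<tau>)"
    unfolding A E s' by (simp add: fun_eq_iff)
  also have "residue \<dots> 0 = residue (\<lambda>x. (x + A) ^ (m + \<nu>) * exp (c * x) / x ^ Suc s') 0 * cusp_exp n \<tau>"
    by (rule residue_rmul[of UNIV]) (auto intro!: holomorphic_intros)
  also have "residue (\<lambda>x. (x + A) ^ (m + \<nu>) * exp (c * x) / x ^ Suc s') 0
      = (\<Sum>s\<le>s'. of_nat ((m + \<nu>) choose s) * A ^ (m + \<nu> - s) * (c ^ (s' - s) / fact (s' - s)))"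
    by (rule residue_binomial_exp) (simp add: s')
  finally show ?thesis
    unfolding A_def c_def by (simp add: s' lessThan_Suc_atMost)
qed

text \<open>
  Substitute \<open>\<tau> = M z\<close>, where \<open>M\<close> has bottom row \<open>v\<close>. The differences \<open>z - \<zz>\<close> and \<open>z - cnj \<zz>\<close>
  become the corresponding differences for the orbit point, times automorphy factors. Those in
  \<open>z\<close> cancel: the two powers contribute the exponent \<open>m\<close> and \<open>dz\<close> the exponent \<open>2\<close>, against
  the weight \<open>m + 2\<close> of the Poincare term. Those in \<open>\<zz>\<close> remain as a power of \<open>c \<zz> + d\<close>. At the
  orbit point the residue is a finite sum by the Leibniz rule, in which the height
  \<open>Im \<zz> / nrm v\<close> of the orbit point produces the powers of the norm.
\<close>
lemma residue_mult_poincare_term: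
  assumes v: "v \<in> coprime_pairs" and \<nu>: "\<nu> \<ge> 1" and m: "even m"
  shows "residue (\<lambda>z. (z - cnj \<zz>) ^ (m + \<nu>) / (z - \<zz>) ^ \<nu> * poincare_term (m + 2) n v z) \<zz>
    = (\<Sum>s<\<nu>. res_coeff m \<nu> s *
        (theta (2 * \<nu> + m) n v * of_real (weight (2 * \<nu> + m) s (\<nu> - 1 - s) n (nrm v))))"
proof -
  define M where "M = completion v"
  have M: "M \<in> SL2Z" "bottom M = v" using completion[OF v] by (auto simp: M_def)
  define \<tau> where "\<tau> = moebius_act M \<zz>"
  define al where "al = elt v"
  define N where "N = real_of_int (nrm v)"
  define H where "H = {z. Im z > 0}"
  define h where "h = (\<lambda>z. (z - cnj \<tau>) ^ (m + \<nu>) / (z - \<tau>) ^ \<nu> * cusp_exp n z)"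
  define f where "f = (\<lambda>z. (z - cnj \<zz>) ^ (m + \<nu>) / (z - \<zz>) ^ \<nu> * poincare_term (m + 2) n v z)"
  have N1: "N \<ge> 1" using nrm_coprime_pos[OF v] by (simp add: N_def)
  have H: "open H" "\<zz> \<in> H" using Im_\<zz>_bounds(1) by (auto simp: H_def open_halfspace_Im_gt)
  have \<tau>: "Im \<tau> = Im \<zz> / N" "\<tau> \<in> H"
    using Im_orbit[OF M(1)] Im_moebius_act_pos[OF M(1) Im_\<zz>_bounds(1)] by (auto simp: \<tau>_def M(2) N_def H_def)
  have al: "automorphy M \<zz> = al" "al \<noteq> 0" "al * cnj al = of_real N"
    using automorphy_elt[of M] automorphy_nonzero[OF M(1), of \<zz>] elt_mult_cnj[of v]
    by (auto simp: al_def M(2) N_def)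
  have ne: "automorphy M z \<noteq> 0" if "z \<in> H" for z
    using that by (intro automorphy_nonzero[OF M(1)]) (auto simp: H_def)
  have d1: "moebius_act M z - \<tau> = (z - \<zz>) / (automorphy M z * al)" if "z \<in> H" for z
    unfolding \<tau>_def al(1)[symmetric] using that by (intro moebius_act_diff[OF M(1)]) (auto simp: H_def)
  have d2: "moebius_act M z - cnj \<tau> = (z - cnj \<zz>) / (automorphy M z * cnj al)" if "z \<in> H" for z
    unfolding \<tau>_def al(1)[symmetric] moebius_act_cnj[symmetric] automorphy_cnj[symmetric]
    using that by (intro moebius_act_diff[OF M(1)]) (auto simp: H_def)
  have cusp_hol: "cusp_exp n holomorphic_on S" for S
    unfolding cusp_exp_def[abs_def] by (intro holomorphic_intros)
  have h_hol: "h holomorphic_on H - {\<tau>}"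
    unfolding h_def by (intro holomorphic_intros cusp_hol) auto
  have cusp_an: "cusp_exp n analytic_on {\<tau>}"
    using cusp_hol[of UNIV] by (auto simp: analytic_at)
  have h_ness: "not_essential h \<tau>"
    unfolding h_def
    by (intro not_essential_times not_essential_divide not_essential_analytic isolated_singularity_at_analytic
        isolated_singularity_at_divide cusp_an analytic_intros)
  have "residue (\<lambda>z. h (moebius_act M z) * (1 / (automorphy M z)\<^sup>2)) \<zz> = residue h (moebius_act M \<zz>)"
  proof (rule residue_compose[OF H H(1)])
    show "moebius_act M ` (H - {\<zz>}) \<subseteq> H - {moebius_act M \<zz>}"
    proof (rule image_subsetI)
      fix z assume z: "z \<in> H - {\<zz>}"
      then have "moebius_act M z - \<tau> \<noteq> 0" using d1[of z] ne[of z] al(2) by auto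
      moreover have "Im (moebius_act M z) > 0" using z Im_moebius_act_pos[OF M(1)] by (simp add: H_def)
      ultimately show "moebius_act M z \<in> H - {moebius_act M \<zz>}" by (simp add: H_def \<tau>_def)
    qed
    show "moebius_act M \<zz> \<in> H" using \<tau>(2) by (simp add: \<tau>_def)
    show "h holomorphic_on H - {moebius_act M \<zz>}" using h_hol by (simp add: \<tau>_def)
    show "not_essential h (moebius_act M \<zz>)" using h_ness by (simp add: \<tau>_def)
    show "(moebius_act M has_field_derivative 1 / (automorphy M z)\<^sup>2) (at z)" if "z \<in> H" for z
      using that by (intro DERIV_moebius_act[OF M(1)]) (auto simp: H_def)
    show "1 / (automorphy M \<zz>)\<^sup>2 \<noteq> 0" using al by simp
  qed
  then have r1: "residue (\<lambda>z. h (moebius_act M z) * (1 / (automorphy M z)\<^sup>2)) \<zz> = residue h \<tau>"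
    by (simp only: \<tau>_def)
  define K where "K = al ^ \<nu> / cnj al ^ (m + \<nu>)"
  have K: "K \<noteq> 0" using al(2) by (simp add: K_def)
  have f_hol: "f holomorphic_on H - {\<zz>}"
    unfolding f_def by (intro holomorphic_intros holomorphic_on_poincare_term[OF v]) (auto simp: H_def)
  have eq: "h (moebius_act M z) * (1 / (automorphy M z)\<^sup>2) = f z * K" if z: "z \<in> H - {\<zz>}" for z
  proof -
    define j where "j = automorphy M z"
    have j: "j \<noteq> 0" using ne z by (simp add: j_def)
    have "poincare_term (m + 2) n v z = cusp_exp n (moebius_act M z) / j ^ (m + 2)"
      using poincare_term_bottom[OF M(1), of z "m + 2" n] z by (auto simp: M(2) j_def H_def)
    moreover have "h (moebius_act M z) = ((z - cnj \<zz>) / (j * cnj al)) ^ (m + \<nu>) / ((z - \<zz>) / (j * al)) ^ \<nu>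
        * cusp_exp n (moebius_act M z)"
      unfolding h_def j_def using z by (simp only: d1 d2 DiffD1)
    ultimately show ?thesis
      unfolding f_def K_def j_def[symmetric] using j al(2) z
      by (simp add: power_divide power_mult_distrib power_add power2_eq_square mult_ac)
  qed
  have "residue (\<lambda>z. h (moebius_act M z) * (1 / (automorphy M z)\<^sup>2)) \<zz> = residue (\<lambda>z. f z * K) \<zz>"
  proof (rule residue_cong)
    have "\<forall>\<^sub>F z in at \<zz>. z \<in> H - {\<zz>}"
      using H by (intro eventually_at_in_open) auto
    then show "\<forall>\<^sub>F z in at \<zz>. h (moebius_act M z) * (1 / (automorphy M z)\<^sup>2) = f z * K"
      by eventually_elim (rule eq)
  qed simp
  also have "\<dots> = residue f \<zz> * K"
    by (rule residue_rmul[OF H f_hol])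
  finally have "residue f \<zz> = residue h \<tau> / K" using r1 K by (simp add: field_simps)
  also have "residue h \<tau> / K = (\<Sum>s<\<nu>. res_coeff m \<nu> s *
        (theta (2 * \<nu> + m) n v * of_real (weight (2 * \<nu> + m) s (\<nu> - 1 - s) n (nrm v))))"
  proof -
    obtain m' where m': "m = 2 * m'" using m by (rule evenE)
    define P where "P = phase n (Re \<tau>) * of_real (exp (2 * pi * real n / N * Im \<zz>))"
    have cusp: "cusp_exp n \<tau> = P"
    proof -
      have "- (2 * pi * \<i> * of_nat n * \<tau>) = - (2 * pi * \<i> * of_nat n * of_real (Re \<tau>)) + of_real (2 * pi * real n / N * Im \<zz>)"
        using \<tau>(1) by (simp add: complex_eq_iff)
      then show ?thesis unfolding P_def phase_def cusp_exp_def by (simp only: exp_add exp_of_real)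
    qed
    have dir: "al \<noteq> 0 \<Longrightarrow> 1 / K = direction v ^ (2 * \<nu> + m) * of_real (N ^ m')"
    proof -
      have cm: "cmod al ^ 2 = N" by (simp add: al_def N_def cmod_elt)
      have "cnj al = direction v * of_real (cmod al)" using al(2) by (simp add: direction_def al_def)
      then have "cnj al ^ (2 * \<nu> + m) = direction v ^ (2 * \<nu> + m) * of_real (cmod al ^ (2 * (\<nu> + m')))"
        by (simp add: power_mult_distrib m' algebra_simps)
      also have "cmod al ^ (2 * (\<nu> + m')) = N ^ (\<nu> + m')" unfolding power_mult cm ..
      finally have 1: "cnj al ^ (2 * \<nu> + m) = direction v ^ (2 * \<nu> + m) * of_real (N ^ (\<nu> + m'))" .
      have "1 / K = cnj al ^ (m + \<nu>) / al ^ \<nu>" by (simp add: K_def)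
      also have "\<dots> = cnj al ^ (2 * \<nu> + m) / (al * cnj al) ^ \<nu>"
        using al(2) by (simp add: power_mult_distrib power_add mult_2)
      also have "\<dots> = direction v ^ (2 * \<nu> + m) * of_real (N ^ (\<nu> + m')) / of_real (N ^ \<nu>)"
        unfolding al(3) 1 by simp
      also have "\<dots> = direction v ^ (2 * \<nu> + m) * of_real (N ^ m')"
        using N1 by (simp add: power_add)
      finally show ?thesis .
    qed
    have th: "theta (2 * \<nu> + m) n v = phase n (Re \<tau>) * direction v ^ (2 * \<nu> + m)"
      by (simp add: theta_def \<tau>_def M_def)
    have summand: "of_nat ((m + \<nu>) choose s) * (2 * \<i> * of_real (Im \<tau>)) ^ (m + \<nu> - s)
        * ((- (2 * pi * \<i> * of_nat n)) ^ (\<nu> - 1 - s) / fact (\<nu> - 1 - s)) * P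
        * (direction v ^ (2 * \<nu> + m) * of_real (N ^ m'))
      = res_coeff m \<nu> s * (theta (2 * \<nu> + m) n v * of_real (weight (2 * \<nu> + m) s (\<nu> - 1 - s) n (nrm v)))"
      if s: "s < \<nu>" for s
    proof -
      have "(2 * \<i> * complex_of_real (Im \<tau>)) ^ (m + \<nu> - s) = (2 * \<i> * of_real (Im \<zz>)) ^ (m + \<nu> - s) / of_real (N ^ (m + \<nu> - s))"
      proof -
        have "2 * \<i> * complex_of_real (Im \<tau>) = 2 * \<i> * of_real (Im \<zz>) / of_real N"
          unfolding \<tau>(1) by simp
        then show ?thesis by (simp only: power_divide of_real_power)
      qed
      moreover have "(- (2 * pi * \<i> * of_nat n)) ^ (\<nu> - 1 - s) = (- (2 * pi * \<i>)) ^ (\<nu> - 1 - s) * of_real (real n ^ (\<nu> - 1 - s))"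
        by (simp flip: power_mult_distrib)
      moreover have "weight (2 * \<nu> + m) s (\<nu> - 1 - s) n (nrm v) = N ^ m' / N ^ (m + \<nu> - s) * real n ^ (\<nu> - 1 - s) * exp (2 * pi * real n / N * Im \<zz>)"
      proof -
        have e: "real (2 * \<nu> + m) / 2 - real s = real (\<nu> + m' - s)" using s by (simp add: m' of_nat_diff)
        have "N powr (real (2 * \<nu> + m) / 2 - real s) = N ^ (\<nu> + m' - s)"
          unfolding e using N1 by (simp add: powr_realpow)
        moreover have "m + \<nu> - s = m' + (\<nu> + m' - s)" using s by (simp add: m')
        then have "N ^ m' / N ^ (m + \<nu> - s) = 1 / N ^ (\<nu> + m' - s)"
          using N1 by (simp add: power_add)
        ultimately show ?thesis by (simp add: weight_def N_def)
      qed
      ultimately show ?thesis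
        unfolding res_coeff_def th P_def by (simp add: mult_ac)
    qed
    have rh: "residue h \<tau> = (\<Sum>s<\<nu>. of_nat ((m + \<nu>) choose s) * (2 * \<i> * of_real (Im \<tau>)) ^ (m + \<nu> - s)
        * ((- (2 * pi * \<i> * of_nat n)) ^ (\<nu> - 1 - s) / fact (\<nu> - 1 - s))) * P"
      unfolding h_def using residue_elliptic_term[OF M(1) \<nu>, of m n] unfolding \<tau>_def[symmetric] cusp .
    have "residue h \<tau> / K = residue h \<tau> * (1 / K)" by simp
    also have "\<dots> = residue h \<tau> * (direction v ^ (2 * \<nu> + m) * of_real (N ^ m'))"
      by (simp only: dir[OF al(2)])
    also have "\<dots> = (\<Sum>s<\<nu>. res_coeff m \<nu> s *
        (theta (2 * \<nu> + m) n v * of_real (weight (2 * \<nu> + m) s (\<nu> - 1 - s) n (nrm v))))"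
      unfolding rh sum_distrib_right by (rule sum.cong) (simp_all only: summand lessThan_iff)
    finally show ?thesis .
  qed
  finally show ?thesis by (simp only: f_def)
qed

section \<open>Expansions of modular forms of negative weight\<close>

lemma odd_weight_eq_0:
  assumes "\<And>M z. M \<in> SL2Z \<Longrightarrow> Im z > 0 \<Longrightarrow> F (moebius_act M z) = automorphy M z powi w * F z" "odd w" "Im z > 0"
  shows "F z = 0"
proof -
  have "mat2 (-1) 0 0 (-1) \<in> SL2Z" by (simp add: SL2Z_iff)
  from assms(1)[OF this assms(3)] have "F z = (-1) powi w * F z"
    by (simp add: moebius_act_eq automorphy_def)
  also have "(-1 :: complex) powi w = -1" using assms(2) by (simp add: power_int_minus_left_odd)
  finally show ?thesis by simp
qed

text \<open>
  In terms of the functions \<open>(z - cnj \<zz>) ^ (m + j) / (z - \<zz>) ^ j\<close> the principal part of \<open>F\<close>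
  has residues against the Poincare series that are sums over coprime pairs. Such a sum
  vanishes unless \<open>2 * omega \<zz>\<close> divides \<open>2 * j + m\<close>, and otherwise it is a multiple of a
  coefficient of one of the expansions, with \<open>l + r = j - 1\<close>.
\<close>
lemma M_space_fourier_coefficients:
  fixes F g :: "complex \<Rightarrow> complex"
  assumes m: "m \<ge> 2" "even m"
    and hol: "F holomorphic_on {z. Im z > 0} - orbit" and ness: "not_essential F \<zz>"
    and modular: "\<And>M z. M \<in> SL2Z \<Longrightarrow> Im z > 0 \<Longrightarrow> F (moebius_act M z) = F z / automorphy M z ^ m"
    and g: "g holomorphic_on ball 0 \<rho>" "\<rho> > 0" "\<And>z. Im z > Y \<Longrightarrow> F z = g (exp (2 * pi * \<i> * z))"
  obtains T :: "(nat \<times> nat \<times> nat) set" and \<alpha> where "finite T"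
    "\<And>k l r. (k, l, r) \<in> T \<Longrightarrow> k \<ge> 1 \<and> real (2 * k * omega \<zz>) / 2 - real l \<ge> 2"
    "\<And>n. (deriv ^^ n) g 0 / fact n
      = (\<Sum>(k, l, r)\<in>T. \<alpha> (k, l, r) * of_real (F_coeff (2 * k * omega \<zz>) l r \<zz> n))"
proof -
  define pw where "pw = (\<lambda>j z. (z - cnj \<zz>) ^ (m + j))"
  have V_sub: "half_strip - {\<zz>} \<subseteq> {z. Im z > 0} - orbit" using orbit_half_strip Im_half_strip by auto
  have F_V: "F holomorphic_on half_strip - {\<zz>}" by (rule holomorphic_on_subset[OF hol V_sub])
  have pw: "pw j holomorphic_on half_strip" "pw j \<zz> \<noteq> 0" for j
    using ne_cnj_\<zz>[OF Im_\<zz>_bounds(1)] unfolding pw_def by (auto intro!: holomorphic_intros)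
  obtain K a h where h: "h holomorphic_on half_strip"
    and F_eq: "\<And>z. z \<in> half_strip - {\<zz>} \<Longrightarrow> F z = (\<Sum>j=1..K. a j * pw j z / (z - \<zz>) ^ j) + h z"
  proof (rule principal_part[OF open_half_strip \<zz>_in_half_strip F_V ness, of pw])
    show "pw j holomorphic_on half_strip" "pw j \<zz> \<noteq> 0" for j by (rule pw)+
  qed (rule that; auto)
  define om where "om = omega \<zz>"
  have om: "om > 0" by (simp add: om_def omega_eq tr_def)
  define I where "I = (SIGMA j:{1..K}. {..<j})"
  define A where "A = {x \<in> I. 2 * om dvd 2 * fst x + m}"
  have fin: "finite I" "finite A" by (auto simp: I_def A_def)
  define \<Theta> where "\<Theta> = (\<lambda>n (j, s) v. theta (2 * j + m) n v * of_real (weight (2 * j + m) s (j - 1 - s) n (nrm v)))"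
  define b where "b = (\<lambda>(j, s). a j * res_coeff m j s)"
  \<comment> \<open>the exponent of the norm is at least two, which makes all sums over ideals converge\<close>
  have half: "real (2 * j + m) / 2 - real s \<ge> 2" if "s < j" for j s
  proof -
    have "real s + 1 \<le> real j" "real m \<ge> 2" using that m(1) by auto
    moreover have "real (2 * j + m) / 2 = real j + real m / 2" by simp
    ultimately show ?thesis by linarith
  qed

  \<comment> \<open>residues of \<open>F\<close> times a single term of the Poincare series\<close>
  have res: "residue (\<lambda>z. F z * poincare_term (m + 2) n v z) \<zz> = (\<Sum>x\<in>I. b x * \<Theta> n x v)"
    if v: "v \<in> coprime_pairs" for n v
  proof -
    define P where "P = poincare_term (m + 2) n v"
    define q where "q = (\<lambda>j z. (z - cnj \<zz>) ^ (m + j) / (z - \<zz>) ^ j * P z)"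
    have P: "P holomorphic_on half_strip"
      unfolding P_def using Im_half_strip by (intro holomorphic_on_poincare_term[OF v]) auto
    have q: "q j holomorphic_on half_strip - {\<zz>}" for j
      unfolding q_def by (intro holomorphic_intros holomorphic_on_subset[OF P]) auto
    have "residue (\<lambda>z. F z * P z) \<zz> = residue (\<lambda>z. (\<Sum>j=1..K. a j * q j z) + h z * P z) \<zz>"
    proof (rule residue_cong)
      have "\<forall>\<^sub>F z in at \<zz>. z \<in> half_strip - {\<zz>}"
        using open_half_strip \<zz>_in_half_strip by (intro eventually_at_in_open) auto
      then show "\<forall>\<^sub>F z in at \<zz>. F z * P z = (\<Sum>j=1..K. a j * q j z) + h z * P z"
      proof eventually_elim
        case (elim z)
        show ?case
          unfolding F_eq[OF elim] q_def pw_def distrib_right sum_distrib_right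
          by (intro arg_cong2[of _ _ _ _ "(+)"] sum.cong refl) (simp add: mult_ac)
      qed
    qed simp
    also have "\<dots> = residue (\<lambda>z. \<Sum>j=1..K. a j * q j z) \<zz> + residue (\<lambda>z. h z * P z) \<zz>"
      by (rule residue_add[OF open_half_strip \<zz>_in_half_strip])
        (intro holomorphic_intros q holomorphic_on_subset[OF h] holomorphic_on_subset[OF P]; blast)+
    also have "residue (\<lambda>z. h z * P z) \<zz> = 0"
      by (rule residue_holo[OF open_half_strip \<zz>_in_half_strip]) (intro holomorphic_intros h P)
    also have "residue (\<lambda>z. \<Sum>j=1..k. a j * q j z) \<zz> = (\<Sum>j=1..k. a j * residue (q j) \<zz>)" for k
    proof (induction k)
      case 0
      then show ?case by (simp add: residue_const)
    next
      case (Suc k)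
      have "residue (\<lambda>z. (\<Sum>j=1..k. a j * q j z) + a (Suc k) * q (Suc k) z) \<zz>
          = residue (\<lambda>z. \<Sum>j=1..k. a j * q j z) \<zz> + residue (\<lambda>z. a (Suc k) * q (Suc k) z) \<zz>"
        by (rule residue_add[OF open_half_strip \<zz>_in_half_strip]) (intro holomorphic_intros q)+
      also have "residue (\<lambda>z. a (Suc k) * q (Suc k) z) \<zz> = a (Suc k) * residue (q (Suc k)) \<zz>"
        by (rule residue_lmul[OF open_half_strip \<zz>_in_half_strip q])
      finally show ?case using Suc by simp
    qed
    finally have "residue (\<lambda>z. F z * P z) \<zz> = (\<Sum>j=1..K. a j * residue (q j) \<zz>)" by simp
    also have "\<dots> = (\<Sum>j=1..K. \<Sum>s<j. b (j, s) * \<Theta> n (j, s) v)"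
    proof (rule sum.cong)
      fix j assume "j \<in> {1..K}"
      then have "j \<ge> 1" by simp
      show "a j * residue (q j) \<zz> = (\<Sum>s<j. b (j, s) * \<Theta> n (j, s) v)"
        unfolding q_def P_def residue_mult_poincare_term[OF v \<open>j \<ge> 1\<close> m(2)] sum_distrib_left b_def \<Theta>_def
        by (simp add: mult.assoc)
    qed simp
    also have "\<dots> = (\<Sum>x\<in>I. b x * \<Theta> n x v)"
      unfolding I_def by (subst sum.Sigma) (auto simp: case_prod_unfold)
    finally show ?thesis by (simp only: P_def)
  qed

  define \<beta> where "\<beta> = (\<lambda>x. - (2 * pi * \<i>) * b x)"
  have coeff: "(deriv ^^ n) g 0 / fact n
      = (\<Sum>x\<in>A. \<beta> x * of_real (F_coeff (2 * fst x + m) (snd x) (fst x - 1 - snd x) \<zz> n))" for n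
  proof -
    define c where "c = (deriv ^^ n) g 0 / fact n"
    define Fc where "Fc = (\<lambda>x. F_coeff (2 * fst x + m) (snd x) (fst x - 1 - snd x) \<zz> n)"
    have \<Theta>: "((\<lambda>v. b x * \<Theta> n x v) has_sum (if x \<in> A then b x * (of_nat (2 * om) * of_real (Fc x)) else 0)) coprime_pairs"
      if x: "x \<in> I" for x
    proof -
      obtain j s where js: "x = (j, s)" "s < j" using x by (auto simp: I_def)
      have "\<Theta> n x summable_on coprime_pairs"
        unfolding \<Theta>_def js(1) prod.case by (rule theta_weight_summable[OF half[OF js(2)]])
      then have "(\<Theta> n x has_sum infsum (\<Theta> n x) coprime_pairs) coprime_pairs" by (rule has_sum_infsum)
      then have "((\<lambda>v. b x * \<Theta> n x v) has_sum b x * infsum (\<Theta> n x) coprime_pairs) coprime_pairs"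
        by (rule has_sum_cmult_right)
      moreover have "infsum (\<Theta> n x) coprime_pairs = (if x \<in> A then of_nat (2 * om) * of_real (Fc x) else 0)"
      proof (cases "2 * om dvd 2 * j + m")
        case True
        then have "x \<in> A" using x by (simp add: A_def js(1))
        then show ?thesis
          using F_coeff_eq_sum_pairs[OF True[unfolded om_def] half[OF js(2)], of n "j - 1 - s"]
          by (simp add: \<Theta>_def js(1) Fc_def om_def)
      next
        case False
        then have "x \<notin> A" by (simp add: A_def js(1))
        then show ?thesis
          using theta_sum_eq_0[OF False[unfolded om_def], of n] by (simp add: \<Theta>_def js(1))
      qed
      ultimately show ?thesis by (simp split: if_splits)
    qed
    have "((\<lambda>v. \<Sum>x\<in>I. b x * \<Theta> n x v) has_sum (\<Sum>x\<in>I. if x \<in> A then b x * (of_nat (2 * om) * of_real (Fc x)) else 0)) coprime_pairs"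
    proof -
      have "((\<lambda>X. \<Sum>x\<in>I. \<Sum>v\<in>X. b x * \<Theta> n x v) \<longlongrightarrow>
          (\<Sum>x\<in>I. if x \<in> A then b x * (of_nat (2 * om) * of_real (Fc x)) else 0)) (finite_subsets_at_top coprime_pairs)"
        by (intro tendsto_sum \<Theta>[unfolded has_sum_def])
      moreover have "(\<lambda>X. \<Sum>x\<in>I. \<Sum>v\<in>X. b x * \<Theta> n x v) = sum (\<lambda>v. \<Sum>x\<in>I. b x * \<Theta> n x v)"
        by (rule ext) (rule sum.swap)
      ultimately show ?thesis unfolding has_sum_def by (simp only:)
    qed
    also have "(\<Sum>x\<in>I. if x \<in> A then b x * (of_nat (2 * om) * of_real (Fc x)) else 0)
        = (\<Sum>x\<in>A. b x * (of_nat (2 * om) * of_real (Fc x)))"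
      using fin by (intro sum.mono_neutral_cong_right) (auto simp: A_def)
    finally have 1: "((\<lambda>v. \<Sum>x\<in>I. b x * \<Theta> n x v) has_sum (\<Sum>x\<in>A. b x * (of_nat (2 * om) * of_real (Fc x)))) coprime_pairs" .
    have "((\<lambda>v. residue (\<lambda>z. F z * poincare_term (m + 2) n v z) \<zz>) has_sum
        residue (\<lambda>z. F z * poincare (m + 2) n z) \<zz>) coprime_pairs"
      by (rule residue_mult_poincare_has_sum[OF _ open_half_strip \<zz>_in_half_strip _ F_V]) (use m(1) Im_half_strip in auto)
    also have "?this \<longleftrightarrow> ((\<lambda>v. \<Sum>x\<in>I. b x * \<Theta> n x v) has_sum
        residue (\<lambda>z. F z * poincare (m + 2) n z) \<zz>) coprime_pairs"
      by (rule has_sum_cong) (rule res)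
    finally have "residue (\<lambda>z. F z * poincare (m + 2) n z) \<zz> = (\<Sum>x\<in>A. b x * (of_nat (2 * om) * of_real (Fc x)))"
      using 1 by (rule has_sum_unique)
    moreover have "2 * c = - (2 * pi * \<i> / om) * residue (\<lambda>z. F z * poincare (m + 2) n z) \<zz>"
      unfolding c_def om_def by (rule fourier_coefficient_eq_residue[OF m hol ness modular g])
    ultimately have "2 * c = (\<Sum>x\<in>A. - (2 * pi * \<i> / om) * (b x * (of_nat (2 * om) * of_real (Fc x))))"
      by (simp only: sum_distrib_left)
    also have "\<dots> = (\<Sum>x\<in>A. 2 * (\<beta> x * of_real (Fc x)))"
      using om by (intro sum.cong refl) (simp add: \<beta>_def)
    also have "\<dots> = 2 * (\<Sum>x\<in>A. \<beta> x * of_real (Fc x))" by (simp only: sum_distrib_left)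
    finally have "c = (\<Sum>x\<in>A. \<beta> x * of_real (Fc x))"
      by (subst (asm) mult_left_cancel) auto
    then show ?thesis by (simp only: c_def Fc_def)
  qed

  \<comment> \<open>the index \<open>(k, l, r)\<close> of an expansion determines the order \<open>j = l + r + 1\<close> of the polar term it comes from\<close>
  define \<iota> where "\<iota> = (\<lambda>(j, s). ((2 * j + m) div (2 * om), s, j - 1 - s))"
  have inj: "inj_on \<iota> A"
    by (rule inj_onI) (auto simp: \<iota>_def A_def I_def)
  have \<iota>: "\<iota> x = (k, snd x, fst x - 1 - snd x) \<Longrightarrow> 2 * k * om = 2 * fst x + m" if "x \<in> A" for x k
    using that by (auto simp: \<iota>_def A_def case_prod_unfold)
  show ?thesis
  proof (rule that[of "\<iota> ` A" "\<lambda>(k, l, r). \<beta> (l + r + 1, l)"])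
    show "finite (\<iota> ` A)" using fin by simp
    fix k l r assume "(k, l, r) \<in> \<iota> ` A"
    then obtain x where x: "x \<in> A" "\<iota> x = (k, l, r)" by force
    then have lr: "l = snd x" "r = fst x - 1 - snd x" by (auto simp: \<iota>_def case_prod_unfold)
    have k: "2 * k * om = 2 * fst x + m" using \<iota>[OF x(1)] x(2) lr by simp
    have sx: "snd x < fst x" using x(1) by (auto simp: A_def I_def)
    have "k \<ge> 1" using k m(1) by (cases k) auto
    moreover have "real (2 * k * omega \<zz>) / 2 - real l \<ge> 2"
      unfolding om_def[symmetric] k lr by (rule half[OF sx])
    ultimately show "k \<ge> 1 \<and> real (2 * k * omega \<zz>) / 2 - real l \<ge> 2" by blast
  next
    fix n
    have "(\<Sum>(k, l, r)\<in>\<iota> ` A. (case (k, l, r) of (k, l, r) \<Rightarrow> \<beta> (l + r + 1, l)) * of_real (F_coeff (2 * k * omega \<zz>) l r \<zz> n))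
        = (\<Sum>x\<in>A. \<beta> x * of_real (F_coeff (2 * fst x + m) (snd x) (fst x - 1 - snd x) \<zz> n))"
    proof (subst sum.reindex[OF inj], rule sum.cong)
      fix x assume x: "x \<in> A"
      obtain k where k: "\<iota> x = (k, snd x, fst x - 1 - snd x)" by (simp add: \<iota>_def case_prod_unfold)
      have "snd x < fst x" using x by (auto simp: A_def I_def)
      then have "(snd x + (fst x - 1 - snd x) + 1, snd x) = x" by (simp add: prod_eq_iff)
      then show "((\<lambda>(k, l, r). (case (k, l, r) of (k, l, r) \<Rightarrow> \<beta> (l + r + 1, l)) * of_real (F_coeff (2 * k * omega \<zz>) l r \<zz> n)) \<circ> \<iota>) x
          = \<beta> x * of_real (F_coeff (2 * fst x + m) (snd x) (fst x - 1 - snd x) \<zz> n)"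
        using \<iota>[OF x k] by (simp add: k om_def)
    qed simp
    with coeff[of n] show "(deriv ^^ n) g 0 / fact n
        = (\<Sum>(k, l, r)\<in>\<iota> ` A. (case (k, l, r) of (k, l, r) \<Rightarrow> \<beta> (l + r + 1, l)) * of_real (F_coeff (2 * k * omega \<zz>) l r \<zz> n))"
      by simp
  qed
qed

lemma F_series_sums:
  assumes "real k / 2 - real l \<ge> 2" "cmod q < exp (- 2 * pi * Im \<zz>)"
  shows "(\<lambda>n. of_real (F_coeff k l r \<zz> n) * q ^ n) sums F_series k l r \<zz> q"
  unfolding F_series_def using F_series_summable[OF assms] by (rule summable_sums)

lemma F_series_holomorphic:
  assumes "real k / 2 - real l \<ge> 2"
  shows "(\<lambda>z. F_series k l r \<zz> (exp (2 * pi * \<i> * z))) holomorphic_on {z. Im z > Im \<zz>}"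
proof -
  have "F_series k l r \<zz> holomorphic_on ball 0 (exp (- 2 * pi * Im \<zz>))"
    by (rule power_series_holomorphic[where a = "\<lambda>n. of_real (F_coeff k l r \<zz> n)"])
      (use F_series_sums[OF assms] in auto)
  moreover have "(\<lambda>z. exp (2 * pi * \<i> * z)) ` {z. Im z > Im \<zz>} \<subseteq> ball 0 (exp (- 2 * pi * Im \<zz>))"
    by auto
  moreover have "(\<lambda>z. exp (2 * pi * \<i> * z)) holomorphic_on {z. Im z > Im \<zz>}"
    by (intro holomorphic_intros)
  ultimately have "(F_series k l r \<zz> \<circ> (\<lambda>z. exp (2 * pi * \<i> * z))) holomorphic_on {z. Im z > Im \<zz>}"
    by (intro holomorphic_on_compose_gen)
  then show ?thesis by (simp add: o_def)
qed

text \<open>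
  The expansion of the Taylor coefficients of \<open>F\<close> at the cusp gives the identity for large
  \<open>Im z\<close>. All orbit points have height at most \<open>Im \<zz>\<close>, so both sides are holomorphic for
  \<open>Im z > Im \<zz>\<close> and the identity persists there.
\<close>
theorem M_space_expansion:
  assumes F: "F \<in> M_space \<zz> \<nu>"
  shows "\<exists>(T :: (nat \<times> nat \<times> nat) set) (\<alpha> :: nat \<times> nat \<times> nat \<Rightarrow> complex).
    finite T \<and>
    (\<forall>(k, l, r)\<in>T. k \<ge> 1) \<and>
    (\<forall>z. Im z > Im \<zz> \<longrightarrow>
      (\<forall>(k, l, r)\<in>T. F_converges (2 * k * omega \<zz>) l r \<zz> (exp (2 * pi * \<i> * z))) \<and>
      F z = (\<Sum>(k, l, r)\<in>T. \<alpha> (k, l, r) * F_series (2 * k * omega \<zz>) l r \<zz> (exp (2 * pi * \<i> * z))))"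
proof -
  obtain w where w: "w < 0" and mero: "F nicely_meromorphic_on upper_half_plane"
    and trans: "\<And>M z. M \<in> SL2Z \<Longrightarrow> Im z > 0 \<Longrightarrow> F (moebius_act M z) = automorphy M z powi w * F z"
    using F by (auto simp: M_space_def meromorphic_modular_form_def upper_half_plane_def)
  have poles: "z \<in> orbit" if "is_pole F z" "Im z > 0" for z
    using F that by (auto simp: M_space_def upper_half_plane_def orbit_def)
  obtain g Y where g0: "g analytic_on {0}" and g: "\<And>z. Im z > Y \<Longrightarrow> F z = g (exp (2 * pi * \<i> * z))"
    using F by (auto simp: M_space_def no_pole_at_cusp_def)
  obtain \<rho> where \<rho>: "\<rho> > 0" "g holomorphic_on ball 0 \<rho>"
    using g0 by (auto simp: analytic_on_def)
  show ?thesis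
  proof (cases "odd w")
    case True
    then have "F z = 0" if "Im z > Im \<zz>" for z
      using odd_weight_eq_0[OF trans True, of z] that Im_\<zz>_bounds(1) by simp
    then show ?thesis by (intro exI[of _ "{}"] exI[of _ "\<lambda>_. 0"]) simp
  next
    case False
    define m where "m = nat (- w)"
    have wm: "w = - int m" using w by (simp add: m_def)
    have m: "m \<ge> 2" "even m" using w False unfolding wm by (auto elim!: evenE)
    have modular: "F (moebius_act M z) = F z / automorphy M z ^ m" if "M \<in> SL2Z" "Im z > 0" for M z
      using trans[OF that] by (simp add: wm power_int_minus divide_inverse mult.commute)
    have hol: "F holomorphic_on {z. Im z > 0} - orbit"
    proof -
      have "F analytic_on {z}" if "z \<in> {z. Im z > 0} - orbit" for z
        using that poles by (intro nicely_meromorphic_on_imp_analytic_at[OF mero]) (auto simp: upper_half_plane_def)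
      then show ?thesis using analytic_on_analytic_at analytic_imp_holomorphic by blast
    qed
    have "F meromorphic_on {\<zz>}"
      using mero Im_\<zz>_bounds(1) unfolding nicely_meromorphic_on_def
      by (auto simp: upper_half_plane_def intro: meromorphic_on_subset)
    then have ness: "not_essential F \<zz>" by (simp add: meromorphic_at_iff)
    obtain T :: "(nat \<times> nat \<times> nat) set" and \<alpha> where T: "finite T"
      "\<And>k l r. (k, l, r) \<in> T \<Longrightarrow> k \<ge> 1 \<and> real (2 * k * omega \<zz>) / 2 - real l \<ge> 2"
      and coeff: "\<And>n. (deriv ^^ n) g 0 / fact n
        = (\<Sum>(k, l, r)\<in>T. \<alpha> (k, l, r) * of_real (F_coeff (2 * k * omega \<zz>) l r \<zz> n))"
      using M_space_fourier_coefficients[OF m hol ness modular \<rho>(2,1) g] by blast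
    define S where "S = (\<lambda>q. \<Sum>(k, l, r)\<in>T. \<alpha> (k, l, r) * F_series (2 * k * omega \<zz>) l r \<zz> q)"
    have norm_q: "cmod (exp (2 * pi * \<i> * z)) = exp (- (2 * pi * Im z))" for z by simp
    have S_sums: "(\<lambda>n. (deriv ^^ n) g 0 / fact n * q ^ n) sums S q" if q: "cmod q < exp (- 2 * pi * Im \<zz>)" for q
    proof -
      have "(\<lambda>n. \<Sum>(k, l, r)\<in>T. \<alpha> (k, l, r) * (of_real (F_coeff (2 * k * omega \<zz>) l r \<zz> n) * q ^ n)) sums S q"
        unfolding S_def case_prod_unfold
        using T(2) q by (intro sums_sum sums_mult F_series_sums) auto
      then show ?thesis
        unfolding coeff by (simp add: sum_distrib_right case_prod_unfold mult.assoc)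
    qed
    define H where "H = {z. Im z > Im \<zz>}"
    have orbit_H: "H \<inter> orbit = {}"
      using orbit_height Im_\<zz>_bounds(1) by (fastforce simp: H_def orbit_def)
    have F_H: "F holomorphic_on H"
      using orbit_H Im_\<zz>_bounds(1) by (intro holomorphic_on_subset[OF hol]) (auto simp: H_def)
    have S_H: "(\<lambda>z. S (exp (2 * pi * \<i> * z))) holomorphic_on H"
      unfolding S_def case_prod_unfold H_def
      using T(2) by (intro holomorphic_on_sum holomorphic_on_mult holomorphic_on_const F_series_holomorphic) auto
    define y0 where "y0 = Max {Y, Im \<zz>, \<bar>ln \<rho>\<bar>}"
    have y0: "Y \<le> y0" "Im \<zz> \<le> y0" "\<bar>ln \<rho>\<bar> \<le> y0" by (auto simp: y0_def)
    have F_eq: "F z = S (exp (2 * pi * \<i> * z))" if "z \<in> H" for z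
    proof (rule analytic_continuation_open[of "{z. Im z > y0}" H F "\<lambda>z. S (exp (2 * pi * \<i> * z))"])
      show "open {z. Im z > y0}" "open H" unfolding H_def by (rule open_halfspace_Im_gt)+
      show "connected H" unfolding H_def by (intro convex_connected convex_halfspace_Im_gt)
      show "{z. Im z > y0} \<noteq> {}"
        by (rule ex_in_conv[THEN iffD1], rule exI[of _ "\<i> * of_real (y0 + 1)"]) simp
      show "{z. Im z > y0} \<subseteq> H" using y0 by (auto simp: H_def)
      fix z assume "z \<in> {z. Im z > y0}"
      then have z: "Im z > Y" "Im z > Im \<zz>" "Im z > \<bar>ln \<rho>\<bar>" using y0 by auto
      define q where "q = exp (2 * pi * \<i> * z)"
      have "- (2 * pi * Im z) < ln \<rho>"
      proof -
        have "1 * Im z \<le> 2 * pi * Im z" using z(3) pi_gt3 by (intro mult_right_mono) auto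
        then show ?thesis using z(3) by linarith
      qed
      then have "exp (- (2 * pi * Im z)) < exp (ln \<rho>)" by simp
      then have "cmod q < \<rho>" using \<rho>(1) by (simp add: q_def)
      then have "(\<lambda>n. (deriv ^^ n) g 0 / fact n * (q - 0) ^ n) sums g q"
        by (intro holomorphic_power_series[OF \<rho>(2)]) simp
      moreover have "(\<lambda>n. (deriv ^^ n) g 0 / fact n * q ^ n) sums S q"
        using z(2) by (intro S_sums) (simp add: q_def)
      ultimately have "g q = S q" by (simp add: sums_unique2)
      then show "F z = S (exp (2 * pi * \<i> * z))" using g[OF z(1)] by (simp add: q_def)
    qed (use that F_H S_H in auto)
    have conv: "F_converges (2 * k * omega \<zz>) l r \<zz> (exp (2 * pi * \<i> * z))"
      if "(k, l, r) \<in> T" "Im z > Im \<zz>" for k l r z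
      unfolding F_converges_def using T(2)[OF that(1)] that(2)
      by (intro conjI allI F_term_summable F_series_summable) (auto simp: norm_q)
    show ?thesis
      using T F_eq conv by (intro exI[of _ T] exI[of _ \<alpha>]) (auto simp: S_def H_def)
  qed
qed

end

theorem theorem1p1:
  fixes \<zz> :: complex and F :: "complex \<Rightarrow> complex"
  assumes "\<zz> \<in> {\<i>, rho}"
    and "F \<in> M_space \<zz> 3"
  shows "\<exists>(T :: (nat \<times> nat \<times> nat) set) (\<alpha> :: nat \<times> nat \<times> nat \<Rightarrow> complex).
    finite T \<and>
    (\<forall>(k, l, r)\<in>T. k \<ge> 1) \<and>
    (\<forall>z. Im z > Im \<zz> \<longrightarrow>
      (\<forall>(k, l, r)\<in>T. F_converges (2 * k * omega \<zz>) l r \<zz> (exp (2 * pi * \<i> * z))) \<and>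
      F z = (\<Sum>(k, l, r)\<in>T. \<alpha> (k, l, r) * F_series (2 * k * omega \<zz>) l r \<zz> (exp (2 * pi * \<i> * z))))"
proof -
  interpret elliptic_point \<zz> by standard (rule assms(1))
  show ?thesis by (rule M_space_expansion[OF assms(2)])
qed

end
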